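(* Let $(X=\operatorname{Spec}R,\mathbb T,\xi)$ be a polarized affine variety of dimension $n$, and let $\mathcal F$ be a linearly bounded filtration on $R$, with volume $S(\mathcal F)$, jumping numbers $a_{m,j}$ and jumping measures $\mu_m$. Then $$S(\mathcal F)=\lim_{m\to\infty}S_m(\mathcal F),$$ where $$S_m(\mathcal F):=\frac{n!}{\operatorname{vol}(\xi)}\int_0^\infty t\,d\mu_m(t)=\frac{n!}{\operatorname{vol}(\xi)\,m^{n+1}}\sum_{j=1}^{N_m}a_{m,j}=\frac1{mN_m}\sum_{j=1}^{N_m}a_{m,j}.$$
   Context: **Setting.** $\mathbb K$ is an algebraically closed field of characteristic $0$. $X=\operatorname{Spec}R$ is a normal affine variety of dimension $n$ with a good action of a split torus $\mathbb T$: $N=\operatorname{Hom}(\mathbb G_m,\mathbb T)$, $M$ the dual lattice, $R=\bigoplus_{\alpha\in\Lambda}R_\alpha$ the weight decomposition with $\Lambda=\{\alpha\in M:R_\alpha\neq0\}$, there is a unique fixed point $0$ (with maximal ideal $\mathfrak m$), it lies in the closure of all orbits, and $R_0=\mathbb K$. The Reeb vector $\xi\in N_{\mathbb R}$ satisfies $\langle\alpha,\xi\rangle>0$ for all $\alpha\in\Lambda\setminus\{0\}$. Put $R_m=\bigoplus_{\langle\alpha,\xi\rangle\le m}R_\alpha$, $N_m=\dim_{\mathbb K}R_m$, $\operatorname{vol}(\xi)=\lim_{m\to\infty}\frac{n!}{m^n}N_m$. **Okounkov body.** Let $\mu_Y:Y\to X$ be a log resolution of $X$ at $\mathfrak m$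 such that $n$ irreducible components $E_1,\dots,E_n$ of $\mu_Y^{-1}(0)$ meet at a point $\eta$, with local equations $x_1,\dots,x_n$ forming a regular system of parameters of $\mathcal O_{Y,\eta}$. Let $v=(v_1,\dots,v_n):\mathcal O_{Y,\eta}\setminus\{0\}\to\mathbb N^n$ (lexicographic order) be the rank $n$ valuation with $v_1=\operatorname{ord}_{E_1}$ and $v_i(f)=\operatorname{ord}_{E_i}\big((f/\prod_{k<i}x_k^{v_k(f)})|_{\bigcap_{j<i}E_j}\big)$ for $2\le i\le n$. Put $\Gamma_m=v(R_m\setminus\{0\})$, $\Gamma=\{(x,m):x\in\Gamma_m,\ m\ge1\}\subset\mathbb N^{n+1}$, and define the convex body $\Delta\subset\mathbb R^n$ by $\Delta\times\{1\}=\Sigma(\Gamma)\cap(\mathbb R^n\times\{1\})$, with $\Sigma(\Gamma)$ the closed convex cone generated by $\Gamma$. Let $\rho$ be Lebesgue measure on $\Delta$. **Filtrations.** A filtration $\mathcal F$ on $R$ is a family of subspaces $\mathcal F^\lambda R$, decreasing in $\lambda\in\mathbb R$, left continuous ($\mathcal F^\lambda R=\bigcap_{\lambda'<\lambda}\mathcal F^{\lambda'}R$ for $\lambda>0$), with $\mathcal F^\lambda R=\bigoplus_\alpha\mathcal F^\lambda R_\alpha$ (where $\mathcal F^\lambda R_\alpha=\mathcal F^\lambda R\cap R_\alpha$), $\mathcal F^\lambda R_\alpha\cdot\mathcal F^{\lambda'}R_{\alpha'}\subseteq\mathcal F^{\lambda+\lambda'}R_{\alpha+\alpha'}$, $\mathcal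 F^0R=R$, and for each $\alpha$, $\mathcal F^\lambda R_\alpha=0$ for $\lambda\gg0$. Put $\mathcal F^\lambda R_m=\bigoplus_{\langle\alpha,\xi\rangle\le m}\mathcal F^\lambda R_\alpha$ and $R_m^t=\mathcal F^{mt}R_m$. The filtration is linearly bounded if $T(\mathcal F)=\sup_m\sup\{t\ge0:R_m^t\ne0\}<\infty$. For $t\ge 0$, $\Delta^t\subset\Delta$ is obtained from $\Gamma^t_m=v(R^t_m\setminus\{0\})$ exactly as $\Delta$ is from $\Gamma_m$. The concave transform is $G:\Delta\to\mathbb R_+$, $G(x)=\sup\{t\ge0:x\in\Delta^t\}$, and $\mu:=G_*\rho$ is a positive measure on $\mathbb R_+$. The volume of $\mathcal F$ is $$S(\mathcal F)=\frac{n!}{\operatorname{vol}(\xi)}\int_0^\infty t\,d\mu(t).$$ **Jumping numbers.** $a_{m,j}=\inf\{\lambda\ge0:\operatorname{codim}_{R_m}\mathcal F^\lambda R_m\ge j\}$ for $1\le j\le N_m$, and $\mu_m=\frac1{m^n}\sum_{j=1}^{N_m}\delta_{a_{m,j}/m}$, a positive measure on $\mathbb R_+$.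
   Formalization: The last printed equality, with (1/(m N_m)) times the sum of the a_{m,j}, fails for finite m (e.g. R=K[x], F^λ=(x^⌈λ⌉): (m+1)/(2m) versus 1/2); it is replaced by the claim that this expression also converges to S(F). *)

theory Defs
  imports
    "HOL-Analysis.Analysis"
    "HOL-Computational_Algebra.Computational_Algebra"
    "HOL-Algebra.Ideal"
    "HOL-Algebra.Generated_Rings"
begin

section \<open>Subrings of a commutative ring\<close>

definition ring_on :: "'a::comm_ring_1 set \<Rightarrow> 'a ring"
  where "ring_on A = \<lparr>carrier = A, monoid.mult = (*), one = 1, ring.zero = 0, add = (+)\<rparr>"

definition krull_dim :: "'a::comm_ring_1 set \<Rightarrow> enat"
  where "krull_dim A = Sup {enat k | k. \<exists>P :: nat \<Rightarrow> 'a set.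
    (\<forall>i\<le>k. primeideal (P i) (ring_on A)) \<and> (\<forall>i<k. P i \<subset> P (Suc i))}"

definition nonunits :: "'a::field set \<Rightarrow> 'a set"
  where "nonunits B = {z \<in> B. \<forall>w\<in>B. z * w \<noteq> 1}"

definition localization_at :: "'a::field set \<Rightarrow> 'a set \<Rightarrow> 'a set"
  where "localization_at A P = {a / b | a b. a \<in> A \<and> b \<in> A \<and> b \<notin> P}"

text \<open>\<open>y 0, \<dots>, y (d - 1)\<close> is a regular system of parameters of the local ring \<open>B\<close> of
  dimension \<open>d\<close>.\<close>

definition regular_parameters :: "'a::field set \<Rightarrow> nat \<Rightarrow> (nat \<Rightarrow> 'a) \<Rightarrow> bool"
  where "regular_parameters B d y \<longleftrightarrow>
    krull_dim B = enat d \<and> y ` {..<d} \<subseteq> B \<and>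
    Idl\<^bsub>ring_on B\<^esub> (y ` {..<d}) = nonunits B"

definition valuation_ring :: "'a::field set \<Rightarrow> bool"
  where "valuation_ring V \<longleftrightarrow> subring V (ring_on UNIV) \<and> (\<forall>z. z \<in> V \<or> inverse z \<in> V)"

definition dominates :: "'a::field set \<Rightarrow> 'a set \<Rightarrow> bool"
  where "dominates V B \<longleftrightarrow> B \<subseteq> V \<and> nonunits B \<subseteq> nonunits V"


section \<open>Polarized affine varieties\<close>

text \<open>The type \<^typ>\<open>'r\<close> is the coordinate ring \<open>R\<close> of \<open>X = Spec R\<close> and \<^typ>\<open>'r fract\<close> its function
  field. The split torus is \<open>\<bbbT> = \<bbbG>\<^sub>m\<^sup>d\<close>, so that \<open>M\<close> is \<^typ>\<open>int^'d\<close>, \<open>N\<^sub>\<real>\<close> is \<^typ>\<open>real^'d\<close>, and an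
  algebraic \<open>\<bbbT>\<close>-action on \<open>X\<close> is an \<open>M\<close>-grading of \<open>R\<close>.\<close>

locale affine_variety = vector_space smul
  for smul :: "'k::{alg_closed_field, field_char_0} \<Rightarrow> 'r::idom \<Rightarrow> 'r" +
  assumes scale_mult: "smul c a * b = smul c (a * b)"
    and finitely_generated:
      "\<exists>S. finite S \<and> generate_ring (ring_on UNIV) (range (\<lambda>c. smul c 1) \<union> S) = UNIV"

locale normal_affine_variety = affine_variety smul
  for smul :: "'k::{alg_closed_field, field_char_0} \<Rightarrow> 'r::idom \<Rightarrow> 'r" +
  assumes normal:
    "\<And>(z :: 'r fract) (p :: 'r poly). lead_coeff p = 1 \<Longrightarrow> poly (map_poly to_fract p) z = 0
      \<Longrightarrow> z \<in> range to_fract"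

definition weight_pairing :: "int^'d \<Rightarrow> real^'d \<Rightarrow> real"
  where "weight_pairing \<alpha> \<xi> = (\<Sum>i\<in>UNIV. of_int (\<alpha> $ i) * \<xi> $ i)"

definition decomposes :: "('m \<Rightarrow> 'r::comm_monoid_add set) \<Rightarrow> 'r \<Rightarrow> ('m \<Rightarrow> 'r) \<Rightarrow> bool"
  where "decomposes gr f c \<longleftrightarrow>
    (\<forall>\<alpha>. c \<alpha> \<in> gr \<alpha>) \<and> finite {\<alpha>. c \<alpha> \<noteq> 0} \<and> f = (\<Sum>\<alpha> | c \<alpha> \<noteq> 0. c \<alpha>)"

definition homogeneous_parts :: "('m \<Rightarrow> 'r::comm_monoid_add set) \<Rightarrow> 'r \<Rightarrow> 'm \<Rightarrow> 'r"
  where "homogeneous_parts gr f = (THE c. decomposes gr f c)"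

text \<open>\<open>torus_act smul gr t\<close> is the algebra automorphism \<open>f \<mapsto> \<Sum>\<^sub>\<alpha> t\<^sup>\<alpha> f\<^sub>\<alpha>\<close> of \<open>R\<close> induced by
  \<open>t \<in> \<bbbT>(\<bbbK>)\<close>.\<close>

definition torus_points :: "('d \<Rightarrow> 'k::field) set"
  where "torus_points = {t. \<forall>i. t i \<noteq> 0}"

definition torus_act ::
  "('k::field \<Rightarrow> 'r::idom \<Rightarrow> 'r) \<Rightarrow> (int^'d \<Rightarrow> 'r set) \<Rightarrow> ('d \<Rightarrow> 'k) \<Rightarrow> 'r \<Rightarrow> 'r"
  where "torus_act smul gr t f =
    (\<Sum>\<alpha> | homogeneous_parts gr f \<alpha> \<noteq> 0.
      smul (\<Prod>i\<in>UNIV. t i powi (\<alpha> $ i)) (homogeneous_parts gr f \<alpha>))"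

text \<open>Closed points of \<open>X\<close> are maximal ideals of \<open>R\<close>; the closure of a set of closed points contains
  \<open>\<mm>\<close> iff the intersection of the corresponding ideals is contained in \<open>\<mm>\<close>.\<close>

locale good_torus_action = normal_affine_variety smul
  for smul :: "'k::{alg_closed_field, field_char_0} \<Rightarrow> 'r::idom \<Rightarrow> 'r" +
  fixes gr :: "int^'d \<Rightarrow> 'r set" and \<mm> :: "'r set"
  assumes gr_subspace: "subspace (gr \<alpha>)"
    and gr_direct_sum: "\<exists>!c. decomposes gr f c"
    and gr_mult: "\<lbrakk>f \<in> gr \<alpha>; g \<in> gr \<beta>\<rbrakk> \<Longrightarrow> f * g \<in> gr (\<alpha> + \<beta>)"
    and gr_zero: "gr 0 = range (\<lambda>c. smul c 1)"
    and unique_fixed_point: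
      "maximalideal p (ring_on UNIV) \<Longrightarrow> (\<forall>t\<in>torus_points. torus_act smul gr t ` p = p) \<longleftrightarrow> p = \<mm>"
    and fixed_point_closed: "maximalideal \<mm> (ring_on UNIV)"
    and fixed_point_in_orbit_closure:
      "maximalideal p (ring_on UNIV) \<Longrightarrow> (\<Inter>t\<in>torus_points. torus_act smul gr t ` p) \<subseteq> \<mm>"

locale polarized_affine_variety = good_torus_action smul gr \<mm>
  for smul :: "'k::{alg_closed_field, field_char_0} \<Rightarrow> 'r::idom \<Rightarrow> 'r"
    and gr :: "int^'d \<Rightarrow> 'r set" and \<mm> :: "'r set" +
  fixes \<xi> :: "real^'d"
  assumes reeb: "\<lbrakk>gr \<alpha> \<noteq> {0}; \<alpha> \<noteq> 0\<rbrakk> \<Longrightarrow> weight_pairing \<alpha> \<xi> > 0"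

definition graded_part ::
  "('k::field \<Rightarrow> 'r::idom \<Rightarrow> 'r) \<Rightarrow> (int^'d \<Rightarrow> 'r set) \<Rightarrow> real^'d \<Rightarrow> nat \<Rightarrow> 'r set"
  where "graded_part smul gr \<xi> m =
    module.span smul (\<Union>\<alpha>\<in>{\<alpha>. weight_pairing \<alpha> \<xi> \<le> real m}. gr \<alpha>)"

definition hilbert_fun ::
  "('k::field \<Rightarrow> 'r::idom \<Rightarrow> 'r) \<Rightarrow> (int^'d \<Rightarrow> 'r set) \<Rightarrow> real^'d \<Rightarrow> nat \<Rightarrow> nat"
  where "hilbert_fun smul gr \<xi> m = vector_space.dim smul (graded_part smul gr \<xi> m)"

definition reeb_volume ::
  "nat \<Rightarrow> ('k::field \<Rightarrow> 'r::idom \<Rightarrow> 'r) \<Rightarrow> (int^'d \<Rightarrow> 'r set) \<Rightarrow> real^'d \<Rightarrow> real"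
  where "reeb_volume n smul gr \<xi> =
    lim (\<lambda>m. fact n / real m ^ n * real (hilbert_fun smul gr \<xi> m))"


section \<open>Log resolutions\<close>

text \<open>An integral scheme that is proper and birational over \<open>X\<close> is represented by the set \<open>Y\<close> of
  its local rings, viewed inside the function field (a complete model over \<open>X\<close> in the sense of
  Zariski): it is covered by finitely many affine schemes of finite type over \<open>X\<close>, and by the
  valuative criterion it is separated and proper over \<open>X\<close> iff every valuation ring of the function
  field containing \<open>R\<close> has exactly one centre on it. For \<open>B, B' \<in> Y\<close>, the point \<open>B\<close> lies in the
  closure of the point \<open>B'\<close> iff \<open>B \<subseteq> B'\<close>.\<close>

definition spec_points :: "'a::field set \<Rightarrow> 'a set set"
  where "spec_points A = {localization_at A P | P. primeideal P (ring_on A)}"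

definition proper_birational_model :: "'r::idom fract set set \<Rightarrow> bool"
  where "proper_birational_model Y \<longleftrightarrow>
    (\<exists>\<A>. finite \<A> \<and>
      (\<forall>A\<in>\<A>. \<exists>S. finite S \<and> A = generate_ring (ring_on UNIV) (range to_fract \<union> S)) \<and>
      Y = (\<Union>A\<in>\<A>. spec_points A)) \<and>
    (\<forall>V. valuation_ring V \<and> range to_fract \<subseteq> V \<longrightarrow> (\<exists>!B. B \<in> Y \<and> dominates V B))"

text \<open>The exceptional locus: the points at which \<open>Y \<rightarrow> X\<close> is not a local isomorphism.\<close>

definition exceptional :: "'r::idom fract set \<Rightarrow> bool"
  where "exceptional B \<longleftrightarrow>
    B \<noteq> localization_at (range to_fract) (range to_fract \<inter> nonunits B)"

text \<open>\<open>Y\<close> is regular, \<open>\<mm> \<O>\<^sub>Y\<close> is the ideal sheaf of an effective divisor, and the union of its support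
  with the exceptional locus is a simple normal crossings divisor: near each point there are regular
  parameters \<open>y\<close> such that \<open>\<mm> \<O>\<^sub>Y\<close> is generated by a monomial in \<open>y\<close> and the exceptional locus
  is the zero locus of a product of some of the \<open>y i\<close>. As \<open>y\<close> lives in the local ring itself and not
  in its completion or henselization, the crossings are simple.\<close>

definition log_resolution :: "'r::idom set \<Rightarrow> 'r fract set set \<Rightarrow> bool"
  where "log_resolution \<mm> Y \<longleftrightarrow> proper_birational_model Y \<and>
    (\<forall>B\<in>Y. \<exists>d y a I. regular_parameters B d y \<and>
      Idl\<^bsub>ring_on B\<^esub> (to_fract ` \<mm>) = PIdl\<^bsub>ring_on B\<^esub> (\<Prod>i<d. y i ^ (a i :: nat)) \<and>
      I \<subseteq> {..<d} \<and>
      (\<forall>Q. primeideal Q (ring_on B) \<longrightarrow>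
        (exceptional (localization_at B Q) \<longleftrightarrow> (\<Prod>i\<in>I. y i) \<in> Q)))"

definition central_fibre :: "'r::idom set \<Rightarrow> 'r fract set set \<Rightarrow> 'r fract set set"
  where "central_fibre \<mm> Y = {B \<in> Y. to_fract ` \<mm> \<subseteq> nonunits B}"

text \<open>The irreducible components of the central fibre, given by their generic points.\<close>

definition fibre_components :: "'r::idom set \<Rightarrow> 'r fract set set \<Rightarrow> 'r fract set set"
  where "fibre_components \<mm> Y =
    {E \<in> central_fibre \<mm> Y. \<forall>B\<in>central_fibre \<mm> Y. E \<subseteq> B \<longrightarrow> B = E}"

text \<open>The components \<open>E 0, \<dots>, E (n - 1)\<close> meet at the point \<open>\<eta>\<close>, where \<open>E i\<close> has the local equation
  \<open>x i\<close>. The ideal of \<open>E i\<close> in the local ring \<open>\<eta>\<close> is \<open>nonunits (E i) \<inter> \<eta>\<close>.\<close>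

definition components_meet_at ::
  "'r::idom set \<Rightarrow> 'r fract set set \<Rightarrow> nat \<Rightarrow> (nat \<Rightarrow> 'r fract set) \<Rightarrow> 'r fract set
    \<Rightarrow> (nat \<Rightarrow> 'r fract) \<Rightarrow> bool"
  where "components_meet_at \<mm> Y n E \<eta> x \<longleftrightarrow>
    \<eta> \<in> Y \<and> inj_on E {..<n} \<and>
    (\<forall>i<n. E i \<in> fibre_components \<mm> Y \<and> \<eta> \<subseteq> E i \<and>
      nonunits (E i) \<inter> \<eta> = PIdl\<^bsub>ring_on \<eta>\<^esub> (x i)) \<and>
    regular_parameters \<eta> n x"


section \<open>The valuation and Okounkov bodies\<close>

text \<open>\<open>flag_ideal B x i\<close> is the ideal of the intersection \<open>Z\<close> of \<open>E 0, \<dots>, E (i - 1)\<close>, and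
  \<open>flag_rest B x f i\<close> represents the function on \<open>Z\<close> obtained from \<open>f\<close> by successively dividing by the
  maximal power of \<open>x k\<close> and restricting to \<open>E k\<close>, for \<open>k < i\<close>. The representative is unique modulo
  \<open>flag_ideal B x i\<close> because \<open>x k\<close> is not a zero divisor modulo \<open>flag_ideal B x k\<close>; the division
  has to be done modulo that ideal, since \<open>f\<close> itself need not be divisible in \<open>B\<close> by
  \<open>\<Prod>k<i. x k ^ flag_val B x f k\<close>.\<close>

definition flag_ideal :: "'a::field set \<Rightarrow> (nat \<Rightarrow> 'a) \<Rightarrow> nat \<Rightarrow> 'a set"
  where "flag_ideal B x i = Idl\<^bsub>ring_on B\<^esub> (x ` {..<i})"

definition order_modulo :: "'a::field set \<Rightarrow> 'a set \<Rightarrow> 'a \<Rightarrow> 'a \<Rightarrow> nat"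
  where "order_modulo B J y f = (GREATEST k. \<exists>h\<in>B. f - y ^ k * h \<in> J)"

primrec flag_rest :: "'a::field set \<Rightarrow> (nat \<Rightarrow> 'a) \<Rightarrow> 'a \<Rightarrow> nat \<Rightarrow> 'a"
  where
    "flag_rest B x f 0 = f"
  | "flag_rest B x f (Suc i) =
      (SOME h. h \<in> B \<and>
        flag_rest B x f i
          - x i ^ order_modulo B (flag_ideal B x i) (x i) (flag_rest B x f i) * h
        \<in> flag_ideal B x i)"

definition flag_val :: "'a::field set \<Rightarrow> (nat \<Rightarrow> 'a) \<Rightarrow> 'a \<Rightarrow> nat \<Rightarrow> nat"
  where "flag_val B x f i = order_modulo B (flag_ideal B x i) (x i) (flag_rest B x f i)"

text \<open>Coordinates of \<open>\<real>\<^sup>n\<close> are indexed by a finite linearly ordered type; \<open>card {..<i}\<close> is the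
  position of the index \<open>i\<close>, counted from \<open>0\<close>.\<close>

definition flag_val_vec ::
  "'r::idom fract set \<Rightarrow> (nat \<Rightarrow> 'r fract) \<Rightarrow> 'r \<Rightarrow> real^'n::{finite, linorder}"
  where "flag_val_vec \<eta> x f = (\<chi> i. real (flag_val \<eta> x (to_fract f) (card {..<i})))"

text \<open>The convex body of a family \<open>W m \<subseteq> R\<close>, \<open>m \<ge> 1\<close>.\<close>

definition value_semigroup ::
  "'r::idom fract set \<Rightarrow> (nat \<Rightarrow> 'r fract) \<Rightarrow> (nat \<Rightarrow> 'r set) \<Rightarrow> ((real^'n::{finite, linorder}) \<times> real) set"
  where "value_semigroup \<eta> x W =
    {(flag_val_vec \<eta> x f, real m) | f m. m \<ge> 1 \<and> f \<in> W m - {0}}"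

definition okounkov_body ::
  "'r::idom fract set \<Rightarrow> (nat \<Rightarrow> 'r fract) \<Rightarrow> (nat \<Rightarrow> 'r set) \<Rightarrow> (real^'n::{finite, linorder}) set"
  where "okounkov_body \<eta> x W =
    {p. (p, 1) \<in> closure (convex_cone hull (value_semigroup \<eta> x W))}"


section \<open>Filtrations\<close>

locale filtration =
  fixes smul :: "'k::field \<Rightarrow> 'r::idom \<Rightarrow> 'r"
    and gr :: "int^'d \<Rightarrow> 'r set" and F :: "real \<Rightarrow> 'r set"
  assumes subspaces: "module.subspace smul (F l)"
    and decreasing: "antimono F"
    and left_continuous: "l > 0 \<Longrightarrow> F l = (\<Inter>l'\<in>{..<l}. F l')"
    and homogeneous: "F l = module.span smul (\<Union>\<alpha>. F l \<inter> gr \<alpha>)"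
    and multiplicative: "\<lbrakk>f \<in> F l \<inter> gr \<alpha>; g \<in> F l' \<inter> gr \<beta>\<rbrakk> \<Longrightarrow> f * g \<in> F (l + l') \<inter> gr (\<alpha> + \<beta>)"
    and at_zero: "F 0 = UNIV"
    and eventually_zero: "\<forall>\<^sub>F l in at_top. F l \<inter> gr \<alpha> = {0}"

definition filtered_part ::
  "('k::field \<Rightarrow> 'r::idom \<Rightarrow> 'r) \<Rightarrow> (int^'d \<Rightarrow> 'r set) \<Rightarrow> real^'d \<Rightarrow> (real \<Rightarrow> 'r set)
    \<Rightarrow> real \<Rightarrow> nat \<Rightarrow> 'r set"
  where "filtered_part smul gr \<xi> F l m =
    module.span smul (\<Union>\<alpha>\<in>{\<alpha>. weight_pairing \<alpha> \<xi> \<le> real m}. F l \<inter> gr \<alpha>)"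

definition slope_part ::
  "('k::field \<Rightarrow> 'r::idom \<Rightarrow> 'r) \<Rightarrow> (int^'d \<Rightarrow> 'r set) \<Rightarrow> real^'d \<Rightarrow> (real \<Rightarrow> 'r set)
    \<Rightarrow> real \<Rightarrow> nat \<Rightarrow> 'r set"
  where "slope_part smul gr \<xi> F t m = filtered_part smul gr \<xi> F (real m * t) m"

text \<open>The supremum is over \<open>m \<ge> 1\<close>: for \<open>m = 0\<close> one has \<open>R\<^sub>0\<^sup>t = \<F>\<^sup>0 R\<^sub>0 \<noteq> 0\<close> for all \<open>t\<close>.\<close>

definition max_slope ::
  "('k::field \<Rightarrow> 'r::idom \<Rightarrow> 'r) \<Rightarrow> (int^'d \<Rightarrow> 'r set) \<Rightarrow> real^'d \<Rightarrow> (real \<Rightarrow> 'r set) \<Rightarrow> ereal"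
  where "max_slope smul gr \<xi> F =
    (SUP m\<in>{1..}. SUP t\<in>{t. t \<ge> 0 \<and> slope_part smul gr \<xi> F t m \<noteq> {0}}. ereal t)"

definition linearly_bounded ::
  "('k::field \<Rightarrow> 'r::idom \<Rightarrow> 'r) \<Rightarrow> (int^'d \<Rightarrow> 'r set) \<Rightarrow> real^'d \<Rightarrow> (real \<Rightarrow> 'r set) \<Rightarrow> bool"
  where "linearly_bounded smul gr \<xi> F \<longleftrightarrow> max_slope smul gr \<xi> F < \<infinity>"

definition concave_transform ::
  "('k::field \<Rightarrow> 'r::idom \<Rightarrow> 'r) \<Rightarrow> (int^'d \<Rightarrow> 'r set) \<Rightarrow> real^'d
    \<Rightarrow> 'r fract set \<Rightarrow> (nat \<Rightarrow> 'r fract) \<Rightarrow> (real \<Rightarrow> 'r set) \<Rightarrow> real^'n::{finite, linorder} \<Rightarrow> real"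
  where "concave_transform smul gr \<xi> \<eta> x F p =
    Sup {t. t \<ge> 0 \<and> p \<in> okounkov_body \<eta> x (slope_part smul gr \<xi> F t)}"

text \<open>The type argument fixes the dimension \<open>n = CARD('n)\<close> of the Okounkov body.\<close>

definition limit_measure ::
  "'n::{finite, linorder} itself \<Rightarrow> ('k::field \<Rightarrow> 'r::idom \<Rightarrow> 'r) \<Rightarrow> (int^'d \<Rightarrow> 'r set) \<Rightarrow> real^'d
    \<Rightarrow> 'r fract set \<Rightarrow> (nat \<Rightarrow> 'r fract) \<Rightarrow> (real \<Rightarrow> 'r set) \<Rightarrow> real measure"
  where "limit_measure (_ :: 'n::{finite, linorder} itself) smul gr \<xi> \<eta> x F =
    distr (restrict_space lborel (okounkov_body \<eta> x (graded_part smul gr \<xi>) :: (real^'n::{finite, linorder}) set))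
      borel (concave_transform smul gr \<xi> \<eta> x F)"

definition filtration_volume ::
  "'n::{finite, linorder} itself \<Rightarrow> ('k::field \<Rightarrow> 'r::idom \<Rightarrow> 'r) \<Rightarrow> (int^'d \<Rightarrow> 'r set) \<Rightarrow> real^'d
    \<Rightarrow> 'r fract set \<Rightarrow> (nat \<Rightarrow> 'r fract) \<Rightarrow> (real \<Rightarrow> 'r set) \<Rightarrow> real"
  where "filtration_volume (N :: 'n::{finite, linorder} itself) smul gr \<xi> \<eta> x F =
    fact CARD('n::{finite, linorder}) / reeb_volume CARD('n::{finite, linorder}) smul gr \<xi>
      * (LINT t:{0..}|limit_measure N smul gr \<xi> \<eta> x F. t)"

definition jumping_number ::
  "('k::field \<Rightarrow> 'r::idom \<Rightarrow> 'r) \<Rightarrow> (int^'d \<Rightarrow> 'r set) \<Rightarrow> real^'d \<Rightarrow> (real \<Rightarrow> 'r set)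
    \<Rightarrow> nat \<Rightarrow> nat \<Rightarrow> real"
  where "jumping_number smul gr \<xi> F m j =
    Inf {l. l \<ge> 0 \<and>
      vector_space.dim smul (graded_part smul gr \<xi> m)
        - vector_space.dim smul (filtered_part smul gr \<xi> F l m) \<ge> j}"

text \<open>The sum of the point masses \<open>\<delta>\<close> at \<open>a\<^sub>m\<^sub>,\<^sub>j / m\<close> is the push-forward of the counting measure on
  \<open>{1..N\<^sub>m}\<close>.\<close>

definition jumping_measure ::
  "nat \<Rightarrow> ('k::field \<Rightarrow> 'r::idom \<Rightarrow> 'r) \<Rightarrow> (int^'d \<Rightarrow> 'r set) \<Rightarrow> real^'d \<Rightarrow> (real \<Rightarrow> 'r set)
    \<Rightarrow> nat \<Rightarrow> real measure"
  where "jumping_measure n smul gr \<xi> F m =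
    scale_measure (ennreal (1 / real m ^ n))
      (distr (count_space {1..hilbert_fun smul gr \<xi> m}) borel
        (\<lambda>j. jumping_number smul gr \<xi> F m j / real m))"

definition filtration_volume_level ::
  "nat \<Rightarrow> ('k::field \<Rightarrow> 'r::idom \<Rightarrow> 'r) \<Rightarrow> (int^'d \<Rightarrow> 'r set) \<Rightarrow> real^'d \<Rightarrow> (real \<Rightarrow> 'r set)
    \<Rightarrow> nat \<Rightarrow> real"
  where "filtration_volume_level n smul gr \<xi> F m =
    fact n / reeb_volume n smul gr \<xi> * (LINT t:{0..}|jumping_measure n smul gr \<xi> F m. t)"

end

theory Submission
  imports Defs "HOL-Library.List_Lexorder"
begin

text \<open>
  Elements of \<open>R\<close> with distinct values under \<open>v\<close> are linearly independent, and \<open>v\<close> has one-dimensional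
  leaves, so \<open>dim \<F>\<^sup>m\<^sup>t R\<^sub>m\<close> is the number of lattice points at height \<open>m\<close> in the semigroup \<open>\<Gamma>\<^sup>t\<close>. For
  almost every point \<open>p\<close> of the Okounkov body, the largest \<open>t\<close> such that \<open>\<Gamma>\<^sup>t\<close> contains the lattice
  point \<open>\<lfloor>m p\<rfloor>\<close> at height \<open>m\<close> converges to the concave transform at \<open>p\<close>. The integral of this step
  function is \<open>m\<^sup>-\<^sup>n\<^sup>-\<^sup>1 \<Sum>\<^sub>j a\<^sub>m\<^sub>,\<^sub>j\<close>, and dominated convergence gives the limit.

  Two facts of algebra enter. The flag ideals are prime, so that \<open>v\<close> is a valuation: a chain of primes
  of maximal length in \<open>\<O>\<^sub>Y\<^sub>,\<^sub>\<eta>\<close> is moved by Krull's principal ideal theorem onto the flag.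
  And \<open>dim R\<^sub>m = O(m\<^sup>n)\<close>: by the Coquand--Lombardi description of Krull dimension, any \<open>n + 1\<close>
  homogeneous generators satisfy a relation that excludes high powers of all of them from a
  lexicographic monomial basis. The growth bound shows that the residue field at \<open>\<eta>\<close> is \<open>\<K>\<close>, and
  it replaces Izumi's theorem in the proof that the Okounkov body is bounded: otherwise the body
  would have infinite volume.
\<close>

section \<open>Ideals of subrings\<close>

text \<open>\<open>regular_parameters\<close> speaks only of Krull dimension and generators, so all
  that the valuation needs (prime flag ideals, finite orders, residue field \<bbbK>) has to be
  derived from these two data; this is why ring theory takes up half of the proof. The bound on
  \<open>dim R_m\<close> is the only growth estimate, and it is used three times: for the residue
  field, for the boundedness of the body and for the finiteness of the levels. The limit that
  defines \<open>reeb_volume\<close> is not known to exist beforehand. It comes out of the same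
  lattice point count, applied to a constant filtration. The delicate slope is the largest one,
  where the semigroup may fail to generate the lattice. The lower estimates therefore use rational
  slopes strictly below a slope whose semigroup is nonempty, and the exceptional points of the
  overview are the frontiers of these countably many convex bodies. Since \<open>vol\<close> is the
  limit of n! N_m / m^n, the normalization by m N_m agrees with the other two only asymptotically,
  and it is given a limit of its own.\<close>

definition is_subring :: "'a::comm_ring_1 set \<Rightarrow> bool"
  where "is_subring B \<longleftrightarrow> 1 \<in> B \<and> (\<forall>a\<in>B. \<forall>b\<in>B. a - b \<in> B \<and> a * b \<in> B)"

definition is_ideal :: "'a::comm_ring_1 set \<Rightarrow> 'a set \<Rightarrow> bool"
  where "is_ideal B I \<longleftrightarrow> I \<subseteq> B \<and> 0 \<in> I \<and> (\<forall>a\<in>I. \<forall>b\<in>I. a + b \<in> I) \<and> (\<forall>a\<in>B. \<forall>b\<in>I. a * b \<in> I)"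

definition is_prime :: "'a::comm_ring_1 set \<Rightarrow> 'a set \<Rightarrow> bool"
  where "is_prime B P \<longleftrightarrow> is_ideal B P \<and> 1 \<notin> P \<and> (\<forall>a\<in>B. \<forall>b\<in>B. a * b \<in> P \<longrightarrow> a \<in> P \<or> b \<in> P)"

definition adjoin :: "'a::comm_ring_1 set \<Rightarrow> 'a set \<Rightarrow> 'a \<Rightarrow> 'a set"
  where "adjoin B I x = {i + b * x | i b. i \<in> I \<and> b \<in> B}"

lemma adjoinI: "i \<in> I \<Longrightarrow> b \<in> B \<Longrightarrow> a = i + b * x \<Longrightarrow> a \<in> adjoin B I x"
  by (auto simp: adjoin_def)

lemma is_subringD:
  assumes "is_subring B"
  shows "1 \<in> B" "0 \<in> B" "a \<in> B \<Longrightarrow> b \<in> B \<Longrightarrow> a - b \<in> B" "a \<in> B \<Longrightarrow> b \<in> B \<Longrightarrow> a * b \<in> B"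
    "a \<in> B \<Longrightarrow> - a \<in> B" "a \<in> B \<Longrightarrow> b \<in> B \<Longrightarrow> a + b \<in> B" "a \<in> B \<Longrightarrow> a ^ k \<in> B"
proof -
  show 1: "1 \<in> B" and d: "\<And>a b. a \<in> B \<Longrightarrow> b \<in> B \<Longrightarrow> a - b \<in> B"
    and m: "\<And>a b. a \<in> B \<Longrightarrow> b \<in> B \<Longrightarrow> a * b \<in> B"
    using assms by (auto simp: is_subring_def)
  show 0: "0 \<in> B" using d[OF 1 1] by simp
  show n: "\<And>a. a \<in> B \<Longrightarrow> - a \<in> B" using d[OF 0] by simp
  show "a \<in> B \<Longrightarrow> b \<in> B \<Longrightarrow> a + b \<in> B" using d[of a "- b"] n by simp
  show "a \<in> B \<Longrightarrow> a ^ k \<in> B" by (induction k) (auto simp: 1 m)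
qed

lemma is_idealD:
  assumes "is_ideal B I"
  shows "I \<subseteq> B" "0 \<in> I" "a \<in> I \<Longrightarrow> b \<in> I \<Longrightarrow> a + b \<in> I" "a \<in> B \<Longrightarrow> b \<in> I \<Longrightarrow> a * b \<in> I"
    "a \<in> I \<Longrightarrow> b \<in> B \<Longrightarrow> a * b \<in> I"
  using assms by (auto simp: is_ideal_def mult.commute)

lemma is_ideal_minus:
  assumes "is_subring B" "is_ideal B I" "a \<in> I" shows "- a \<in> I"
  using is_idealD(4)[OF assms(2) is_subringD(5)[OF assms(1) is_subringD(1)[OF assms(1)]] assms(3)]
  by simp

lemma is_ideal_diff:
  assumes "is_subring B" "is_ideal B I" "a \<in> I" "b \<in> I" shows "a - b \<in> I"
  using is_idealD(3)[OF assms(2,3) is_ideal_minus[OF assms(1,2,4)]] by simp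

lemma is_primeD:
  assumes "is_prime B P"
  shows "is_ideal B P" "1 \<notin> P" "a \<in> B \<Longrightarrow> b \<in> B \<Longrightarrow> a * b \<in> P \<Longrightarrow> a \<in> P \<or> b \<in> P"
  using assms by (auto simp: is_prime_def)

lemma is_prime_power:
  assumes "is_subring B" "is_prime B P" "a \<in> B" "a ^ k \<in> P" shows "a \<in> P"
  using assms(4)
proof (induction k)
  case (Suc k)
  then show ?case using is_primeD(3)[OF assms(2,3) is_subringD(7)[OF assms(1,3)]] by auto
qed (use is_primeD(2)[OF assms(2)] in auto)

lemma is_ideal_adjoin:
  assumes B: "is_subring B" and I: "is_ideal B I" and x: "x \<in> B"
  shows "is_ideal B (adjoin B I x)" "I \<subseteq> adjoin B I x" "x \<in> adjoin B I x"
proof -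
  show "is_ideal B (adjoin B I x)"
    unfolding is_ideal_def
  proof (intro conjI ballI)
    show "adjoin B I x \<subseteq> B"
      using is_subringD[OF B] is_idealD(1)[OF I] x by (auto simp: adjoin_def)
    show "0 \<in> adjoin B I x" using is_idealD(2)[OF I] is_subringD(2)[OF B]
      by (auto simp: adjoin_def intro!: exI[of _ 0])
  next
    fix a b assume "a \<in> adjoin B I x" "b \<in> adjoin B I x"
    then obtain i c j d where "i \<in> I" "j \<in> I" "c \<in> B" "d \<in> B" "a = i + c * x" "b = j + d * x"
      by (auto simp: adjoin_def)
    then show "a + b \<in> adjoin B I x"
      using is_idealD(3)[OF I] is_subringD(6)[OF B]
      by (intro adjoinI[of "i + j" _ "c + d"]) (auto simp: algebra_simps)
  next
    fix a b assume "a \<in> B" "b \<in> adjoin B I x"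
    then obtain j d where "j \<in> I" "d \<in> B" "b = j + d * x" by (auto simp: adjoin_def)
    then show "a * b \<in> adjoin B I x"
      using is_idealD(4)[OF I] is_subringD(4)[OF B] \<open>a \<in> B\<close>
      by (intro adjoinI[of "a * j" _ "a * d"]) (auto simp: algebra_simps)
  qed
  show "I \<subseteq> adjoin B I x"
    using is_subringD(2)[OF B] by (force simp: adjoin_def)
  show "x \<in> adjoin B I x"
    using is_subringD(1)[OF B] is_idealD(2)[OF I]
    by (intro adjoinI[of 0 _ 1]) auto
qed

lemma adjoin_least:
  assumes "is_ideal B H" "I \<subseteq> H" "x \<in> H" shows "adjoin B I x \<subseteq> H"
  using is_idealD[OF assms(1)] assms by (auto simp: adjoin_def)

text \<open>An ideal maximal among those that contain \<open>I\<close> and miss \<open>S\<close> is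
  prime: for \<open>a\<close> and \<open>b\<close> outside it, both enlarged ideals meet
  \<open>S\<close>, and the product of the two elements found lies in \<open>S\<close>, hence not in
  the ideal, although \<open>a * b\<close> in the ideal would force it there. Zorn's lemma is used
  because the rings are not yet Noetherian.\<close>

lemma prime_avoiding:
  assumes B: "is_subring B" and I: "is_ideal B I" and S: "1 \<in> S" "\<And>a b. a \<in> S \<Longrightarrow> b \<in> S \<Longrightarrow> a * b \<in> S"
    and dis: "I \<inter> S = {}"
  obtains P where "is_prime B P" "I \<subseteq> P" "P \<inter> S = {}"
proof -
  let ?F = "{J. is_ideal B J \<and> I \<subseteq> J \<and> J \<inter> S = {}}"
  have "\<exists>P\<in>?F. \<forall>X\<in>?F. P \<subseteq> X \<longrightarrow> X = P"
  proof (rule subset_Zorn_nonempty)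
    show "?F \<noteq> {}" using I dis by auto
    fix C assume C: "C \<noteq> {}" "subset.chain ?F C"
    have CF: "C \<subseteq> ?F" using C(2) by (simp add: subset.chain_def)
    have lin: "X \<subseteq> Y \<or> Y \<subseteq> X" if "X \<in> C" "Y \<in> C" for X Y
      using subset.chain_total[OF C(2) that] by auto
    have "is_ideal B (\<Union>C)"
      unfolding is_ideal_def
    proof (intro conjI ballI)
      show "\<Union>C \<subseteq> B" using CF is_idealD(1) by blast
      show "0 \<in> \<Union>C" using C(1) CF is_idealD(2) by blast
    next
      fix a b assume "a \<in> \<Union>C" "b \<in> \<Union>C"
      then obtain X Y where "X \<in> C" "Y \<in> C" "a \<in> X" "b \<in> Y" by blast
      then obtain Z where "Z \<in> C" "a \<in> Z" "b \<in> Z" using lin by blast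
      then show "a + b \<in> \<Union>C" using CF is_idealD(3) by blast
    next
      fix a b assume "a \<in> B" "b \<in> \<Union>C"
      then show "a * b \<in> \<Union>C" using CF is_idealD(4) by blast
    qed
    then show "\<Union>C \<in> ?F" using C(1) CF by blast
  qed
  then obtain P where P: "is_ideal B P" "I \<subseteq> P" "P \<inter> S = {}"
    and max: "\<And>X. is_ideal B X \<Longrightarrow> P \<subseteq> X \<Longrightarrow> X \<inter> S = {} \<Longrightarrow> X = P"
    by (smt (verit) mem_Collect_eq order_trans)
  have hit: "\<exists>i c. i \<in> P \<and> c \<in> B \<and> i + c * a \<in> S" if "a \<in> B" "a \<notin> P" for a
    using max[OF is_ideal_adjoin(1,2)[OF B P(1) that(1)]] is_ideal_adjoin(3)[OF B P(1) that(1)] that(2)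
    by (auto simp: adjoin_def)
  have "is_prime B P"
    unfolding is_prime_def
  proof (intro conjI ballI impI)
    show "is_ideal B P" by fact
    show "1 \<notin> P" using S(1) P(3) by auto
    fix a b assume ab: "a \<in> B" "b \<in> B" "a * b \<in> P"
    show "a \<in> P \<or> b \<in> P"
    proof (rule ccontr)
      assume n: "\<not> (a \<in> P \<or> b \<in> P)"
      obtain i c where 1: "i \<in> P" "c \<in> B" "i + c * a \<in> S" using hit ab n by blast
      obtain j d where 2: "j \<in> P" "d \<in> B" "j + d * b \<in> S" using hit ab n by blast
      have "(i + c * a) * (j + d * b) = i * (j + d * b) + (c * a * j + c * d * (a * b))"
        by (simp add: algebra_simps)
      also have "\<dots> \<in> P"
        using 1 2 ab is_idealD[OF P(1)] is_subringD[OF B] by (meson subsetD)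
      finally show False using S(2)[OF 1(3) 2(3)] P(3) by blast
    qed
  qed
  then show thesis using that P by blast
qed

subsection \<open>The Coquand--Lombardi criterion for Krull dimension\<close>

text \<open>The iterated boundary of Coquand and Lombardi. Containing 0 means an identity
  \<open>x1^m1 * (x2^m2 * (... (xk^mk * (1 + ak * xk)) ... + a2 * x2) + a1 * x1) = 0\<close>. It
  turns a bound on chains of primes into an equation that can be expanded in monomials.\<close>

primrec boundary_monoid :: "'a::comm_ring_1 set \<Rightarrow> 'a list \<Rightarrow> 'a set" where
  "boundary_monoid B [] = {1}"
| "boundary_monoid B (x # xs) = {x ^ m * (s + a * x) | m s a. s \<in> boundary_monoid B xs \<and> a \<in> B}"

lemma boundary_monoid_mult:
  assumes B: "is_subring B" and xs: "set xs \<subseteq> B"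
  shows "1 \<in> boundary_monoid B xs \<and> boundary_monoid B xs \<subseteq> B \<and>
    (\<forall>a\<in>boundary_monoid B xs. \<forall>b\<in>boundary_monoid B xs. a * b \<in> boundary_monoid B xs)"
  using xs
proof (induction xs)
  case Nil
  then show ?case using is_subringD[OF B] by auto
next
  case (Cons x xs)
  then have x: "x \<in> B" and I1: "1 \<in> boundary_monoid B xs" and I2: "boundary_monoid B xs \<subseteq> B"
    and I3: "\<And>a b. a \<in> boundary_monoid B xs \<Longrightarrow> b \<in> boundary_monoid B xs \<Longrightarrow> a * b \<in> boundary_monoid B xs"
    by auto
  show ?case
  proof (intro conjI ballI)
    show "1 \<in> boundary_monoid B (x # xs)"
      using I1 is_subringD(2)[OF B] unfolding boundary_monoid.simps
      by (intro CollectI exI[of _ "0::nat"] exI[of _ 1] exI[of _ "0"]) auto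
    show "boundary_monoid B (x # xs) \<subseteq> B"
      using I2 x is_subringD[OF B] by auto
    fix a b assume "a \<in> boundary_monoid B (x # xs)" "b \<in> boundary_monoid B (x # xs)"
    then obtain m s c n t d where ab: "a = x ^ m * (s + c * x)" "b = x ^ n * (t + d * x)"
      and st: "s \<in> boundary_monoid B xs" "t \<in> boundary_monoid B xs" "c \<in> B" "d \<in> B" by auto
    have "a * b = x ^ (m + n) * (s * t + (s * d + t * c + c * d * x) * x)"
      by (simp add: ab power_add algebra_simps)
    moreover have "s * d + t * c + c * d * x \<in> B"
      using st I2 x is_subringD[OF B] by (meson subsetD)
    ultimately show "a * b \<in> boundary_monoid B (x # xs)" using I3[OF st(1,2)] by auto
  qed
qed

text \<open>Take a prime \<open>Q\<close> above \<open>I\<close> that misses the monoid of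
  \<open>x # xs\<close>. Then \<open>Q + (x)\<close> misses the monoid of \<open>xs\<close>, because
  \<open>i + b * x\<close> in that monoid would put \<open>i\<close> into the larger one; so the
  chain can be continued above \<open>Q + (x)\<close>. Read backwards: if no chain has length
  \<open>n + 1\<close>, then 0 lies in the monoid of any \<open>n + 1\<close> elements.\<close>

lemma prime_chain_from_boundary:
  assumes B: "is_subring B" and xs: "set xs \<subseteq> B" and I: "is_ideal B I" and dis: "I \<inter> boundary_monoid B xs = {}"
  shows "\<exists>P. (\<forall>i\<le>length xs. is_prime B (P i)) \<and> (\<forall>i<length xs. P i \<subset> P (Suc i)) \<and> I \<subseteq> P 0"
  using xs I dis
proof (induction xs arbitrary: I)
  case Nil
  obtain P where "is_prime B P" "I \<subseteq> P"
    using prime_avoiding[OF B Nil(2), of "boundary_monoid B []"] Nil(3) by auto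
  then show ?case by (auto intro!: exI[of _ "\<lambda>_. P"])
next
  case (Cons x xs)
  note mon = boundary_monoid_mult[OF B Cons.prems(1)]
  obtain Q where Q: "is_prime B Q" "I \<subseteq> Q" "Q \<inter> boundary_monoid B (x # xs) = {}"
    using prime_avoiding[OF B Cons.prems(2), of "boundary_monoid B (x # xs)"] mon Cons.prems(3) by metis
  have x: "x \<in> B" and xs: "set xs \<subseteq> B" using Cons.prems(1) by auto
  note Qi = is_primeD(1)[OF Q(1)]
  have "adjoin B Q x \<inter> boundary_monoid B xs = {}"
  proof (rule ccontr)
    assume "adjoin B Q x \<inter> boundary_monoid B xs \<noteq> {}"
    then obtain i b where "i \<in> Q" "b \<in> B" "i + b * x \<in> boundary_monoid B xs" by (auto simp: adjoin_def)
    then have "x ^ 0 * ((i + b * x) + (- b) * x) \<in> boundary_monoid B (x # xs)"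
      using is_subringD(5)[OF B] unfolding boundary_monoid.simps by blast
    then show False using Q(3) \<open>i \<in> Q\<close> by auto
  qed
  from Cons.IH[OF xs is_ideal_adjoin(1)[OF B Qi x] this]
  obtain P where P: "\<And>i. i \<le> length xs \<Longrightarrow> is_prime B (P i)"
    "\<And>i. i < length xs \<Longrightarrow> P i \<subset> P (Suc i)" "adjoin B Q x \<subseteq> P 0" by blast
  \<comment> \<open>\<open>x\<close> itself belongs to the monoid, hence not to \<open>Q\<close>;
    this makes the inclusion into the next prime strict.\<close>
  have "x ^ 1 * (1 + 0 * x) \<in> boundary_monoid B (x # xs)"
    using boundary_monoid_mult[OF B xs] is_subringD(2)[OF B] unfolding boundary_monoid.simps by blast
  then have "x \<notin> Q" using Q(3) by auto
  then have "Q \<subset> P 0" using is_ideal_adjoin(2,3)[OF B Qi x] P(3) by blast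
  then show ?case
    using P Q by (intro exI[of _ "\<lambda>i. case i of 0 \<Rightarrow> Q | Suc j \<Rightarrow> P j"]) (auto split: nat.splits)
qed

subsection \<open>Noetherian subrings\<close>

definition noeth :: "'a::comm_ring_1 set \<Rightarrow> bool"
  where "noeth B \<longleftrightarrow> is_subring B \<and>
    (\<forall>H :: nat \<Rightarrow> 'a set. (\<forall>k. is_ideal B (H k)) \<longrightarrow> (\<forall>k. H k \<subseteq> H (Suc k)) \<longrightarrow> (\<exists>k. \<forall>l\<ge>k. H l = H k))"

lemma noethD:
  assumes "noeth B"
  shows "is_subring B"
    "\<And>H. (\<And>k. is_ideal B (H k)) \<Longrightarrow> (\<And>k. H k \<subseteq> H (Suc k)) \<Longrightarrow> \<exists>k. \<forall>l\<ge>k. H l = H (k::nat)"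
  using assms by (auto simp: noeth_def)

lemma noeth_maximal:
  assumes "noeth B" "I \<in> F" "\<And>J. J \<in> F \<Longrightarrow> is_ideal B J"
  obtains M where "M \<in> F" "\<And>J. J \<in> F \<Longrightarrow> M \<subseteq> J \<Longrightarrow> J = M"
proof -
  have "wf {(J, I). I \<in> F \<and> J \<in> F \<and> I \<subset> J}"
    unfolding wf_iff_no_infinite_down_chain
  proof
    assume "\<exists>H. \<forall>i. (H (Suc i), H i) \<in> {(J, I). I \<in> F \<and> J \<in> F \<and> I \<subset> J}"
    then obtain H where "\<forall>i. H i \<in> F \<and> H (Suc i) \<in> F \<and> H i \<subset> H (Suc i)" by auto
    then have H: "\<And>i. H i \<in> F" "\<And>i. H i \<subset> H (Suc i)" by auto
    then show False using noethD(2)[OF assms(1), of H] assms(3)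
      by (metis le_SucI order_refl psubset_eq)
  qed
  then show thesis
  proof (rule wfE_min[OF _ assms(2)])
    fix z assume z: "z \<in> F" "\<And>y. (y, z) \<in> {(J, I). I \<in> F \<and> J \<in> F \<and> I \<subset> J} \<Longrightarrow> y \<notin> F"
    show thesis
    proof (rule that[OF z(1)])
      fix J assume "J \<in> F" "z \<subseteq> J"
      then show "J = z"
        by (metis (mono_tags, lifting) case_prodI mem_Collect_eq psubsetI z)
    qed
  qed
qed

lemma noeth_field:
  assumes B: "is_subring B" and inv: "\<And>a. a \<in> B \<Longrightarrow> a \<noteq> 0 \<Longrightarrow> \<exists>b\<in>B. b * a = 1"
  shows "noeth B"
  unfolding noeth_def
proof (intro conjI allI impI B)
  fix H :: "nat \<Rightarrow> 'a set"
  assume H: "\<forall>k. is_ideal B (H k)" "\<forall>k. H k \<subseteq> H (Suc k)"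
  show "\<exists>k. \<forall>l\<ge>k. H l = H k"
  proof (cases "\<exists>k. H k \<noteq> {0}")
    case True
    then obtain k where "H k \<noteq> {0}" by auto
    then obtain a where a: "a \<in> H k" "a \<noteq> 0" using H(1) is_idealD(2) by (metis is_singletonI' is_singleton_def empty_iff singletonD singletonI)
    then obtain b where "b \<in> B" "b * a = 1" using inv H(1) is_idealD(1) by blast
    then have 1: "1 \<in> H k" using a H(1) is_idealD(4) by metis
    have "H l = B" if "l \<ge> k" for l
    proof -
      have "1 \<in> H l" using 1 lift_Suc_mono_le[of H, OF _ that] H(2) by blast
      then show ?thesis using is_idealD(1,5) H(1) by (metis is_idealD(4) mult.right_neutral subsetI subset_antisym)
    qed
    then show ?thesis by (metis order_refl)
  qed auto
qed

section \<open>Hilbert's basis theorem\<close>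

definition poly_ring :: "'a::comm_ring_1 set \<Rightarrow> 'a \<Rightarrow> 'a set"
  where "poly_ring C z = {poly p z | p. \<forall>i. Polynomial.coeff p i \<in> C}"

lemma is_subring_poly_ring:
  assumes C: "is_subring C"
  shows "is_subring (poly_ring C z)" "C \<subseteq> poly_ring C z" "z \<in> poly_ring C z"
    "is_subring D \<Longrightarrow> C \<subseteq> D \<Longrightarrow> z \<in> D \<Longrightarrow> poly_ring C z \<subseteq> D"
proof -
  note S = is_subringD[OF C]
  have sumC: "(\<Sum>i\<in>A. f i) \<in> C" if "\<And>i. i \<in> A \<Longrightarrow> f i \<in> C" for A and f :: "nat \<Rightarrow> 'a"
    using that by (induction A rule: infinite_finite_induct) (auto simp: S)
  show "is_subring (poly_ring C z)"
    unfolding is_subring_def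
  proof (intro conjI ballI)
    show "1 \<in> poly_ring C z" using S by (auto simp: poly_ring_def intro!: exI[of _ 1])
    fix a b assume "a \<in> poly_ring C z" "b \<in> poly_ring C z"
    then obtain p q where pq: "a = poly p z" "b = poly q z" "\<forall>i. Polynomial.coeff p i \<in> C" "\<forall>i. Polynomial.coeff q i \<in> C"
      by (auto simp: poly_ring_def)
    have "a - b = poly (p - q) z" "\<forall>i. Polynomial.coeff (p - q) i \<in> C"
      using pq S by auto
    then show "a - b \<in> poly_ring C z" unfolding poly_ring_def by blast
    have "a * b = poly (p * q) z" "\<forall>i. Polynomial.coeff (p * q) i \<in> C"
      using pq S by (auto simp: coeff_mult intro!: sumC)
    then show "a * b \<in> poly_ring C z" unfolding poly_ring_def by blast
  qed
  show "C \<subseteq> poly_ring C z"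
  proof
    fix c assume "c \<in> C"
    then have "\<forall>i. Polynomial.coeff [:c:] i \<in> C" using S by (auto simp: coeff_pCons split: nat.splits)
    then show "c \<in> poly_ring C z" unfolding poly_ring_def by (intro CollectI exI[of _ "[:c:]"]) simp
  qed
  have "\<forall>i. Polynomial.coeff [:0, 1:] i \<in> C" using S by (auto simp: coeff_pCons split: nat.splits)
  then show "z \<in> poly_ring C z" unfolding poly_ring_def by (intro CollectI exI[of _ "[:0, 1:]"]) simp
  assume D: "is_subring D" "C \<subseteq> D" "z \<in> D"
  have sumD: "(\<Sum>i\<in>A. f i) \<in> D" if "\<And>i. i \<in> A \<Longrightarrow> f i \<in> D" for A and f :: "nat \<Rightarrow> 'a"
    using that by (induction A rule: infinite_finite_induct) (auto simp: is_subringD[OF D(1)])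
  show "poly_ring C z \<subseteq> D"
    using D by (auto simp: poly_ring_def poly_altdef intro!: sumD is_subringD[OF D(1)])
qed

text \<open>The leading coefficient argument. As \<open>z\<close> may be algebraic over
  \<open>C\<close>, it works with polynomials whose value at \<open>z\<close> lies in
  \<open>H k\<close> instead of with elements of \<open>H k\<close>. \<open>LL k d\<close> is the
  ideal of their coefficients of degree \<open>d\<close>; once all \<open>LL k d\<close> are
  constant in \<open>k\<close>, so is \<open>H k\<close>, by induction on the degree: subtract a
  polynomial from the stable stage with the same top coefficient.\<close>

lemma Hilbert_basis:
  assumes C: "noeth C" shows "noeth (poly_ring C z)"
  unfolding noeth_def
proof (intro conjI allI impI)
  note Cs = noethD(1)[OF C]
  note S = is_subringD[OF Cs]
  show "is_subring (poly_ring C z)" by (rule is_subring_poly_ring[OF Cs])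
  fix H :: "nat \<Rightarrow> 'a set"
  assume H: "\<forall>k. is_ideal (poly_ring C z) (H k)" "\<forall>k. H k \<subseteq> H (Suc k)"
  have Hmono: "H k \<subseteq> H l" if "k \<le> l" for k l using lift_Suc_mono_le[of H, OF _ that] H(2) by blast
  note HD = is_idealD[OF H(1)[rule_format]]
  define PP where "PP k d = {p. (\<forall>i. Polynomial.coeff p i \<in> C) \<and> poly p z \<in> H k \<and> Polynomial.degree p \<le> d}" for k d
  define LL where "LL k d = (\<lambda>p. Polynomial.coeff p d) ` PP k d" for k d
  have PR: "poly p z \<in> poly_ring C z" if "\<forall>i. Polynomial.coeff p i \<in> C" for p
    using that by (auto simp: poly_ring_def)
  have LLid: "is_ideal C (LL k d)" for k d
    unfolding is_ideal_def
  proof (intro conjI ballI)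
    show "LL k d \<subseteq> C" by (auto simp: LL_def PP_def)
    have "0 \<in> PP k d" using S HD(2) by (auto simp: PP_def)
    then show "0 \<in> LL k d" unfolding LL_def by force
  next
    fix a b assume "a \<in> LL k d" "b \<in> LL k d"
    then obtain p q where pq: "p \<in> PP k d" "q \<in> PP k d" "a = Polynomial.coeff p d" "b = Polynomial.coeff q d" by (auto simp: LL_def)
    then have "p + q \<in> PP k d" using S HD(3) by (auto simp: PP_def intro: degree_add_le)
    then show "a + b \<in> LL k d" unfolding LL_def using pq by force
  next
    fix a b assume a: "a \<in> C" and "b \<in> LL k d"
    then obtain q where q: "q \<in> PP k d" "b = Polynomial.coeff q d" by (auto simp: LL_def)
    have "Polynomial.smult a q \<in> PP k d" using q a S HD(4) is_subring_poly_ring(2)[OF Cs, of z]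
      by (auto simp: PP_def intro: order_trans[OF degree_smult_le])
    then show "a * b \<in> LL k d" unfolding LL_def using q by force
  qed
  have LLk: "LL k d \<subseteq> LL l d" if "k \<le> l" for k l d
    using Hmono[OF that] by (auto simp: LL_def PP_def)
  have LLd: "LL k d \<subseteq> LL k (Suc d)" for k d
  proof
    fix a assume "a \<in> LL k d"
    then obtain p where p: "p \<in> PP k d" "a = Polynomial.coeff p d" by (auto simp: LL_def)
    have "poly (pCons 0 p) z \<in> H k"
      using p HD(4) is_subring_poly_ring(3)[OF Cs] by (auto simp: PP_def)
    then have "pCons 0 p \<in> PP k (Suc d)" using p S
      by (auto simp: PP_def coeff_pCons split: nat.splits)
    then show "a \<in> LL k (Suc d)" unfolding LL_def using p by force
  qed
  have LLd': "LL k d \<subseteq> LL k e" if "d \<le> e" for k d e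
    using lift_Suc_mono_le[of "LL k", OF LLd that] .
  have "\<exists>k. \<forall>l\<ge>k. LL l l = LL k k"
    by (rule noethD(2)[OF C], rule LLid, rule order_trans[OF LLd LLk]) simp
  then obtain k0 where k0: "\<And>l. l \<ge> k0 \<Longrightarrow> LL l l = LL k0 k0" by blast
  have "\<exists>k. \<forall>l\<ge>k. LL l d = LL k d" for d
    by (rule noethD(2)[OF C], rule LLid, rule LLk) simp
  then obtain kd where kd: "\<And>d l. l \<ge> kd d \<Longrightarrow> LL l d = LL (kd d) d" by metis
  \<comment> \<open>Past \<open>k0\<close> the diagonal \<open>LL l l\<close> is constant, which
    settles all degrees \<open>d \<ge> k0\<close>. The finitely many lower degrees stabilize at
    stages \<open>kd d\<close> of their own, and the sum dominates each of these.\<close>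
  define k1 where "k1 = k0 + (\<Sum>d<k0. kd d)"
  have eq: "LL l d \<subseteq> LL k1 d" if l: "l \<ge> k1" for l d
  proof (cases "d < k0")
    case True
    have "kd d \<le> k1" unfolding k1_def using True member_le_sum[of d "{..<k0}" kd] by simp
    then show ?thesis using kd[of d] l by (metis order_refl order_trans)
  next
    case False
    have "LL l d \<subseteq> LL (max l d) (max l d)" using LLk[of l "max l d" d] LLd'[of d "max l d" "max l d"] by auto
    also have "\<dots> = LL k0 k0" by (rule k0) (use l in \<open>auto simp: k1_def\<close>)
    also have "\<dots> \<subseteq> LL k1 d" using LLk[of k0 k1] LLd'[of k0 d] False by (auto simp: k1_def)
    finally show ?thesis .
  qed
  have "H l \<subseteq> H k1" if l: "l \<ge> k1" for l
  proof -
    have claim: "poly p z \<in> H k1" if "p \<in> PP l d" for p d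
      using that
    proof (induction d arbitrary: p)
      case 0
      then have "Polynomial.coeff p 0 \<in> LL k1 0" using eq[OF l, of 0] by (auto simp: LL_def)
      then obtain q where q: "q \<in> PP k1 0" "Polynomial.coeff p 0 = Polynomial.coeff q 0" by (auto simp: LL_def)
      have "Polynomial.degree p = 0" "Polynomial.degree q = 0" using 0 q(1) by (auto simp: PP_def)
      then have "p = q" using q(2) by (metis degree_0_id)
      then show ?case using q by (simp add: PP_def)
    next
      case (Suc d)
      then have "Polynomial.coeff p (Suc d) \<in> LL k1 (Suc d)" using eq[OF l, of "Suc d"] by (auto simp: LL_def)
      then obtain q where q: "q \<in> PP k1 (Suc d)" "Polynomial.coeff p (Suc d) = Polynomial.coeff q (Suc d)" by (auto simp: LL_def)
      have "Polynomial.degree (p - q) \<le> Suc d" using Suc.prems q by (auto simp: PP_def intro: degree_diff_le)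
      moreover have "Polynomial.coeff (p - q) (Suc d) = 0" using q by simp
      ultimately have deg: "Polynomial.degree (p - q) \<le> d"
        by (metis (no_types) Polynomial.degree_0 le_Suc_eq leading_coeff_0_iff zero_le)
      have "poly p z - poly q z \<in> H l"
        using is_ideal_diff[OF is_subring_poly_ring(1)[OF Cs] H(1)[rule_format]] Suc.prems q Hmono[OF l]
        by (auto simp: PP_def)
      then have "p - q \<in> PP l d" using Suc.prems q deg S by (auto simp: PP_def)
      then have "poly (p - q) z \<in> H k1" by (rule Suc.IH)
      moreover have "poly q z \<in> H k1" using q by (auto simp: PP_def)
      ultimately have "poly (p - q) z + poly q z \<in> H k1" by (rule HD(3))
      then show ?case by simp
    qed
    show ?thesis
    proof
      fix a assume a: "a \<in> H l"
      then obtain p where "a = poly p z" "\<forall>i. Polynomial.coeff p i \<in> C" using HD(1) by (force simp: poly_ring_def)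
      then show "a \<in> H k1" using claim[of p "Polynomial.degree p"] a by (auto simp: PP_def)
    qed
  qed
  then show "\<exists>k. \<forall>l\<ge>k. H l = H k" using Hmono by (meson subset_antisym)
qed

text \<open>The ring \<open>C[S]\<close>, built by adjoining one generator at a time. It is
  described by minimality so that it can later be identified with a ring given by
  \<open>generate_ring\<close>.\<close>

lemma noeth_finitely_generated:
  assumes C: "noeth C" and S: "finite S"
  shows "\<exists>Z. noeth Z \<and> C \<subseteq> Z \<and> S \<subseteq> Z \<and> (\<forall>D. is_subring D \<longrightarrow> C \<subseteq> D \<longrightarrow> S \<subseteq> D \<longrightarrow> Z \<subseteq> D)"
  using S
proof (induction S)
  case empty
  then show ?case using C by auto
next
  case (insert s S)
  then obtain Z where Z: "noeth Z" "C \<subseteq> Z" "S \<subseteq> Z" "\<And>D. is_subring D \<Longrightarrow> C \<subseteq> D \<Longrightarrow> S \<subseteq> D \<Longrightarrow> Z \<subseteq> D" by blast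
  note pr = is_subring_poly_ring[OF noethD(1)[OF Z(1)], where z = s]
  show ?case
    using Hilbert_basis[OF Z(1), where z = s] pr Z by (intro exI[of _ "poly_ring Z s"]) (metis insert_subset order_trans)
qed

subsection \<open>Krull's principal ideal theorem\<close>

lemma adjoin_mono: "I \<subseteq> J \<Longrightarrow> adjoin B I x \<subseteq> adjoin B J x"
  by (auto simp: adjoin_def)

lemma not_nonunit:
  assumes "z \<in> B" "z \<notin> nonunits B" obtains w where "w \<in> B" "z * w = 1"
  using assms by (auto simp: nonunits_def)

lemma one_notin_nonunits: "is_subring B \<Longrightarrow> 1 \<notin> nonunits B"
  using is_subringD(1) by (auto simp: nonunits_def)

lemma nonunits_proper_ideal:
  assumes "is_ideal B I" "1 \<notin> I" shows "I \<subseteq> nonunits B"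
  using is_idealD(1,5)[OF assms(1)] assms(2) by (force simp: nonunits_def)

lemma is_prime_nonunits:
  assumes B: "is_subring B" and M: "is_ideal B (nonunits B)" shows "is_prime B (nonunits B)"
  unfolding is_prime_def
proof (intro conjI ballI impI M one_notin_nonunits[OF B])
  fix a b assume ab: "a \<in> B" "b \<in> B" "a * b \<in> nonunits B"
  show "a \<in> nonunits B \<or> b \<in> nonunits B"
  proof (rule ccontr)
    assume "\<not> (a \<in> nonunits B \<or> b \<in> nonunits B)"
    then obtain c d where cd: "c \<in> B" "a * c = 1" "d \<in> B" "b * d = 1" using ab not_nonunit by metis
    have "a * b * (c * d) = (a * c) * (b * d)" by (simp add: algebra_simps)
    then have "a * b * (c * d) = 1" using cd by simp
    then show False using ab(3) cd is_subringD(4)[OF B] by (auto simp: nonunits_def)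
  qed
qed

text \<open>Nakayama's lemma and Krull's intersection theorem in the one form that is used. The
  ideals \<open>J + (f k)\<close> increase, so \<open>f (Suc k) = i + b * f k\<close> for some
  \<open>k\<close>; then \<open>(1 - b * x) * f (Suc k)\<close> lies in \<open>J\<close> and
  \<open>1 - b * x\<close> is a unit. Membership in \<open>J\<close> then descends from
  \<open>f (Suc k)\<close> to \<open>f 0\<close>.\<close>

lemma infinitely_divisible:
  fixes f :: "nat \<Rightarrow> 'a::field"
  assumes B: "noeth B" and M: "is_ideal B (nonunits B)" and J: "is_ideal B J"
    and x: "x \<in> nonunits B" and f: "\<And>k. f k \<in> B" "\<And>k. f k - x * f (Suc k) \<in> J"
  shows "f 0 \<in> J"
proof -
  note Bs = noethD(1)[OF B]
  note S = is_subringD[OF Bs]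
  have xB: "x \<in> B" using x by (simp add: nonunits_def)
  define H where "H k = adjoin B J (f k)" for k
  note ad = is_ideal_adjoin[OF Bs J f(1), folded H_def]
  have "H k \<subseteq> H (Suc k)" for k
    unfolding H_def
  proof (rule adjoin_least)
    show "is_ideal B (adjoin B J (f (Suc k)))" "J \<subseteq> adjoin B J (f (Suc k))" using ad by (auto simp: H_def)
    show "f k \<in> adjoin B J (f (Suc k))" by (rule adjoinI[OF f(2)[of k] xB]) simp
  qed
  then obtain k where k: "\<And>l. l \<ge> k \<Longrightarrow> H l = H k" using noethD(2)[OF B, of H] ad(1) by blast
  have "f (Suc k) \<in> H k" using ad(3)[of "Suc k"] unfolding k[OF le_SucI[OF order_refl]] .
  then obtain i b where ib: "i \<in> J" "b \<in> B" "f (Suc k) = i + b * f k" by (auto simp: H_def adjoin_def)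
  have bx: "b * x \<in> nonunits B" by (rule is_idealD(4)[OF M ib(2) x])
  have "1 - b * x \<notin> nonunits B"
  proof
    assume "1 - b * x \<in> nonunits B"
    from is_idealD(3)[OF M this bx] show False using one_notin_nonunits[OF Bs] by simp
  qed
  then obtain w where w: "w \<in> B" "(1 - b * x) * w = 1" using S(1) S(3)[OF S(1) S(4)[OF ib(2) xB]] not_nonunit by metis
  have "w * ((1 - b * x) * f (Suc k)) = ((1 - b * x) * w) * f (Suc k)" by (simp only: mult_ac)
  then have "f (Suc k) = w * ((1 - b * x) * f (Suc k))" using w(2) by simp
  also have "(1 - b * x) * f (Suc k) = i + b * (f k - x * f (Suc k))" by (simp add: ib(3) algebra_simps)
  also have "w * \<dots> \<in> J" using w ib f(2) is_idealD[OF J] by blast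
  finally have fk: "f (Suc k) \<in> J" .
  have "f (Suc k - j) \<in> J" for j
  proof (induction j)
    case (Suc j)
    show ?case
    proof (cases "j < Suc k")
      case True
      then obtain i where i: "Suc k - j = Suc i" "Suc k - Suc j = i" by (metis Suc_diff_Suc diff_Suc_Suc)
      have "(f i - x * f (Suc i)) + x * f (Suc i) \<in> J" using Suc i f(2) is_idealD[OF J] xB by metis
      then show ?thesis using i by simp
    qed (use Suc in simp)
  qed (use fk in simp)
  from this[of "Suc k"] show ?thesis by simp
qed

text \<open>Says that \<open>B / I\<close> is Artinian without forming the quotient, so that all
  ideals remain subsets of the same field.\<close>

definition dcc_above :: "'a::field set \<Rightarrow> 'a set \<Rightarrow> bool"
  where "dcc_above B I \<longleftrightarrow> (\<forall>H :: nat \<Rightarrow> 'a set. (\<forall>k. is_ideal B (H k)) \<longrightarrow> (\<forall>k. I \<subseteq> H k) \<longrightarrow>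
    (\<forall>k. H (Suc k) \<subseteq> H k) \<longrightarrow> (\<exists>k. \<forall>l\<ge>k. H l = H k))"

definition colon :: "'a::field set \<Rightarrow> 'a set \<Rightarrow> 'a \<Rightarrow> 'a set"
  where "colon B I a = {c \<in> B. c * a \<in> I}"

lemma is_ideal_colon:
  assumes B: "is_subring B" and I: "is_ideal B I" and a: "a \<in> B"
  shows "is_ideal B (colon B I a)" "I \<subseteq> colon B I a"
  using is_subringD[OF B] is_idealD[OF I] a
  by (auto simp: is_ideal_def colon_def distrib_right mult.assoc)

text \<open>The exact sequence with terms \<open>B / (I : a)\<close>, \<open>B / I\<close> and
  \<open>B / (I + (a))\<close>, whose first map is multiplication by \<open>a\<close>: a descending
  chain is controlled by the two chains \<open>H k : a\<close> and \<open>H k + (a)\<close>.\<close>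

lemma dcc_above_extension:
  assumes B: "is_subring B" and I: "is_ideal B I" and a: "a \<in> B"
    and 1: "dcc_above B (adjoin B I a)" and 2: "dcc_above B (colon B I a)"
  shows "dcc_above B I"
  unfolding dcc_above_def
proof (intro allI impI)
  fix H :: "nat \<Rightarrow> 'a set"
  assume id: "\<forall>k. is_ideal B (H k)" and IH: "\<forall>k. I \<subseteq> H k" and dec: "\<forall>k. H (Suc k) \<subseteq> H k"
  have anti: "H l \<subseteq> H k" if "k \<le> l" for k l using lift_Suc_antimono_le[of H, OF _ that] dec by blast
  have "\<exists>k. \<forall>l\<ge>k. adjoin B (H l) a = adjoin B (H k) a"
  proof (rule 1[unfolded dcc_above_def, rule_format])
    fix k
    show "is_ideal B (adjoin B (H k) a)" using is_ideal_adjoin(1)[OF B _ a] id by blast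
    show "adjoin B I a \<subseteq> adjoin B (H k) a" "adjoin B (H (Suc k)) a \<subseteq> adjoin B (H k) a"
      using IH dec by (auto intro!: adjoin_mono)
  qed
  then obtain k1 where k1: "\<And>l. l \<ge> k1 \<Longrightarrow> adjoin B (H l) a = adjoin B (H k1) a" by blast
  have "\<exists>k. \<forall>l\<ge>k. colon B (H l) a = colon B (H k) a"
  proof (rule 2[unfolded dcc_above_def, rule_format])
    fix k
    show "is_ideal B (colon B (H k) a)" using is_ideal_colon(1)[OF B _ a] id by blast
    show "colon B I a \<subseteq> colon B (H k) a" "colon B (H (Suc k)) a \<subseteq> colon B (H k) a"
      using IH dec by (auto simp: colon_def)
  qed
  then obtain k2 where k2: "\<And>l. l \<ge> k2 \<Longrightarrow> colon B (H l) a = colon B (H k2) a" by blast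
  define k where "k = max k1 k2"
  have "H k \<subseteq> H l" if l: "l \<ge> k" for l
  proof
    fix h assume h: "h \<in> H k"
    have "adjoin B (H l) a = adjoin B (H k) a" using k1[of l] k1[of k] l by (auto simp: k_def)
    then have "h \<in> adjoin B (H l) a" using h is_ideal_adjoin(2)[OF B _ a] id by blast
    then obtain g c where g: "g \<in> H l" "c \<in> B" "h = g + c * a" by (auto simp: adjoin_def)
    have "h - g \<in> H k" using is_ideal_diff[OF B] id h g(1) anti[OF l] by blast
    then have "c \<in> colon B (H k) a" using g by (simp add: colon_def)
    also have "colon B (H k) a = colon B (H l) a" using k2[of l] k2[of k] l by (auto simp: k_def)
    finally have "c * a \<in> H l" by (simp add: colon_def)
    then show "h \<in> H l" using g is_idealD(3)[OF id[rule_format]] by auto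
  qed
  then show "\<exists>k. \<forall>l\<ge>k. H l = H k" using anti by (meson subset_antisym)
qed

text \<open>Noetherian induction: an ideal maximal among those above \<open>I\<close> that violate
  the chain condition is prime by \<open>dcc_above_extension\<close>, hence equal to the maximal
  ideal. But above that one there are only two ideals.\<close>

lemma dcc_above_if_unique_prime:
  assumes B: "noeth B" and M: "is_ideal B (nonunits B)" and I: "is_ideal B I"
    and uniq: "\<And>P. is_prime B P \<Longrightarrow> I \<subseteq> P \<Longrightarrow> P = nonunits B"
  shows "dcc_above B I"
proof (rule ccontr)
  assume "\<not> dcc_above B I"
  then have IF: "I \<in> {J. is_ideal B J \<and> I \<subseteq> J \<and> \<not> dcc_above B J}" using I by auto
  obtain N where N: "is_ideal B N" "I \<subseteq> N" "\<not> dcc_above B N"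
    and max: "\<And>J. is_ideal B J \<Longrightarrow> N \<subseteq> J \<Longrightarrow> J \<noteq> N \<Longrightarrow> dcc_above B J"
    using noeth_maximal[OF B IF] by (smt (verit) mem_Collect_eq subset_trans)
  note Bs = noethD(1)[OF B]
  have ideal_unit: "J = B" if "is_ideal B J" "1 \<in> J" for J
    using is_idealD(1,5)[OF that(1)] that(2) by (metis mult_1 subsetI subset_antisym)
  have "is_prime B N"
    unfolding is_prime_def
  proof (intro conjI ballI impI N(1))
    show "1 \<notin> N"
    proof
      assume "1 \<in> N"
      then have "H k = B" if "\<forall>k. is_ideal B (H k)" "\<forall>k. N \<subseteq> H k" for H and k :: nat
        using ideal_unit that by blast
      then show False using N(3) unfolding dcc_above_def by metis
    qed
    fix a b assume ab: "a \<in> B" "b \<in> B" "a * b \<in> N"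
    show "a \<in> N \<or> b \<in> N"
    proof (rule ccontr)
      assume n: "\<not> (a \<in> N \<or> b \<in> N)"
      have "dcc_above B (adjoin B N a)"
        using max is_ideal_adjoin[OF Bs N(1) ab(1)] n by blast
      moreover have "b \<in> colon B N a" using ab by (simp add: colon_def mult.commute)
      then have "dcc_above B (colon B N a)"
        using max is_ideal_colon[OF Bs N(1) ab(1)] n by blast
      ultimately show False using dcc_above_extension[OF Bs N(1) ab(1)] N(3) by blast
    qed
  qed
  then have NM: "N = nonunits B" using uniq N(2) by blast
  have "dcc_above B N"
    unfolding dcc_above_def
  proof (intro allI impI)
    fix H :: "nat \<Rightarrow> 'a set"
    assume id: "\<forall>k. is_ideal B (H k)" and IH: "\<forall>k. N \<subseteq> H k" and dec: "\<forall>k. H (Suc k) \<subseteq> H k"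
    have anti: "H l \<subseteq> H k" if "k \<le> l" for k l using lift_Suc_antimono_le[of H, OF _ that] dec by blast
    have two: "H k = N \<or> H k = B" for k
    proof (cases "1 \<in> H k")
      case False
      then have "H k \<subseteq> N" using nonunits_proper_ideal id NM by blast
      then show ?thesis using IH by auto
    qed (use ideal_unit id in blast)
    show "\<exists>k. \<forall>l\<ge>k. H l = H k"
    proof (cases "\<exists>k. H k = N")
      case True
      then obtain k where "H k = N" ..
      then have "\<forall>l\<ge>k. H l = H k" using anti IH by (metis subset_antisym)
      then show ?thesis ..
    next
      case False
      then show ?thesis using two by metis
    qed
  qed
  then show False using N(3) by blast
qed

text \<open>The ideals \<open>I k\<close> below replace the symbolic powers of \<open>Q\<close>: modulo \<open>Q'\<close>, \<open>I k\<close> is the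
  contraction of \<open>a\<^sup>k B\<^sub>Q\<close>, where \<open>a\<close> is any element of \<open>Q\<close> outside \<open>Q'\<close>.\<close>

lemma principal_ideal_theorem_local:
  fixes B :: "'a::field set"
  assumes B: "noeth B" and M: "is_ideal B (nonunits B)"
    and Q': "is_prime B Q'" and Q: "is_prime B Q" and lt: "Q' \<subset> Q" "Q \<subset> nonunits B" and x: "x \<in> nonunits B"
  shows "\<exists>P. is_prime B P \<and> Q' \<subseteq> P \<and> x \<in> P \<and> P \<subset> nonunits B"
proof (rule ccontr)
  assume no: "\<not> ?thesis"
  note Bs = noethD(1)[OF B]
  note S = is_subringD[OF Bs]
  note q' = is_idealD[OF is_primeD(1)[OF Q']]
  note q = is_idealD[OF is_primeD(1)[OF Q]]
  have xB: "x \<in> B" using x by (simp add: nonunits_def)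
  have xQ: "x \<notin> Q" using no Q lt by blast
  have sub: "P \<subseteq> nonunits B" if "is_prime B P" for P
    using nonunits_proper_ideal is_primeD(1,2)[OF that] by blast
  note adQ' = is_ideal_adjoin[OF Bs is_primeD(1)[OF Q'] xB]
  \<comment> \<open>If the claim fails, the maximal ideal is the only prime above
    \<open>Q' + (x)\<close>, so that quotient is Artinian.\<close>
  have dcc: "dcc_above B (adjoin B Q' x)"
    by (rule dcc_above_if_unique_prime[OF B M adQ'(1)]) (use no sub adQ' in blast)
  obtain a where a: "a \<in> Q" "a \<notin> Q'" using lt by blast
  have aB: "a \<in> B" using a q(1) by blast
  define I where "I k = {f \<in> B. \<exists>s c. s \<in> B \<and> s \<notin> Q \<and> c \<in> B \<and> s * f - a ^ k * c \<in> Q'}" for k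
  have nQ: "s * t \<notin> Q" if "s \<in> B" "t \<in> B" "s \<notin> Q" "t \<notin> Q" for s t
    using is_primeD(3)[OF Q] that by blast
  have id: "is_ideal B (I k)" for k
    unfolding is_ideal_def
  proof (intro conjI ballI)
    show "I k \<subseteq> B" by (auto simp: I_def)
    show "0 \<in> I k" using S(1,2) is_primeD(2)[OF Q] q'(2) unfolding I_def
      by (intro CollectI conjI exI[of _ 1] exI[of _ 0]) auto
  next
    fix f g assume "f \<in> I k" "g \<in> I k"
    then obtain s c t d where *: "f \<in> B" "g \<in> B" "s \<in> B" "s \<notin> Q" "c \<in> B" "s * f - a ^ k * c \<in> Q'"
      "t \<in> B" "t \<notin> Q" "d \<in> B" "t * g - a ^ k * d \<in> Q'" by (auto simp: I_def)
    have "t * (s * f - a ^ k * c) + s * (t * g - a ^ k * d) \<in> Q'"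
      by (rule q'(3)[OF q'(4) q'(4)]) (use * in auto)
    then have "(s * t) * (f + g) - a ^ k * (t * c + s * d) \<in> Q'" by (simp add: algebra_simps)
    then show "f + g \<in> I k" using * S nQ unfolding I_def
      by (intro CollectI conjI exI[of _ "s * t"] exI[of _ "t * c + s * d"]) auto
  next
    fix b f assume b: "b \<in> B" and "f \<in> I k"
    then obtain s c where *: "f \<in> B" "s \<in> B" "s \<notin> Q" "c \<in> B" "s * f - a ^ k * c \<in> Q'" by (auto simp: I_def)
    have "b * (s * f - a ^ k * c) \<in> Q'" by (rule q'(4)) (use * b in auto)
    then have "s * (b * f) - a ^ k * (b * c) \<in> Q'" by (simp add: algebra_simps)
    then show "b * f \<in> I k" using * b S unfolding I_def
      by (intro CollectI conjI exI[of _ s] exI[of _ "b * c"]) auto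
  qed
  have dec: "I (Suc k) \<subseteq> I k" for k
  proof
    fix f assume "f \<in> I (Suc k)"
    then obtain s c where *: "f \<in> B" "s \<in> B" "s \<notin> Q" "c \<in> B" "s * f - a ^ Suc k * c \<in> Q'"
      by (auto simp: I_def)
    have "a ^ Suc k * c = a ^ k * (a * c)" by (simp only: power_Suc2 mult.assoc)
    with *(5) have "s * f - a ^ k * (a * c) \<in> Q'" by (simp only:)
    with * S(4)[OF aB *(4)] show "f \<in> I k" unfolding I_def by blast
  qed
  have Q'I: "Q' \<subseteq> I k" for k
    unfolding I_def using q'(1) S(1,2) is_primeD(2)[OF Q]
    by (intro subsetI CollectI conjI exI[of _ 1] exI[of _ 0]) auto
  \<comment> \<open>\<open>x\<close> is outside \<open>Q\<close>, so it can be absorbed into the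
    denominator \<open>s\<close>.\<close>
  have cancel: "f \<in> I k" if "f \<in> B" "x * f \<in> I k" for f k
  proof -
    obtain s c where *: "s \<in> B" "s \<notin> Q" "c \<in> B" "s * (x * f) - a ^ k * c \<in> Q'"
      using \<open>x * f \<in> I k\<close> unfolding I_def by blast
    then show ?thesis unfolding I_def using that(1) S(4)[OF _ xB] nQ[OF _ xB _ xQ]
      by (intro CollectI conjI exI[of _ "s * x"] exI[of _ c]) (auto simp: mult.assoc)
  qed
  have "\<exists>k. \<forall>l\<ge>k. adjoin B (I l) x = adjoin B (I k) x"
  proof (rule dcc[unfolded dcc_above_def, rule_format])
    fix k
    note ad = is_ideal_adjoin[OF Bs id xB]
    show "is_ideal B (adjoin B (I k) x)" by (rule ad)
    show "adjoin B Q' x \<subseteq> adjoin B (I k) x"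
      using adjoin_least[OF ad(1)] Q'I ad(2,3) by blast
    show "adjoin B (I (Suc k)) x \<subseteq> adjoin B (I k) x"
      using adjoin_least[OF ad(1)] dec ad(2,3) by blast
  qed
  then obtain k where "adjoin B (I (Suc k)) x = adjoin B (I k) x" by (metis le_SucI order_refl)
  \<comment> \<open>Stability of \<open>I k + (x)\<close> together with \<open>cancel\<close> gives
    \<open>I k = I (Suc k) + x * I k\<close>, the situation of Nakayama's lemma.\<close>
  then have step: "\<exists>g f'. g \<in> I (Suc k) \<and> f' \<in> I k \<and> f = g + x * f'" if f: "f \<in> I k" for f
  proof -
    have "f \<in> adjoin B (I (Suc k)) x"
      using \<open>adjoin B (I (Suc k)) x = _\<close> is_ideal_adjoin(2)[OF Bs id xB] f by blast
    then obtain g b where g: "g \<in> I (Suc k)" "b \<in> B" "f = g + b * x" by (auto simp: adjoin_def)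
    then have "f - g \<in> I k" using is_ideal_diff[OF Bs id f] dec by blast
    then have "b \<in> I k" using cancel[OF g(2)] g(3) by (simp add: mult.commute)
    then show ?thesis using g by (metis mult.commute)
  qed
  have ak: "a ^ k \<in> I k" unfolding I_def using S aB q'(2) is_primeD(2)[OF Q]
    by (intro CollectI conjI exI[of _ 1]) auto
  obtain f where f: "f 0 = a ^ k" "\<And>i. f i \<in> I k" "\<And>i. f i - x * f (Suc i) \<in> I (Suc k)"
  proof -
    obtain h where h: "\<And>f. f \<in> I k \<Longrightarrow> h f \<in> I k \<and> f - x * h f \<in> I (Suc k)"
      using step by (metis add_diff_cancel_right')
    have "(h ^^ i) (a ^ k) \<in> I k" for i by (induction i) (use ak h in auto)
    then show thesis using that[of "\<lambda>i. (h ^^ i) (a ^ k)"] h by auto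
  qed
  have "f 0 \<in> I (Suc k)"
    by (rule infinitely_divisible[OF B M id x]) (use f is_idealD(1)[OF id] in auto)
  then obtain s c where *: "s \<in> B" "s \<notin> Q" "c \<in> B" "s * a ^ k - a ^ Suc k * c \<in> Q'"
    by (auto simp: I_def f)
  \<comment> \<open>As \<open>a\<close> is outside the prime \<open>Q'\<close>, the factor
    \<open>a ^ k\<close> cancels. This leaves \<open>s\<close> in \<open>Q\<close>, against its
    being a denominator.\<close>
  then have "a ^ k * (s - a * c) \<in> Q'" by (simp add: algebra_simps)
  then have "s - a * c \<in> Q'"
    using is_primeD(3)[OF Q' S(7)[OF aB] S(3)[OF *(1) S(4)[OF aB *(3)]]]
      is_prime_power[OF Bs Q' aB] a(2) by blast
  then have "s - a * c \<in> Q" using lt(1) by blast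
  then have "(s - a * c) + a * c \<in> Q" by (rule q(3)) (rule q(5)[OF a(1) *(3)])
  then show False using * by simp
qed

section \<open>Localization at a prime inside the ambient field\<close>

definition ext_ideal :: "'a::field set \<Rightarrow> 'a set \<Rightarrow> 'a set \<Rightarrow> 'a set"
  where "ext_ideal A P I = {a / s | a s. a \<in> I \<and> s \<in> A \<and> s \<notin> P}"

context
  fixes A P :: "'a::field set"
  assumes A: "is_subring A" and P: "is_prime A P"
begin


lemma ext_idealI: "a \<in> I \<Longrightarrow> s \<in> A \<Longrightarrow> s \<notin> P \<Longrightarrow> z = a / s \<Longrightarrow> z \<in> ext_ideal A P I"
  by (auto simp: ext_ideal_def)

lemma denominators:
  "0 \<in> P" "s \<in> A \<Longrightarrow> s \<notin> P \<Longrightarrow> s \<noteq> 0" "s \<in> A \<Longrightarrow> s \<notin> P \<Longrightarrow> t \<in> A \<Longrightarrow> t \<notin> P \<Longrightarrow> s * t \<notin> P"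
  using is_idealD(2)[OF is_primeD(1)[OF P]] is_primeD(3)[OF P] by auto

lemma localization_eq_ext_ideal: "localization_at A P = ext_ideal A P A"
  by (auto simp: localization_at_def ext_ideal_def)

lemma is_subring_localization: "is_subring (localization_at A P)" "A \<subseteq> localization_at A P"
proof -
  note S = is_subringD[OF A]
  show "A \<subseteq> localization_at A P"
    using S(1) is_primeD(2)[OF P] by (auto simp: localization_eq_ext_ideal intro: ext_idealI[of _ _ 1])
  then have 1: "1 \<in> localization_at A P" using S(1) by auto
  show "is_subring (localization_at A P)"
    unfolding is_subring_def
  proof (intro conjI ballI 1)
    fix a b assume "a \<in> localization_at A P" "b \<in> localization_at A P"
    then obtain c s d t where *: "c \<in> A" "s \<in> A" "s \<notin> P" "d \<in> A" "t \<in> A" "t \<notin> P" "a = c / s" "b = d / t"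
      by (auto simp: localization_at_def)
    show "a - b \<in> localization_at A P"
      unfolding localization_eq_ext_ideal
      by (rule ext_idealI[of "c * t - d * s" _ "s * t"]) (use * S denominators in \<open>auto simp: field_simps\<close>)
    show "a * b \<in> localization_at A P"
      unfolding localization_eq_ext_ideal
      by (rule ext_idealI[of "c * d" _ "s * t"]) (use * S denominators in auto)
  qed
qed

lemma is_ideal_extend:
  assumes I: "is_ideal A I" shows "is_ideal (localization_at A P) (ext_ideal A P I)"
  unfolding is_ideal_def
proof (intro conjI ballI)
  note S = is_subringD[OF A]
  note i = is_idealD[OF I]
  show "ext_ideal A P I \<subseteq> localization_at A P" using i(1) by (auto simp: ext_ideal_def localization_at_def)
  show "0 \<in> ext_ideal A P I" using S(1) is_primeD(2)[OF P] i(2) by (auto intro!: ext_idealI[of 0 _ 1])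
  fix a b assume b: "b \<in> ext_ideal A P I"
  then obtain d t where d: "d \<in> I" "t \<in> A" "t \<notin> P" "b = d / t" by (auto simp: ext_ideal_def)
  { assume "a \<in> ext_ideal A P I"
    then obtain c s where "c \<in> I" "s \<in> A" "s \<notin> P" "a = c / s" by (auto simp: ext_ideal_def)
    then show "a + b \<in> ext_ideal A P I" using d i S denominators
      by (intro ext_idealI[of "c * t + d * s" _ "s * t"]) (auto simp: add_frac_eq) }
  { assume "a \<in> localization_at A P"
    then obtain c s where "c \<in> A" "s \<in> A" "s \<notin> P" "a = c / s" by (auto simp: localization_at_def)
    then show "a * b \<in> ext_ideal A P I" using d i S denominators
      by (intro ext_idealI[of "c * d" _ "s * t"]) auto }
qed

lemma is_ideal_contract:
  assumes "is_ideal (localization_at A P) H" shows "is_ideal A (H \<inter> A)"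
  using is_idealD[OF assms] is_subringD[OF A] is_subring_localization(2)
  by (auto simp: is_ideal_def subset_iff)

lemma extend_contract:
  assumes H: "is_ideal (localization_at A P) H" shows "ext_ideal A P (H \<inter> A) = H"
proof
  note S = is_subringD[OF A]
  show "ext_ideal A P (H \<inter> A) \<subseteq> H"
  proof
    fix z assume "z \<in> ext_ideal A P (H \<inter> A)"
    then obtain a s where a: "a \<in> H" "s \<in> A" "s \<notin> P" "z = a / s" by (auto simp: ext_ideal_def)
    have "1 / s \<in> localization_at A P" using a S(1) by (auto simp: localization_at_def)
    then have "1 / s * a \<in> H" using is_idealD(4)[OF H] a(1) by blast
    then show "z \<in> H" using a by simp
  qed
  show "H \<subseteq> ext_ideal A P (H \<inter> A)"
  proof
    fix z assume z: "z \<in> H"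
    then obtain a s where a: "a \<in> A" "s \<in> A" "s \<notin> P" "z = a / s"
      using is_idealD(1)[OF H] by (auto simp: localization_at_def)
    have "s * z \<in> H" using is_idealD(4)[OF H _ z] a is_subring_localization(2) by blast
    then show "z \<in> ext_ideal A P (H \<inter> A)" using a denominators by (auto intro!: ext_idealI[of a _ s])
  qed
qed

lemma noeth_localization:
  assumes "noeth A" shows "noeth (localization_at A P)"
  unfolding noeth_def
proof (intro conjI allI impI is_subring_localization)
  fix H :: "nat \<Rightarrow> 'a set"
  assume H: "\<forall>k. is_ideal (localization_at A P) (H k)" "\<forall>k. H k \<subseteq> H (Suc k)"
  have "\<exists>k. \<forall>l\<ge>k. H l \<inter> A = H k \<inter> A"
    using noethD(2)[OF assms, of "\<lambda>k. H k \<inter> A"] H is_ideal_contract by blast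
  then show "\<exists>k. \<forall>l\<ge>k. H l = H k" using extend_contract H(1) by metis
qed

lemma extend_prime:
  assumes Q: "is_prime A Q" "Q \<subseteq> P"
  shows "is_prime (localization_at A P) (ext_ideal A P Q)" "ext_ideal A P Q \<inter> A = Q"
proof -
  note S = is_subringD[OF A]
  note q = is_idealD[OF is_primeD(1)[OF Q(1)]]
  have nQ: "s \<notin> Q" if "s \<notin> P" for s using that Q(2) by blast
  have key: "a \<in> Q" if "a \<in> A" "s \<in> A" "s \<notin> P" "a / s \<in> ext_ideal A P Q" for a s
  proof -
    obtain b t where b: "b \<in> Q" "t \<in> A" "t \<notin> P" "a / s = b / t"
      using \<open>a / s \<in> ext_ideal A P Q\<close> unfolding ext_ideal_def by blast
    then have "t * a = s * b" using denominators that by (auto simp: field_simps)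
    then have "t * a \<in> Q" using b q(4) that by auto
    then show "a \<in> Q" using is_primeD(3)[OF Q(1) b(2) that(1)] nQ b(3) by blast
  qed
  show int: "ext_ideal A P Q \<inter> A = Q"
  proof
    show "ext_ideal A P Q \<inter> A \<subseteq> Q" using key[of _ 1] S(1) is_primeD(2)[OF P] by auto
    show "Q \<subseteq> ext_ideal A P Q \<inter> A" using q(1) S(1) is_primeD(2)[OF P] by (auto intro: ext_idealI[of _ _ 1])
  qed
  show "is_prime (localization_at A P) (ext_ideal A P Q)"
    unfolding is_prime_def
  proof (intro conjI ballI impI is_ideal_extend is_primeD(1)[OF Q(1)])
    show "1 \<notin> ext_ideal A P Q" using int is_primeD(2)[OF Q(1)] S(1) by blast
    fix a b assume "a \<in> localization_at A P" "b \<in> localization_at A P" and ab: "a * b \<in> ext_ideal A P Q"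
    then obtain c s d t where *: "c \<in> A" "s \<in> A" "s \<notin> P" "d \<in> A" "t \<in> A" "t \<notin> P" "a = c / s" "b = d / t"
      by (auto simp: localization_at_def)
    have "(c * d) / (s * t) \<in> ext_ideal A P Q" using ab *(7,8) by simp
    then have "c * d \<in> Q" by (intro key[of "c * d" "s * t"] S(4) denominators(3) *)
    then have "c \<in> Q \<or> d \<in> Q" using is_primeD(3)[OF Q(1)] * by blast
    then show "a \<in> ext_ideal A P Q \<or> b \<in> ext_ideal A P Q" using * by (auto simp: ext_ideal_def)
  qed
qed

lemma contract_prime:
  assumes "is_prime (localization_at A P) H" shows "is_prime A (H \<inter> A)"
  using is_ideal_contract[OF is_primeD(1)[OF assms]] is_primeD(2,3)[OF assms] is_subring_localization(2)
    is_subringD(4)[OF A]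
  by (auto simp: is_prime_def)

lemma nonunits_localization: "nonunits (localization_at A P) = ext_ideal A P P"
proof
  note S = is_subringD[OF A]
  show "ext_ideal A P P \<subseteq> nonunits (localization_at A P)"
    using nonunits_proper_ideal[OF is_ideal_extend[OF is_primeD(1)[OF P]]]
      is_primeD(2)[OF extend_prime(1)[OF P]] by blast
  show "nonunits (localization_at A P) \<subseteq> ext_ideal A P P"
  proof
    fix z assume z: "z \<in> nonunits (localization_at A P)"
    then obtain a s where a: "a \<in> A" "s \<in> A" "s \<notin> P" "z = a / s" by (auto simp: nonunits_def localization_at_def)
    have "a \<in> P"
    proof (rule ccontr)
      assume "a \<notin> P"
      then have "s / a \<in> localization_at A P" "z * (s / a) = 1"
        using a denominators by (auto simp: localization_at_def)
      then show False using z by (auto simp: nonunits_def)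
    qed
    then show "z \<in> ext_ideal A P P" using a by (auto simp: ext_ideal_def)
  qed
qed

lemma is_ideal_nonunits_localization: "is_ideal (localization_at A P) (nonunits (localization_at A P))"
  using is_ideal_extend[OF is_primeD(1)[OF P]] by (simp add: nonunits_localization)

text \<open>Krull's theorem relative to \<open>Q'\<close>: modulo \<open>Q'\<close> the prime
  \<open>P\<close> has height at least 2, so it cannot be minimal over \<open>x\<close>. Localizing
  at \<open>P\<close> turns \<open>P\<close> into the set of nonunits, and the prime found there is
  contracted.\<close>

lemma principal_ideal_theorem:
  assumes N: "noeth A" and Q': "is_prime A Q'" and Q: "is_prime A Q" and lt: "Q' \<subset> Q" "Q \<subset> P" and x: "x \<in> P"
  shows "\<exists>P'. is_prime A P' \<and> Q' \<subseteq> P' \<and> x \<in> P' \<and> P' \<subset> P"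
proof -
  let ?L = "localization_at A P"
  note e' = extend_prime[OF Q'] and e = extend_prime[OF Q] and eP = extend_prime[OF P order_refl]
  have s': "Q' \<subseteq> P" "Q \<subseteq> P" using lt by auto
  have mono: "ext_ideal A P I \<subseteq> ext_ideal A P J" if "I \<subseteq> J" for I J using that by (auto simp: ext_ideal_def)
  have "ext_ideal A P Q' \<noteq> ext_ideal A P Q" "ext_ideal A P Q \<noteq> ext_ideal A P P"
    using e'(2)[OF s'(1)] e(2)[OF s'(2)] eP(2) lt by (metis order_less_irrefl)+
  then have "ext_ideal A P Q' \<subset> ext_ideal A P Q" "ext_ideal A P Q \<subset> nonunits ?L"
    using mono[of Q' Q] mono[of Q P] s' lt unfolding nonunits_localization by (meson psubset_eq)+
  moreover have "x \<in> nonunits ?L" using x eP(2) unfolding nonunits_localization by blast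
  ultimately obtain H where H: "is_prime ?L H" "ext_ideal A P Q' \<subseteq> H" "x \<in> H" "H \<subset> nonunits ?L"
    using principal_ideal_theorem_local[OF noeth_localization[OF N] is_ideal_nonunits_localization
        e'(1)[OF s'(1)] e(1)[OF s'(2)]] by metis
  have "H \<inter> A \<noteq> P"
    using H(4) extend_contract[OF is_primeD(1)[OF H(1)]] unfolding nonunits_localization by (metis order_less_irrefl)
  moreover have "H \<inter> A \<subseteq> P" using H(4) eP(2) unfolding nonunits_localization by blast
  moreover have "x \<in> A" using x is_idealD(1)[OF is_primeD(1)[OF P]] by blast
  moreover have "Q' \<subseteq> H \<inter> A" using H(2) e'(2)[OF s'(1)] by blast
  ultimately show ?thesis using contract_prime[OF H(1)] H(3)
    by (intro exI[of _ "H \<inter> A"]) blast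
qed

end

text \<open>Works from the top down. The last prime but one is replaced by a prime that contains
  \<open>x\<close> and lies strictly between its two neighbours; then the shorter chain that ends in
  the new prime is treated in the same way, until \<open>x\<close> has reached the second member.
  Both ends stay in place.\<close>

lemma chain_exchange:
  fixes B :: "'a::field set"
  assumes B: "noeth B"
  assumes "\<And>i. i \<le> Suc r \<Longrightarrow> is_prime B (P i)" "\<And>i. i \<le> r \<Longrightarrow> P i \<subset> P (Suc i)" "x \<in> P (Suc r)"
  shows "\<exists>Q. (\<forall>i\<le>Suc r. is_prime B (Q i)) \<and> (\<forall>i\<le>r. Q i \<subset> Q (Suc i)) \<and> Q 0 = P 0 \<and> Q (Suc r) = P (Suc r) \<and> x \<in> Q 1"
  using assms(2-)
proof (induction r arbitrary: P)
  case 0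
  then show ?case by (intro exI[of _ P]) auto
next
  case (Suc r)
  obtain P' where P': "is_prime B P'" "P r \<subset> P'" "x \<in> P'" "P' \<subset> P (Suc (Suc r))"
  proof (cases "x \<in> P (Suc r)")
    case True
    then show ?thesis using that[of "P (Suc r)"] Suc.prems by auto
  next
    case False
    have "P r \<subset> P (Suc r)" using Suc.prems(2)[of r] by simp
    \<comment> \<open>This makes the inclusion of \<open>P r\<close> in the new prime strict, as the
      new prime contains \<open>x\<close>.\<close>
    then have "x \<notin> P r" using False by blast
    then show ?thesis
      using principal_ideal_theorem[OF noethD(1)[OF B] Suc.prems(1) B Suc.prems(1) Suc.prems(1), of "Suc (Suc r)" r "Suc r" x]
        Suc.prems(2)[of r] Suc.prems(2)[of "Suc r"] Suc.prems(3) that by auto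
  qed
  define T where "T = P(Suc r := P')"
  have "\<exists>Q. (\<forall>i\<le>Suc r. is_prime B (Q i)) \<and> (\<forall>i\<le>r. Q i \<subset> Q (Suc i)) \<and> Q 0 = T 0 \<and> Q (Suc r) = T (Suc r) \<and> x \<in> Q 1"
    by (rule Suc.IH) (use Suc.prems P' in \<open>auto simp: T_def le_Suc_eq\<close>)
  then obtain Q where Q: "\<And>i. i \<le> Suc r \<Longrightarrow> is_prime B (Q i)" "\<And>i. i \<le> r \<Longrightarrow> Q i \<subset> Q (Suc i)"
    "Q 0 = P 0" "Q (Suc r) = P'" "x \<in> Q 1" by (auto simp: T_def)
  then show ?case using P' Suc.prems
    by (intro exI[of _ "Q(Suc (Suc r) := P (Suc (Suc r)))"]) (auto simp: le_Suc_eq)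
qed

text \<open>The \<open>k\<close>-th exchange is applied to the segment from \<open>Q k\<close>
  upwards. It fixes \<open>Q k\<close> and everything below, so the parameters treated before stay
  where they are.\<close>

lemma chain_through_parameters:
  fixes B :: "'a::field set"
  assumes B: "noeth B" and M: "is_ideal B (nonunits B)" and x: "x ` {..<n} \<subseteq> nonunits B"
    and P: "\<And>i. i \<le> n \<Longrightarrow> is_prime B (P i)" "\<And>i. i < n \<Longrightarrow> P i \<subset> P (Suc i)" and k: "k \<le> n"
  shows "\<exists>Q. (\<forall>i\<le>n. is_prime B (Q i)) \<and> (\<forall>i<n. Q i \<subset> Q (Suc i)) \<and> Q n = nonunits B \<and> (\<forall>j<k. x j \<in> Q (Suc j))"
  using k
proof (induction k)
  case 0
  \<comment> \<open>The last prime may be enlarged to the maximal ideal without losing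
    strictness.\<close>
  define Q where "Q = P(n := nonunits B)"
  have "P n \<subseteq> nonunits B" using nonunits_proper_ideal is_primeD(1,2)[OF P(1)] by blast
  then have "Q i \<subset> Q (Suc i)" if "i < n" for i using P(2)[OF that] that by (auto simp: Q_def) 
  then show ?case using P(1) is_prime_nonunits[OF noethD(1)[OF B] M]
    by (intro exI[of _ Q]) (auto simp: Q_def)
next
  case (Suc k)
  then obtain Q where Q: "\<And>i. i \<le> n \<Longrightarrow> is_prime B (Q i)" "\<And>i. i < n \<Longrightarrow> Q i \<subset> Q (Suc i)" "Q n = nonunits B"
    "\<And>j. j < k \<Longrightarrow> x j \<in> Q (Suc j)" by auto
  define r where "r = n - Suc k"
  have n: "n = k + Suc r" using Suc.prems by (simp add: r_def)
  have "x k \<in> Q (k + Suc r)" using x Q(3) n by auto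
  from chain_exchange[OF B, of r "\<lambda>i. Q (k + i)", OF _ _ this]
  obtain T where T: "\<And>i. i \<le> Suc r \<Longrightarrow> is_prime B (T i)" "\<And>i. i \<le> r \<Longrightarrow> T i \<subset> T (Suc i)" "T 0 = Q k"
    "T (Suc r) = Q (k + Suc r)" "x k \<in> T 1" using Q n by auto
  define U where "U i = (if i < k then Q i else T (i - k))" for i
  have "is_prime B (U i)" if "i \<le> n" for i using that Q(1) T(1) n by (auto simp: U_def)
  moreover have "U i \<subset> U (Suc i)" if "i < n" for i
  proof -
    consider "Suc i < k" | "Suc i = k" | "k \<le> i" by linarith
    then show ?thesis
    proof cases
      case 1 then show ?thesis using Q(2)[OF that] by (simp add: U_def)
    next
      case 2 then show ?thesis using Q(2)[OF that] T(3) by (auto simp: U_def)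
    next
      case 3 then show ?thesis using T(2)[of "i - k"] that n by (auto simp: U_def Suc_diff_le)
    qed
  qed
  moreover have "U n = nonunits B" using T(4) Q(3) n by (simp add: U_def)
  moreover have "x j \<in> U (Suc j)" if "j < Suc k" for j
  proof (cases "j = k")
    case True then show ?thesis using T(5) by (simp add: U_def)
  next
    case False
    then show ?thesis using Q(4)[of j] that T(3) by (cases "Suc j = k") (auto simp: U_def)
  qed
  ultimately show ?case by blast
qed

section \<open>Flags in regular local rings\<close>

lemma ring_on_simps [simp]:
  "carrier (ring_on A) = A" "mult (ring_on A) = (*)" "one (ring_on A) = 1"
  "zero (ring_on A) = 0" "add (ring_on A) = (+)"
  by (simp_all add: ring_on_def)

lemma cring_ring_on: assumes "is_subring B" shows "cring (ring_on B)"
proof -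
  note S = is_subringD[OF assms]
  show ?thesis
  proof (rule cringI)
    show "abelian_group (ring_on B)"
    proof (rule abelian_groupI; simp add: S add_ac)
      fix x assume "x \<in> B"
      then show "\<exists>y\<in>B. x + y = 0" using S(5) by (intro bexI[of _ "- x"]) auto
    qed
    show "comm_monoid (ring_on B)"
      by (rule comm_monoidI) (auto simp: S mult_ac)
  qed (auto simp: distrib_right)
qed

lemma uminus_ring_on: assumes "is_subring B" "a \<in> B" shows "\<ominus>\<^bsub>ring_on B\<^esub> a = - a"
proof -
  interpret cring "ring_on B" by (rule cring_ring_on[OF assms(1)])
  show ?thesis
    by (rule minus_equality) (use assms is_subringD(5)[OF assms(1)] in auto)
qed

lemma ideal_ring_on: assumes B: "is_subring B" shows "ideal I (ring_on B) \<longleftrightarrow> is_ideal B I"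
proof
  interpret cring "ring_on B" by (rule cring_ring_on[OF B])
  note S = is_subringD[OF B]
  show "is_ideal B I" if "ideal I (ring_on B)"
  proof -
    interpret ideal I "ring_on B" by fact
    show ?thesis
      using a_subset zero_closed a_closed I_l_closed by (auto simp: is_ideal_def)
  qed
  show "ideal I (ring_on B)" if I: "is_ideal B I"
  proof (rule idealI)
    show "ring (ring_on B)" by (rule local.ring_axioms)
    show "subgroup I (add_monoid (ring_on B))"
    proof (rule group.subgroupI)
      show "group (add_monoid (ring_on B))" by (rule add.is_group)
      show "I \<subseteq> carrier (add_monoid (ring_on B))" "I \<noteq> {}" using is_idealD[OF I] by auto
      fix a assume "a \<in> I"
      then show "inv\<^bsub>add_monoid (ring_on B)\<^esub> a \<in> I"
        using uminus_ring_on[OF B, of a] is_idealD(1)[OF I] is_ideal_minus[OF B I] by (auto simp: a_inv_def)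
    qed (use is_idealD[OF I] in auto)
  qed (use is_idealD[OF I] in auto)
qed

lemma primeideal_ring_on: assumes B: "is_subring B" shows "primeideal P (ring_on B) \<longleftrightarrow> is_prime B P"
proof -
  have "is_ideal B P \<Longrightarrow> B \<noteq> P \<longleftrightarrow> 1 \<notin> P"
    using is_idealD(1,5)[of B P] is_subringD(1)[OF B] by (metis mult_1 subsetI subset_antisym)
  then show ?thesis
    using cring_ring_on[OF B]
    by (auto simp: primeideal_def primeideal_axioms_def is_prime_def ideal_ring_on[OF B])
qed

lemma is_subring_UNIV: "is_subring UNIV"
  by (simp add: is_subring_def)

lemma generate_ring_ring_on:
  fixes T :: "'a::comm_ring_1 set"
  shows "is_subring (generate_ring (ring_on UNIV) T)" "T \<subseteq> generate_ring (ring_on UNIV) T"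
    "is_subring D \<Longrightarrow> T \<subseteq> D \<Longrightarrow> generate_ring (ring_on UNIV) T \<subseteq> D"
proof -
  note u = uminus_ring_on[OF is_subring_UNIV, simplified]
  show "is_subring (generate_ring (ring_on UNIV) T)"
    unfolding is_subring_def
  proof (intro conjI ballI)
    show "1 \<in> generate_ring (ring_on UNIV) T" using generate_ring.one[of "ring_on UNIV" T] by simp
    fix a b assume ab: "a \<in> generate_ring (ring_on UNIV) T" "b \<in> generate_ring (ring_on UNIV) T"
    show "a * b \<in> generate_ring (ring_on UNIV) T" using generate_ring.eng_mult[OF ab] by simp
    show "a - b \<in> generate_ring (ring_on UNIV) T"
      using generate_ring.eng_add[OF ab(1) generate_ring.a_inv[OF ab(2)]] by (simp add: u)
  qed
  show "T \<subseteq> generate_ring (ring_on UNIV) T" by (auto intro: generate_ring.incl)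
  assume D: "is_subring D" "T \<subseteq> D"
  show "generate_ring (ring_on UNIV) T \<subseteq> D"
  proof
    fix a assume "a \<in> generate_ring (ring_on UNIV) T"
    then show "a \<in> D"
      by induction (use D is_subringD[OF D(1)] in \<open>auto simp: u\<close>)
  qed
qed

text \<open>A positive finite supremum of chain lengths is attained: otherwise \<open>n - 1\<close>
  would already be an upper bound.\<close>

lemma krull_dim_eqD:
  assumes B: "is_subring B" and dim: "krull_dim B = enat n"
  shows "0 < n \<Longrightarrow> \<exists>P. (\<forall>i\<le>n. is_prime B (P i)) \<and> (\<forall>i<n. P i \<subset> P (Suc i))"
    "(\<forall>i\<le>k. is_prime B (P i)) \<and> (\<forall>i<k. P i \<subset> P (Suc i)) \<Longrightarrow> k \<le> n"
proof -
  define A where "A = {k. \<exists>P. (\<forall>i\<le>k. is_prime B (P i)) \<and> (\<forall>i<k. P i \<subset> P (Suc i))}"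
  have eq: "krull_dim B = Sup (enat ` A)"
    unfolding krull_dim_def primeideal_ring_on[OF B] A_def by (rule arg_cong[of _ _ Sup]) auto
  show "k \<le> n" if "(\<forall>i\<le>k. is_prime B (P i)) \<and> (\<forall>i<k. P i \<subset> P (Suc i))"
  proof -
    have "k \<in> A" using that unfolding A_def by blast
    then have "enat k \<le> krull_dim B" unfolding eq by (intro Sup_upper) auto
    then show ?thesis by (simp add: dim)
  qed
  assume n: "0 < n"
  have "n \<in> A"
  proof (rule ccontr)
    assume nA: "n \<notin> A"
    have le: "Sup (enat ` A) \<le> enat (n - 1)"
    proof (rule Sup_least)
      fix z assume "z \<in> enat ` A"
      then obtain k where k: "k \<in> A" "z = enat k" by auto
      then have "enat k \<le> krull_dim B" unfolding eq by (intro Sup_upper) auto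
      then have "k \<le> n" by (simp add: dim)
      then show "z \<le> enat (n - 1)" using k nA by (cases "k = n") auto
    qed
    show False using le[folded eq, unfolded dim] n by simp
  qed
  then show "\<exists>P. (\<forall>i\<le>n. is_prime B (P i)) \<and> (\<forall>i<n. P i \<subset> P (Suc i))" by (simp add: A_def)
qed

lemma flag_ideal_props:
  assumes B: "is_subring B" and x: "x ` {..<i} \<subseteq> B"
  shows "is_ideal B (flag_ideal B x i)" "j < i \<Longrightarrow> x j \<in> flag_ideal B x i"
    "is_ideal B H \<Longrightarrow> x ` {..<i} \<subseteq> H \<Longrightarrow> flag_ideal B x i \<subseteq> H"
proof -
  interpret cring "ring_on B" by (rule cring_ring_on[OF B])
  have s: "x ` {..<i} \<subseteq> carrier (ring_on B)" using x by auto
  show "is_ideal B (flag_ideal B x i)"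
    using genideal_ideal[OF s] by (simp add: flag_ideal_def ideal_ring_on[OF B])
  show "j < i \<Longrightarrow> x j \<in> flag_ideal B x i"
    using genideal_self[OF s] by (auto simp: flag_ideal_def)
  show "is_ideal B H \<Longrightarrow> x ` {..<i} \<subseteq> H \<Longrightarrow> flag_ideal B x i \<subseteq> H"
    using genideal_minimal[of H "x ` {..<i}"] by (auto simp: flag_ideal_def ideal_ring_on[OF B])
qed

lemma flag_ideal_0: assumes B: "is_subring B" shows "flag_ideal B x 0 = {0}"
proof -
  have "is_ideal B {0}" using is_subringD[OF B] by (auto simp: is_ideal_def)
  then show ?thesis
    using flag_ideal_props(3)[OF B, of x 0 "{0}"] is_idealD(2)[OF flag_ideal_props(1)[OF B, of x 0]] by auto
qed

lemma flag_ideal_Suc: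
  assumes B: "is_subring B" and x: "x ` {..<Suc i} \<subseteq> B"
  shows "flag_ideal B x (Suc i) = adjoin B (flag_ideal B x i) (x i)"
proof
  have xi: "x i \<in> B" and x': "x ` {..<i} \<subseteq> B" using x by auto
  note p = flag_ideal_props[OF B x'] and ps = flag_ideal_props[OF B x]
  note ad = is_ideal_adjoin[OF B p(1) xi]
  show "flag_ideal B x (Suc i) \<subseteq> adjoin B (flag_ideal B x i) (x i)"
    by (rule ps(3)) (use ad p(2) in \<open>auto simp: lessThan_Suc\<close>)
  show "adjoin B (flag_ideal B x i) (x i) \<subseteq> flag_ideal B x (Suc i)"
    by (rule adjoin_least) (use ps(1,2) p(3)[OF ps(1) image_subsetI[OF ps(2)]] in auto)
qed

text \<open>For a chain of primes with \<open>x j \<in> P (j + 1)\<close> and \<open>P n\<close> maximal, the strict inclusions force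
  \<open>x i \<notin> P i\<close>, and Nakayama's lemma gives \<open>P i = flag_ideal B x i\<close> by descending induction.\<close>

lemma flag_ideals_prime:
  fixes B :: "'a::field set"
  assumes B: "noeth B" and M: "is_ideal B (nonunits B)" and n: "0 < n" and reg: "regular_parameters B n x"
  shows "i \<le> n \<Longrightarrow> is_prime B (flag_ideal B x i)" "i < n \<Longrightarrow> x i \<notin> flag_ideal B x i"
    "flag_ideal B x n = nonunits B"
proof -
  note Bs = noethD(1)[OF B]
  have dim: "krull_dim B = enat n" and xB: "\<And>j. j < n \<Longrightarrow> x j \<in> B"
    using reg by (auto simp: regular_parameters_def)
  show fn: "flag_ideal B x n = nonunits B" using reg by (simp add: regular_parameters_def flag_ideal_def)
  obtain P where P: "\<And>i. i \<le> n \<Longrightarrow> is_prime B (P i)" "\<And>i. i < n \<Longrightarrow> P i \<subset> P (Suc i)"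
    using krull_dim_eqD(1)[OF Bs dim n] by auto
  have "x ` {..<n} \<subseteq> nonunits B" using flag_ideal_props(2)[OF Bs, of x n] xB fn by auto
  have "\<exists>Q. (\<forall>i\<le>n. is_prime B (Q i)) \<and> (\<forall>i<n. Q i \<subset> Q (Suc i)) \<and> Q n = nonunits B \<and> (\<forall>j<n. x j \<in> Q (Suc j))"
    by (rule chain_through_parameters[OF B M \<open>x ` {..<n} \<subseteq> nonunits B\<close>, of P]) (use P in auto)
  then obtain Q where Q: "\<And>i. i \<le> n \<Longrightarrow> is_prime B (Q i)" "\<And>i. i < n \<Longrightarrow> Q i \<subset> Q (Suc i)" "Q n = nonunits B"
    "\<And>j. j < n \<Longrightarrow> x j \<in> Q (Suc j)" by auto
  have Qmono: "Q i \<subseteq> Q j" if "i \<le> j" "j \<le> n" for i j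
    using that
  proof (induction j)
    case (Suc j) then show ?case using Q(2)[of j] by (cases "i = Suc j") auto
  qed simp
  have step: "x i \<notin> Q i \<and> Q i = flag_ideal B x i" if i: "i < n" and IH: "Q (Suc i) = flag_ideal B x (Suc i)" for i
  proof
    have xB': "x ` {..<i} \<subseteq> B" "x ` {..<Suc i} \<subseteq> B" using xB i by auto
    note Qi = is_primeD(1)[OF Q(1)[of i]]
    note p = flag_ideal_props[OF Bs xB'(1)]
    have sub: "flag_ideal B x i \<subseteq> Q i"
    proof (rule p(3))
      have "x j \<in> Q i" if "j < i" for j using Q(4)[of j] Qmono[of "Suc j" i] i that by auto
      then show "x ` {..<i} \<subseteq> Q i" by auto
    qed (use Qi i in auto)
    note IH' = IH[unfolded flag_ideal_Suc[OF Bs xB'(2)]]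
    show xi: "x i \<notin> Q i"
    proof
      assume "x i \<in> Q i"
      then have "Q (Suc i) \<subseteq> Q i" unfolding IH' using adjoin_least[OF Qi sub] i by auto
      then show False using Q(2)[OF i] by blast
    qed
    have "Q i \<subseteq> flag_ideal B x i"
    proof
      fix f assume f: "f \<in> Q i"
      \<comment> \<open>Since \<open>x i\<close> is outside the prime \<open>Q i\<close>, the
        cofactor is again in \<open>Q i\<close>, so the division can be repeated forever.\<close>
      have "\<exists>h. h \<in> Q i \<and> g - x i * h \<in> flag_ideal B x i" if g: "g \<in> Q i" for g
      proof -
        have "g \<in> adjoin B (flag_ideal B x i) (x i)" using Q(2)[OF i] g IH' by blast
        then obtain j b where jb: "j \<in> flag_ideal B x i" "b \<in> B" "g = j + b * x i" by (auto simp: adjoin_def)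
        have "g - j \<in> Q i" by (rule is_ideal_diff[OF Bs]) (use Qi i g jb sub in auto)
        then have "b * x i \<in> Q i" using jb by simp
        then have "b \<in> Q i" using is_primeD(3)[OF Q(1)[of i] jb(2) xB[OF i]] xi i by auto
        then show ?thesis using jb by (intro exI[of _ b]) (auto simp: mult.commute)
      qed
      then obtain h where h: "\<And>g. g \<in> Q i \<Longrightarrow> h g \<in> Q i \<and> g - x i * h g \<in> flag_ideal B x i" by metis
      have hk: "(h ^^ k) f \<in> Q i" for k by (induction k) (use f h in auto)
      have "(h ^^ 0) f \<in> flag_ideal B x i"
      proof (rule infinitely_divisible[OF B M p(1), of "x i" "\<lambda>k. (h ^^ k) f"])
        show "x i \<in> nonunits B" using \<open>x ` {..<n} \<subseteq> nonunits B\<close> i by auto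
        show "(h ^^ k) f \<in> B" for k using hk is_idealD(1)[OF Qi] i by auto
        show "(h ^^ k) f - x i * (h ^^ Suc k) f \<in> flag_ideal B x i" for k using h[OF hk] by simp
      qed
      then show "f \<in> flag_ideal B x i" by simp
    qed
    then show "Q i = flag_ideal B x i" using sub by auto
  qed
  have eq: "Q i = flag_ideal B x i" if "i \<le> n" for i
    using that
  proof (induction "n - i" arbitrary: i)
    case 0 then show ?case using Q(3) fn by simp
  next
    case (Suc k)
    then show ?case using step[of i] by auto
  qed
  show "i \<le> n \<Longrightarrow> is_prime B (flag_ideal B x i)" using Q(1) eq by simp
  show "i < n \<Longrightarrow> x i \<notin> flag_ideal B x i" using step[of i] eq[of "Suc i"] eq[of i] by auto
qed

section \<open>The lexicographic valuation of a flag of primes\<close>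

locale flag_ring =
  fixes B :: "'a::field set" and x :: "nat \<Rightarrow> 'a" and n :: nat
  assumes noeth: "noeth B" and local: "is_ideal B (nonunits B)" and n_pos: "0 < n"
    and prime: "i \<le> n \<Longrightarrow> is_prime B (flag_ideal B x i)"
    and x_notin: "i < n \<Longrightarrow> x i \<notin> flag_ideal B x i" and x_in: "i < n \<Longrightarrow> x i \<in> B"
    and top: "flag_ideal B x n = nonunits B"
begin

abbreviation J where "J i \<equiv> flag_ideal B x i"
abbreviation ord where "ord i f \<equiv> order_modulo B (J i) (x i) f"

lemma subring: "is_subring B" by (rule noethD(1)[OF noeth])

lemmas S = is_subringD[OF subring]

lemma J_ideal: "i \<le> n \<Longrightarrow> is_ideal B (J i)" using is_primeD(1)[OF prime] .

lemmas JD = is_idealD[OF J_ideal]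

lemma J_diff: "i \<le> n \<Longrightarrow> a \<in> J i \<Longrightarrow> b \<in> J i \<Longrightarrow> a - b \<in> J i"
  by (rule is_ideal_diff[OF subring J_ideal])

lemma J_Suc: "i < n \<Longrightarrow> J (Suc i) = adjoin B (J i) (x i)"
  by (rule flag_ideal_Suc[OF subring]) (use x_in in auto)

lemma J_0: "J 0 = {0}" by (rule flag_ideal_0[OF subring])

lemma J_mono: "i < n \<Longrightarrow> J i \<subseteq> J (Suc i)"
  unfolding J_Suc by (rule is_ideal_adjoin(2)[OF subring J_ideal x_in]) auto

lemma x_in_J: "i < n \<Longrightarrow> x i \<in> J (Suc i)"
  unfolding J_Suc by (rule is_ideal_adjoin(3)[OF subring J_ideal x_in]) auto

lemma x_nonunit: "i < n \<Longrightarrow> x i \<in> nonunits B"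
  using flag_ideal_props(2)[OF subring, of x n i] x_in top by auto

lemma cancel_x:
  assumes "i < n" "h \<in> B" "x i ^ k * h \<in> J i" shows "h \<in> J i"
proof -
  have "x i ^ k \<in> J i \<or> h \<in> J i"
    using is_primeD(3)[OF prime _ _ assms(3)] S(7)[OF x_in] assms by auto
  then show ?thesis
    using is_prime_power[OF subring prime x_in, of i i k] x_notin assms(1) by auto
qed

text \<open>This gives the \<open>GREATEST\<close> in \<open>order_modulo\<close> its meaning. If
  the set were infinite it would contain all \<open>k\<close>, the quotients \<open>h k\<close>
  would satisfy \<open>h k = x i * h (Suc k)\<close> modulo the prime \<open>J i\<close>, and
  \<open>infinitely_divisible\<close> would put \<open>f\<close> into \<open>J i\<close>.\<close>

lemma order_set_finite:
  assumes i: "i < n" and f: "f \<in> B" "f \<notin> J i"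
  shows "finite {k. \<exists>h\<in>B. f - x i ^ k * h \<in> J i}"
proof (rule ccontr)
  assume inf: "infinite {k. \<exists>h\<in>B. f - x i ^ k * h \<in> J i}"
  have ex: "\<exists>h\<in>B. f - x i ^ k * h \<in> J i" for k
  proof -
    obtain l where l: "l > k" "l \<in> {k. \<exists>h\<in>B. f - x i ^ k * h \<in> J i}"
      using inf by (meson infinite_nat_iff_unbounded)
    then obtain h where h: "h \<in> B" "f - x i ^ l * h \<in> J i" by blast
    have "x i ^ l * h = x i ^ k * (x i ^ (l - k) * h)"
      using l by (simp add: mult.assoc[symmetric] power_add[symmetric])
    then show ?thesis using h S(4)[OF S(7)[OF x_in[OF i]] h(1)] by metis
  qed
  then obtain h where h: "\<And>k. h k \<in> B" "\<And>k. f - x i ^ k * h k \<in> J i" by metis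
  have st: "h k - x i * h (Suc k) \<in> J i" for k
  proof (rule cancel_x[OF i])
    have "(f - x i ^ Suc k * h (Suc k)) - (f - x i ^ k * h k) \<in> J i"
      by (rule J_diff[OF _ h(2) h(2)]) (use i in auto)
    then show "x i ^ k * (h k - x i * h (Suc k)) \<in> J i" by (simp add: algebra_simps)
    show "h k - x i * h (Suc k) \<in> B" using S(3)[OF h(1) S(4)[OF x_in[OF i] h(1)]] .
  qed
  have "h 0 \<in> J i"
    by (rule infinitely_divisible[OF noeth local J_ideal x_nonunit]) (use i h(1) st in auto)
  then have "(f - x i ^ 0 * h 0) + h 0 \<in> J i" using JD(3)[of i] h(2) i by (meson less_imp_le)
  then show False using f by simp
qed

lemma ord_works:
  assumes i: "i < n" and f: "f \<in> B" "f \<notin> J i"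
  shows "\<exists>h\<in>B. f - x i ^ ord i f * h \<in> J i" "h \<in> B \<Longrightarrow> f - x i ^ k * h \<in> J i \<Longrightarrow> k \<le> ord i f"
proof -
  obtain b where b: "\<And>k. \<exists>h\<in>B. f - x i ^ k * h \<in> J i \<Longrightarrow> k \<le> b"
    using order_set_finite[OF assms] by (metis (mono_tags, lifting) finite_nat_set_iff_bounded_le mem_Collect_eq)
  have "\<exists>h\<in>B. f - x i ^ 0 * h \<in> J i" using f JD(2)[of i] i by (intro bexI[of _ f]) auto
  from GreatestI_nat[of "\<lambda>k. \<exists>h\<in>B. f - x i ^ k * h \<in> J i", OF this b]
  show "\<exists>h\<in>B. f - x i ^ ord i f * h \<in> J i" by (simp add: order_modulo_def)
  show "h \<in> B \<Longrightarrow> f - x i ^ k * h \<in> J i \<Longrightarrow> k \<le> ord i f"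
    unfolding order_modulo_def
    by (rule Greatest_le_nat[of "\<lambda>k. \<exists>h\<in>B. f - x i ^ k * h \<in> J i", OF _ b]) auto
qed

lemma ord_rest_notin:
  assumes i: "i < n" and f: "f \<in> B" "f \<notin> J i" and h: "h \<in> B" "f - x i ^ ord i f * h \<in> J i"
  shows "h \<notin> J (Suc i)"
proof
  assume "h \<in> J (Suc i)"
  then obtain j b where jb: "j \<in> J i" "b \<in> B" "h = j + b * x i" by (auto simp: J_Suc[OF i] adjoin_def)
  have "(f - x i ^ ord i f * h) + x i ^ ord i f * j \<in> J i"
    using JD(3)[of i] JD(4)[of i] h jb(1) S(7)[OF x_in[OF i]] i by (meson less_imp_le)
  then have "f - x i ^ Suc (ord i f) * b \<in> J i" by (simp add: jb(3) algebra_simps)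
  then show False using ord_works(2)[OF i f jb(2), of "Suc (ord i f)"] by simp
qed

text \<open>A quotient outside \<open>J (Suc i)\<close> certifies the order: if the order were
  larger, cancelling \<open>x i ^ k\<close> modulo the prime \<open>J i\<close> would put
  \<open>h\<close> into \<open>J (Suc i)\<close>.\<close>

lemma ord_eqI:
  assumes i: "i < n" and f: "f \<in> B" "f \<notin> J i" and h: "h \<in> B" "f - x i ^ k * h \<in> J i" "h \<notin> J (Suc i)"
  shows "ord i f = k"
proof (rule ccontr)
  assume ne: "ord i f \<noteq> k"
  have "k \<le> ord i f" by (rule ord_works(2)[OF i f h(1,2)])
  then obtain d where d: "ord i f = k + Suc d" using ne by (metis less_imp_Suc_add le_neq_implies_less add_Suc_right)
  obtain g where g: "g \<in> B" "f - x i ^ (k + Suc d) * g \<in> J i" using ord_works(1)[OF i f] d by auto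
  have "(f - x i ^ (k + Suc d) * g) - (f - x i ^ k * h) \<in> J i"
    by (rule J_diff[OF _ g(2) h(2)]) (use i in auto)
  then have "x i ^ k * (h - x i ^ Suc d * g) \<in> J i" by (simp add: algebra_simps power_add)
  then have "h - x i ^ Suc d * g \<in> J i"
    using cancel_x[OF i] S(3)[OF h(1) S(4)[OF S(7)[OF x_in[OF i]] g(1)]] by blast
  then have 1: "h - x i ^ Suc d * g \<in> J (Suc i)" using J_mono[OF i] by blast
  have "x i ^ d * g \<in> B" using S(4)[OF S(7)[OF x_in[OF i]] g(1)] .
  then have "x i * (x i ^ d * g) \<in> J (Suc i)" using JD(5)[of "Suc i"] x_in_J[OF i] i by (meson Suc_leI)
  then have "(h - x i ^ Suc d * g) + x i * (x i ^ d * g) \<in> J (Suc i)"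
    using JD(3)[of "Suc i"] 1 i by (meson Suc_leI)
  then show False using h(3) by (simp add: mult.assoc)
qed

lemma ord_cong:
  assumes i: "i < n" and "f - g \<in> J i" shows "ord i f = ord i g"
proof -
  have "f - x i ^ k * h \<in> J i \<longleftrightarrow> g - x i ^ k * h \<in> J i" for k h
    using J_diff[of i "f - x i ^ k * h" "f - g"] JD(3)[of i "g - x i ^ k * h" "f - g"] i assms(2) by auto
  then show ?thesis by (simp add: order_modulo_def)
qed

text \<open>A certificate for the values of \<open>f\<close>: exponents \<open>w\<close> and
  successive quotients \<open>r\<close>. \<open>flag_rest\<close> picks its quotients by choice, but
  any certificate determines the values. The condition on the last quotient, which is then a unit,
  keeps all earlier \<open>r i\<close> outside \<open>J i\<close>.\<close>

definition expansion :: "'a \<Rightarrow> (nat \<Rightarrow> nat) \<Rightarrow> (nat \<Rightarrow> 'a) \<Rightarrow> bool"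
  where "expansion f w r \<longleftrightarrow> r 0 = f \<and> (\<forall>i\<le>n. r i \<in> B) \<and>
    (\<forall>i<n. r i - x i ^ w i * r (Suc i) \<in> J i) \<and> r n \<notin> J n"

lemma expansionD:
  assumes "expansion f w r"
  shows "r 0 = f" "i \<le> n \<Longrightarrow> r i \<in> B" "i < n \<Longrightarrow> r i - x i ^ w i * r (Suc i) \<in> J i" "r n \<notin> J n"
  using assms by (auto simp: expansion_def)

lemma J_step:
  assumes i: "i < n" and ab: "a \<in> B" "b \<in> B" "a - x i ^ k * b \<in> J i" and a: "a \<in> J i"
  shows "b \<in> J (Suc i)"
proof -
  have "a - (a - x i ^ k * b) \<in> J i" by (rule J_diff[OF _ a ab(3)]) (use i in auto)
  then have "b \<in> J i" using cancel_x[OF i ab(2)] by simp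
  then show ?thesis using J_mono[OF i] by blast
qed

lemma expansion_notin: "expansion f w r \<Longrightarrow> i \<le> n \<Longrightarrow> r i \<notin> J i"
proof (induction "n - i" arbitrary: i)
  case 0 then show ?case using expansionD(4) by auto
next
  case (Suc k)
  then have i: "i < n" by auto
  have "r (Suc i) \<notin> J (Suc i)" using Suc i by auto
  then show ?case
    using J_step[OF i expansionD(2)[OF Suc.prems(1)] expansionD(2)[OF Suc.prems(1)] expansionD(3)[OF Suc.prems(1) i]] i by auto
qed

lemma expansion_exists:
  assumes f: "f \<in> B" "f \<noteq> 0" shows "expansion f (flag_val B x f) (flag_rest B x f)"
proof -
  have A: "flag_rest B x f i \<in> B \<and> flag_rest B x f i \<notin> J i" if "i \<le> n" for i
    using that
  proof (induction i)
    case 0 then show ?case using f J_0 by simp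
  next
    case (Suc i)
    then have i: "i < n" and IH: "flag_rest B x f i \<in> B" "flag_rest B x f i \<notin> J i" by auto
    have "flag_rest B x f (Suc i) \<in> B \<and> flag_rest B x f i - x i ^ ord i (flag_rest B x f i) * flag_rest B x f (Suc i) \<in> J i"
      using someI_ex[of "\<lambda>h. h \<in> B \<and> flag_rest B x f i - x i ^ ord i (flag_rest B x f i) * h \<in> J i"]
        ord_works(1)[OF i IH] by auto
    then show ?case using ord_rest_notin[OF i IH] by blast
  qed
  have "flag_rest B x f i - x i ^ flag_val B x f i * flag_rest B x f (Suc i) \<in> J i" if i: "i < n" for i
    using someI_ex[of "\<lambda>h. h \<in> B \<and> flag_rest B x f i - x i ^ ord i (flag_rest B x f i) * h \<in> J i"]
      ord_works(1)[OF i] A[of i] i by (auto simp: flag_val_def)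
  then show ?thesis using A by (auto simp: expansion_def)
qed

lemma rest_cong_step:
  assumes i: "i < n" and B: "r \<in> B" "s \<in> B" and rs: "r - x i ^ k * r' \<in> J i" "s - x i ^ k * s' \<in> J i"
    "r' \<in> B" "s' \<in> B" and c: "r - s \<in> J i"
  shows "r' - s' \<in> J i"
proof -
  have "(r - s) - ((r - x i ^ k * r') - (s - x i ^ k * s')) \<in> J i"
    using J_diff[of i] rs c i by (meson less_imp_le)
  then have "x i ^ k * (r' - s') \<in> J i" by (simp add: algebra_simps)
  then show ?thesis using cancel_x[OF i] S(3)[OF rs(3,4)] by blast
qed

lemma expansion_initial:
  assumes s: "s 0 = f" "\<And>j. j \<le> i \<Longrightarrow> s j \<in> B" "\<And>j. j < i \<Longrightarrow> s j - x j ^ w j * s (Suc j) \<in> J j"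
    and notin: "\<And>j. j \<le> i \<Longrightarrow> s j \<notin> J j" and i: "i < n" and f: "f \<noteq> 0"
  shows "(\<forall>j<i. flag_val B x f j = w j) \<and> flag_val B x f i = ord i (s i)"
proof -
  have fB: "f \<in> B" using s(1) s(2)[of 0] by auto
  note e = expansion_exists[OF fB f]
  let ?r = "flag_rest B x f"
  have A: "?r j - s j \<in> J j \<and> (\<forall>l<j. flag_val B x f l = w l)" if "j \<le> i" for j
    using that
  proof (induction j)
    case 0 then show ?case using s(1) J_0 by simp
  next
    case (Suc j)
    then have j: "j < n" "j < i" and IH: "?r j - s j \<in> J j" "\<forall>l<j. flag_val B x f l = w l" using i by auto
    have "flag_val B x f j = ord j (?r j)" by (simp add: flag_val_def)
    also have "\<dots> = ord j (s j)" by (rule ord_cong[OF j(1) IH(1)])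
    also have "\<dots> = w j" by (rule ord_eqI[OF j(1) s(2) notin s(2) s(3) notin]) (use j in auto)
    finally have w: "flag_val B x f j = w j" .
    have "?r (Suc j) - s (Suc j) \<in> J j"
      by (rule rest_cong_step[OF j(1) expansionD(2)[OF e] s(2) expansionD(3)[OF e j(1), unfolded w] s(3)[OF j(2)]
            expansionD(2)[OF e] s(2) IH(1)]) (use j in auto)
    then show ?case using J_mono[OF j(1)] w IH(2) by (auto simp: less_Suc_eq)
  qed
  show ?thesis using A[of i] ord_cong[OF i, of "?r i" "s i"] by (simp add: flag_val_def)
qed

lemma flag_val_eqI:
  assumes e: "expansion f w r" and f: "f \<noteq> 0" and i: "i < n" shows "flag_val B x f i = w i"
proof -
  have "flag_val B x f i = ord i (r i)"
    using expansion_initial[of r f i w] e i f expansion_notin[OF e] by (auto simp: expansion_def)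
  also have "\<dots> = w i"
    by (rule ord_eqI[OF i expansionD(2)[OF e] expansion_notin[OF e] expansionD(2)[OF e] expansionD(3)[OF e] expansion_notin[OF e]])
      (use i in auto)
  finally show ?thesis .
qed

lemma expansion_nonzero: "expansion f w r \<Longrightarrow> f \<noteq> 0"
  using expansion_notin[of f w r 0] expansionD(1)[of f w r] J_0 by auto

text \<open>Expansions multiply termwise, and primeness of the last flag ideal keeps the product of
  the last quotients outside it.\<close>

lemma flag_val_mult:
  assumes f: "f \<in> B" "f \<noteq> 0" and g: "g \<in> B" "g \<noteq> 0" and i: "i < n"
  shows "flag_val B x (f * g) i = flag_val B x f i + flag_val B x g i"
proof -
  note e = expansion_exists[OF f] and e' = expansion_exists[OF g]
  let ?r = "flag_rest B x f" and ?s = "flag_rest B x g" and ?w = "flag_val B x f" and ?v = "flag_val B x g"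
  have "expansion (f * g) (\<lambda>i. ?w i + ?v i) (\<lambda>i. ?r i * ?s i)"
    unfolding expansion_def
  proof (intro conjI allI impI)
    show "?r 0 * ?s 0 = f * g" by simp
    show "?r i * ?s i \<in> B" if "i \<le> n" for i using expansionD(2)[OF e that] expansionD(2)[OF e' that] S(4) by blast
    show "?r n * ?s n \<notin> J n"
      using is_primeD(3)[OF prime[OF order_refl]] expansionD(2,4)[OF e] expansionD(2,4)[OF e'] by blast
    show "?r i * ?s i - x i ^ (?w i + ?v i) * (?r (Suc i) * ?s (Suc i)) \<in> J i" if i: "i < n" for i
    proof -
      have "(?r i - x i ^ ?w i * ?r (Suc i)) * ?s i + (x i ^ ?w i * ?r (Suc i)) * (?s i - x i ^ ?v i * ?s (Suc i)) \<in> J i"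
        by (intro JD(3) JD(4)[of i "x i ^ ?w i * ?r (Suc i)"] JD(5) expansionD(3)[OF e i] expansionD(3)[OF e' i] S(4) S(7) x_in
            expansionD(2)[OF e] expansionD(2)[OF e']) (use i in auto)
      then show ?thesis by (simp add: algebra_simps power_add)
    qed
  qed
  from flag_val_eqI[OF this _ i] f g show ?thesis by simp
qed

lemma flag_val_unit:
  assumes f: "f \<in> B" "f \<notin> nonunits B" and i: "i < n" shows "flag_val B x f i = 0"
proof (rule flag_val_eqI[of f "\<lambda>_. 0" "\<lambda>_. f"])
  show "expansion f (\<lambda>_. 0) (\<lambda>_. f)" using f JD(2) top by (auto simp: expansion_def)
  then show "f \<noteq> 0" by (rule expansion_nonzero)
qed fact

lemma flag_val_x:
  assumes j: "j < n" and i: "i < n" shows "flag_val B x (x j) i = (if i = j then 1 else 0)"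
proof (rule flag_val_eqI[of "x j" "\<lambda>i. if i = j then 1 else 0" "\<lambda>i. if i \<le> j then x j else 1"])
  show "expansion (x j) (\<lambda>i. if i = j then 1 else 0) (\<lambda>i. if i \<le> j then x j else 1)"
    unfolding expansion_def
  proof (intro conjI allI impI)
    fix i assume "i < n"
    then show "(if i \<le> j then x j else 1) - x i ^ (if i = j then 1 else 0) * (if Suc i \<le> j then x j else 1) \<in> J i"
      using JD(2)[of i] by (cases i j rule: linorder_cases) auto
  qed (use x_in[OF j] S(1) j one_notin_nonunits[OF subring] top in auto)
  then show "x j \<noteq> 0" by (rule expansion_nonzero)
qed fact

text \<open>An expansion of \<open>f + g\<close> with the exponents of \<open>f\<close>: up to
  \<open>i\<close> the quotients are added, at \<open>Suc i\<close> the contribution of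
  \<open>g\<close> shrinks to a correction \<open>u\<close> in \<open>J (Suc i)\<close>, and from
  there on the quotients are those of \<open>f\<close>.\<close>

lemma flag_val_add:
  assumes f: "f \<in> B" "f \<noteq> 0" and g: "g \<in> B" "g \<noteq> 0" and i: "i < n"
    and eq: "\<And>j. j < i \<Longrightarrow> flag_val B x f j = flag_val B x g j" and less: "flag_val B x f i < flag_val B x g i"
  shows "f + g \<noteq> 0 \<and> (\<forall>j<n. flag_val B x (f + g) j = flag_val B x f j)"
proof -
  note e = expansion_exists[OF f] and e' = expansion_exists[OF g]
  let ?r = "flag_rest B x f" and ?s = "flag_rest B x g" and ?w = "flag_val B x f" and ?v = "flag_val B x g"
  note rB = expansionD(2)[OF e] and sB = expansionD(2)[OF e']
  \<comment> \<open>Dividing \<open>x i ^ ?v i * ?s (Suc i)\<close> by the smaller power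
    \<open>x i ^ ?w i\<close> leaves at least one factor \<open>x i\<close>, so the remainder is
    invisible modulo \<open>J (Suc i)\<close>.\<close>
  define u where "u = x i * (x i ^ (?v i - ?w i - 1) * ?s (Suc i))"
  have u: "u \<in> J (Suc i)" unfolding u_def
    by (intro JD(5) x_in_J S(4) S(7) x_in sB) (use i in auto)
  define t where "t j = (if j \<le> i then ?r j + ?s j else if j = Suc i then ?r j + u else ?r j)" for j
  have "expansion (f + g) ?w t"
    unfolding expansion_def
  proof (intro conjI allI impI)
    show "t 0 = f + g" by (simp add: t_def)
    show "t j \<in> B" if "j \<le> n" for j
      using rB sB S(6) that JD(1)[of "Suc i"] u i by (auto simp: t_def simp del: flag_rest.simps)
    show "t n \<notin> J n"
    proof
      assume "t n \<in> J n"
      then have "?r n \<in> J n"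
        using i J_diff[of n "t n" u] u by (auto simp: t_def split: if_splits)
      then show False using expansionD(4)[OF e] by blast
    qed
    fix j assume j: "j < n"
    consider "j < i" | "j = i" | "j = Suc i" | "j > Suc i" by linarith
    then show "t j - x j ^ ?w j * t (Suc j) \<in> J j"
    proof cases
      case 1
      have "(?r j - x j ^ ?w j * ?r (Suc j)) + (?s j - x j ^ ?v j * ?s (Suc j)) \<in> J j"
        by (intro JD(3) expansionD(3)[OF e j] expansionD(3)[OF e' j]) (use j in auto)
      then show ?thesis using 1 eq[of j] by (simp add: t_def algebra_simps)
    next
      case 2
      have "?v i = ?w i + Suc (?v i - ?w i - 1)" using less by simp
      then have "x i ^ ?v i * ?s (Suc i) = x i ^ ?w i * u"
        unfolding u_def by (metis mult.assoc power_Suc power_add)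
      moreover have "(?r j - x j ^ ?w j * ?r (Suc j)) + (?s j - x j ^ ?v j * ?s (Suc j)) \<in> J j"
        by (intro JD(3) expansionD(3)[OF e j] expansionD(3)[OF e' j]) (use j in auto)
      ultimately show ?thesis using 2 by (simp add: t_def algebra_simps)
    next
      case 3
      have "(?r j - x j ^ ?w j * ?r (Suc j)) + u \<in> J j"
        by (intro JD(3) expansionD(3)[OF e j]) (use j u 3 in auto)
      then show ?thesis using 3 by (simp add: t_def algebra_simps)
    next
      case 4
      then show ?thesis using expansionD(3)[OF e j] by (simp add: t_def)
    qed
  qed
  then show ?thesis using flag_val_eqI expansion_nonzero by blast
qed

text \<open>With equal exponents, the combinations \<open>?r j - c * ?s j\<close> satisfy the same
  congruences for every \<open>c\<close>. The last quotients are units, so \<open>c\<close> can be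
  chosen in \<open>K\<close> with the last combination in the maximal ideal; this forces a strictly
  larger value.\<close>

lemma flag_val_leaf:
  assumes f: "f \<in> B" "f \<noteq> 0" and g: "g \<in> B" "g \<noteq> 0" and eq: "\<And>j. j < n \<Longrightarrow> flag_val B x f j = flag_val B x g j"
    and K: "K \<subseteq> B" and res: "\<And>z. z \<in> B \<Longrightarrow> \<exists>c\<in>K. z - c \<in> nonunits B"
  shows "\<exists>c\<in>K. f - c * g = 0 \<or> (\<exists>i<n. (\<forall>j<i. flag_val B x (f - c * g) j = flag_val B x f j) \<and>
    flag_val B x f i < flag_val B x (f - c * g) i)"
proof -
  note e = expansion_exists[OF f] and e' = expansion_exists[OF g]
  let ?r = "flag_rest B x f" and ?s = "flag_rest B x g" and ?w = "flag_val B x f" and ?v = "flag_val B x g"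
  note rB = expansionD(2)[OF e] and sB = expansionD(2)[OF e']
  obtain z where z: "z \<in> B" "?s n * z = 1"
    using not_nonunit[OF sB[OF order_refl]] expansionD(4)[OF e'] top by metis
  obtain c where c: "c \<in> K" "?r n * z - c \<in> nonunits B" using res S(4)[OF rB[OF order_refl] z(1)] by blast
  have cB: "c \<in> B" using c K by blast
  have "(?r n * z - c) * ?s n \<in> J n" using c(2) JD(5)[of n] sB[OF order_refl] top by auto
  moreover have "(?r n * z - c) * ?s n = ?r n - c * ?s n" using z(2) by (simp add: algebra_simps)
  ultimately have cn: "?r n - c * ?s n \<in> J n" by simp
  define t where "t j = ?r j - c * ?s j" for j
  have tB: "t j \<in> B" if "j \<le> n" for j unfolding t_def using that by (intro S(3) S(4) cB rB sB)
  have ts: "t j - x j ^ ?w j * t (Suc j) \<in> J j" if j: "j < n" for j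
  proof -
    have "(?r j - x j ^ ?w j * ?r (Suc j)) - c * (?s j - x j ^ ?v j * ?s (Suc j)) \<in> J j"
      by (intro J_diff JD(4) expansionD(3)[OF e j] expansionD(3)[OF e' j] cB) (use j in auto)
    then show ?thesis using eq[OF j] by (simp add: t_def algebra_simps)
  qed
  show ?thesis
  proof (intro bexI[OF _ c(1)], cases "f - c * g = 0")
    case False
    have ex: "t (Suc (n - 1)) \<in> J (Suc (n - 1))" using cn n_pos by (simp add: t_def)
    \<comment> \<open>The first index at which one more factor \<open>x i\<close> splits off: below
      it the values are unchanged, at it the value grows.\<close>
    define i where "i = (LEAST i. t (Suc i) \<in> J (Suc i))"
    have i1: "t (Suc i) \<in> J (Suc i)" unfolding i_def by (rule LeastI) (rule ex)
    have i2: "i < n" unfolding i_def using Least_le[of "\<lambda>i. t (Suc i) \<in> J (Suc i)", OF ex] n_pos by linarith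
    have i3: "t j \<notin> J j" if "j \<le> i" for j
    proof (cases j)
      case 0 then show ?thesis using False J_0 by (simp add: t_def)
    next
      case (Suc l) then show ?thesis using not_less_Least[of l "\<lambda>i. t (Suc i) \<in> J (Suc i)"] that by (auto simp: i_def)
    qed
    have A: "(\<forall>j<i. flag_val B x (f - c * g) j = ?w j) \<and> flag_val B x (f - c * g) i = ord i (t i)"
      by (rule expansion_initial[OF _ tB ts i3 i2 False]) (use i2 in \<open>auto simp: t_def\<close>)
    obtain a b where ab: "a \<in> J i" "b \<in> B" "t (Suc i) = a + b * x i"
      using i1 unfolding J_Suc[OF i2] by (auto simp: adjoin_def)
    have "(t i - x i ^ ?w i * t (Suc i)) + x i ^ ?w i * a \<in> J i"
      by (intro JD(3) JD(4) ts[OF i2] ab S(7) x_in i2) (use i2 in auto)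
    then have "t i - x i ^ Suc (?w i) * b \<in> J i" by (simp add: ab(3) algebra_simps)
    from ord_works(2)[OF i2 tB i3 ab(2) this] i2 have "Suc (?w i) \<le> ord i (t i)" by auto
    then show "f - c * g = 0 \<or> (\<exists>i<n. (\<forall>j<i. flag_val B x (f - c * g) j = ?w j) \<and> ?w i < flag_val B x (f - c * g) i)"
      using A i2 by (intro disjI2 exI[of _ i]) auto
  qed simp
qed

text \<open>All these lists have length \<open>n\<close>, so the order on lists restricts to the
  lexicographic order on \<nat>^n, and \<open>'v::linorder\<close> can be instantiated.\<close>

definition val :: "'a \<Rightarrow> nat list"
  where "val f = map (flag_val B x f) [0..<n]"

lemma val_less_iff:
  "val f < val g \<longleftrightarrow> (\<exists>i<n. (\<forall>j<i. flag_val B x f j = flag_val B x g j) \<and> flag_val B x f i < flag_val B x g i)"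
proof -
  have "take i (val f) = take i (val g) \<longleftrightarrow> (\<forall>j<i. flag_val B x f j = flag_val B x g j)" if "i < n" for i
    using that by (auto simp: val_def take_map map_eq_conv)
  then show ?thesis
    unfolding list_less_def lexord_take_index_conv by (auto simp: val_def)
qed

lemma val_eq_iff: "val f = val g \<longleftrightarrow> (\<forall>i<n. flag_val B x f i = flag_val B x g i)"
  by (auto simp: val_def)

lemma val_add:
  assumes "f \<in> B" "f \<noteq> 0" "g \<in> B" "g \<noteq> 0" "val f < val g" shows "f + g \<noteq> 0 \<and> val (f + g) = val f"
  using flag_val_add[OF assms(1-4)] assms(5) unfolding val_less_iff val_eq_iff by blast

end

section \<open>Growth of the graded ring\<close>

locale valued_space = vector_space scale
  for scale :: "'k::field \<Rightarrow> 'b::ab_group_add \<Rightarrow> 'b" +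
  fixes v :: "'b \<Rightarrow> 'v::linorder"
  assumes v_scale: "c \<noteq> 0 \<Longrightarrow> f \<noteq> 0 \<Longrightarrow> v (scale c f) = v f"
    and v_add: "f \<noteq> 0 \<Longrightarrow> g \<noteq> 0 \<Longrightarrow> v f < v g \<Longrightarrow> f + g \<noteq> 0 \<and> v (f + g) = v f"
begin

lemma sum_distinct_values:
  assumes "finite A" "A \<noteq> {}" "\<And>a. a \<in> A \<Longrightarrow> g a \<noteq> 0" "inj_on (\<lambda>a. v (g a)) A"
  shows "(\<Sum>a\<in>A. g a) \<noteq> 0 \<and> v (\<Sum>a\<in>A. g a) \<in> (\<lambda>a. v (g a)) ` A"
  using assms
proof (induction A rule: finite_ne_induct)
  case (singleton a)
  then show ?case by simp
next
  case (insert a A)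
  then have IH: "(\<Sum>a\<in>A. g a) \<noteq> 0" "v (\<Sum>a\<in>A. g a) \<in> (\<lambda>a. v (g a)) ` A" by (auto simp: inj_on_def)
  have "v (g a) \<noteq> v (\<Sum>a\<in>A. g a)" using IH(2) insert.prems(2) insert.hyps by (auto simp: inj_on_def)
  then consider "v (g a) < v (\<Sum>a\<in>A. g a)" | "v (\<Sum>a\<in>A. g a) < v (g a)" by (meson linorder_neqE)
  then show ?case
  proof cases
    case 1
    then show ?thesis using v_add[OF _ IH(1) 1] insert by auto
  next
    case 2
    then show ?thesis using v_add[OF IH(1) _ 2] insert IH(2) by (auto simp: add.commute)
  qed
qed

lemma independent_distinct_values:
  assumes "\<And>b. b \<in> A \<Longrightarrow> b \<noteq> 0" "inj_on v A"
  shows "independent A"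
proof
  assume "dependent A"
  then obtain T u b where T: "finite T" "T \<subseteq> A" "(\<Sum>b\<in>T. scale (u b) b) = 0" "b \<in> T" "u b \<noteq> 0"
    unfolding dependent_explicit by blast
  define T' where "T' = {b \<in> T. u b \<noteq> 0}"
  have "(\<Sum>b\<in>T'. scale (u b) b) = (\<Sum>b\<in>T. scale (u b) b)"
    unfolding T'_def using T(1) by (intro sum.mono_neutral_left) auto
  moreover have "(\<Sum>b\<in>T'. scale (u b) b) \<noteq> 0"
  proof (rule conjunct1[OF sum_distinct_values])
    show "finite T'" "T' \<noteq> {}" using T by (auto simp: T'_def)
    show "scale (u b) b \<noteq> 0" if "b \<in> T'" for b using that T(2) assms(1) by (auto simp: T'_def)
    have "v (scale (u b) b) = v b" if "b \<in> T'" for b using that T(2) assms(1) by (intro v_scale) (auto simp: T'_def)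
    moreover have "inj_on v T'" using assms(2) T(2) by (auto simp: T'_def inj_on_def)
    ultimately show "inj_on (\<lambda>b. v (scale (u b) b)) T'" by (auto simp: inj_on_def)
  qed
  ultimately show False using T(3) by simp
qed

lemma finite_values:
  assumes W: "W \<subseteq> span T" "finite T"
  shows "finite (v ` (W - {0}))" "card (v ` (W - {0})) \<le> card T"
proof -
  have bd: "card V \<le> card T" if V: "V \<subseteq> v ` (W - {0})" "finite V" for V
  proof -
    obtain A where A: "A \<subseteq> W - {0}" "inj_on v A" "V = v ` A" using V(1) by (meson subset_image_inj)
    have "independent A" using A by (intro independent_distinct_values) auto
    then have "card A \<le> card T" using independent_span_bound[OF W(2), of A] A(1) W(1) by auto
    then show ?thesis using A card_image by metis
  qed
  then show "finite (v ` (W - {0}))" by (meson finite_if_finite_subsets_card_bdd)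
  then show "card (v ` (W - {0})) \<le> card T" using bd by blast
qed

end

locale leaf_space = valued_space scale v
  for scale :: "'k::field \<Rightarrow> 'b::ab_group_add \<Rightarrow> 'b" and v :: "'b \<Rightarrow> 'v::linorder" +
  assumes leaf: "f \<noteq> 0 \<Longrightarrow> g \<noteq> 0 \<Longrightarrow> v f = v g \<Longrightarrow> \<exists>c. f - scale c g = 0 \<or> v f < v (f - scale c g)"
begin

text \<open>One element chosen for each value gives a basis. Independence comes from the distinct
  values; for spanning, subtracting a multiple of the chosen element raises the value, and only
  finitely many values of \<open>W\<close> are left above it.\<close>

lemma card_values_eq_dim:
  assumes W: "subspace W" "W \<subseteq> span T" "finite T"
  shows "card (v ` (W - {0})) = dim W"
proof -
  let ?V = "v ` (W - {0})"
  have fin: "finite ?V" by (rule finite_values[OF W(2,3)])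
  obtain A where A: "A \<subseteq> W - {0}" "inj_on v A" "?V = v ` A" by (meson subset_image_inj order_refl)
  have ind: "independent A" using A by (intro independent_distinct_values) auto
  have "f \<in> span A" if "f \<in> W" for f
    using that
  proof (induction "card {w \<in> ?V. v f < w}" arbitrary: f rule: less_induct)
    case less
    show ?case
    proof (cases "f = 0")
      case True then show ?thesis by (simp add: span_zero)
    next
      case False
      then have "v f \<in> ?V" using less.prems by auto
      then obtain g where g: "g \<in> A" "v f = v g" unfolding A(3) by auto
      then have gW: "g \<in> W" "g \<noteq> 0" using A(1) by auto
      obtain c where c: "f - scale c g = 0 \<or> v f < v (f - scale c g)" using leaf[OF False gW(2) g(2)] ..
      have "f - scale c g \<in> span A"
      proof (cases "f - scale c g = 0")
        case False
        let ?f = "f - scale c g"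
        have f': "?f \<in> W" using W(1) less.prems gW by (intro subspace_diff subspace_scale)
        have lt: "v f < v ?f" using c False by blast
        have "v ?f \<in> {w \<in> ?V. v f < w} - {w \<in> ?V. v ?f < w}" using lt f' False by auto
        moreover have "{w \<in> ?V. v ?f < w} \<subseteq> {w \<in> ?V. v f < w}" using lt by auto
        ultimately have "{w \<in> ?V. v ?f < w} \<subset> {w \<in> ?V. v f < w}" by blast
        then have "card {w \<in> ?V. v ?f < w} < card {w \<in> ?V. v f < w}"
          using fin by (intro psubset_card_mono) auto
        then show ?thesis using less.hyps f' by blast
      qed (simp add: span_zero)
      then have "f - scale c g + scale c g \<in> span A" using g(1) by (intro span_add[OF _ span_scale[OF span_base]])
      then show ?thesis by simp
    qed
  qed
  then have "dim W = card A" using A(1) ind by (intro dim_unique) auto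
  then show ?thesis using A card_image by metis
qed

end

context polarized_affine_variety
begin

lemma scale_mult_right: "a * smul c b = smul c (a * b)"
  by (metis mult.commute scale_mult)

text \<open>The degrees \<open>d i\<close> may repeat, so the terms are grouped by degree before
  uniqueness of the decomposition of 0 is applied.\<close>

lemma component_zero:
  assumes I: "finite I" and h: "\<And>i. i \<in> I \<Longrightarrow> h i \<in> gr (d i)" and 0: "(\<Sum>i\<in>I. h i) = 0"
  shows "(\<Sum>i\<in>{i \<in> I. d i = \<alpha>}. h i) = 0"
proof -
  define c where "c \<alpha> = (\<Sum>i\<in>{i \<in> I. d i = \<alpha>}. h i)" for \<alpha>
  have c: "c \<alpha> \<in> gr \<alpha>" for \<alpha> unfolding c_def by (rule subspace_sum[OF gr_subspace]) (use h in auto)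
  have sub: "{\<alpha>. c \<alpha> \<noteq> 0} \<subseteq> d ` I"
  proof
    fix \<alpha> assume "\<alpha> \<in> {\<alpha>. c \<alpha> \<noteq> 0}"
    show "\<alpha> \<in> d ` I"
    proof (rule ccontr)
      assume "\<alpha> \<notin> d ` I"
      then have "{i \<in> I. d i = \<alpha>} = {}" by auto
      then have "c \<alpha> = 0" by (simp only: c_def sum.empty)
      then show False using \<open>\<alpha> \<in> {\<alpha>. c \<alpha> \<noteq> 0}\<close> by simp
    qed
  qed
  then have fin: "finite {\<alpha>. c \<alpha> \<noteq> 0}" using I finite_surj by blast
  have "(\<Sum>\<alpha> | c \<alpha> \<noteq> 0. c \<alpha>) = (\<Sum>\<alpha>\<in>d ` I. c \<alpha>)"
    by (rule sum.mono_neutral_left) (use sub I in auto)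
  also have "\<dots> = (\<Sum>i\<in>I. h i)" unfolding c_def using sum.image_gen[OF I, of h d] by simp
  finally have "decomposes gr 0 c" using c fin 0 by (simp add: decomposes_def)
  moreover have "decomposes gr 0 (\<lambda>_. 0)" using subspace_0[OF gr_subspace] by (simp add: decomposes_def)
  ultimately have "c = (\<lambda>_. 0)" using gr_direct_sum[of 0] by blast
  then show ?thesis unfolding c_def by metis
qed

lemma weight_pairing_add: "weight_pairing (a + b) \<xi> = weight_pairing a \<xi> + weight_pairing b \<xi>"
  by (simp add: weight_pairing_def sum.distrib distrib_right)

lemma weight_pairing_zero [simp]: "weight_pairing 0 \<xi> = 0"
  by (simp add: weight_pairing_def)

end

subsection \<open>Monomials in homogeneous generators\<close>

locale homogeneous_generators = polarized_affine_variety smul gr \<mm> \<xi>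
  for smul :: "'k::{alg_closed_field, field_char_0} \<Rightarrow> 'r::idom \<Rightarrow> 'r"
    and gr :: "int^'d \<Rightarrow> 'r set" and \<mm> :: "'r set" and \<xi> :: "real^'d" +
  fixes N :: nat and z :: "nat \<Rightarrow> 'r" and \<delta> :: "nat \<Rightarrow> int^'d"
  assumes z_gr: "i < N \<Longrightarrow> z i \<in> gr (\<delta> i)" and \<delta>_pos: "i < N \<Longrightarrow> 0 < weight_pairing (\<delta> i) \<xi>"
    and generating: "is_subring D \<Longrightarrow> range (\<lambda>c. smul c 1) \<subseteq> D \<Longrightarrow> z ` {..<N} \<subseteq> D \<Longrightarrow> D = UNIV"
begin

definition mono :: "(nat \<Rightarrow> nat) \<Rightarrow> 'r" where "mono \<beta> = (\<Prod>i<N. z i ^ \<beta> i)"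
text \<open>Multiplication in \<open>int^'d\<close> is componentwise and \<open>of_nat k\<close> is
  the constant vector \<open>k\<close>, so each summand is the multiple of the degree
  \<open>\<delta> i\<close> by an integer.\<close>

definition deg :: "(nat \<Rightarrow> nat) \<Rightarrow> int^'d" where "deg \<beta> = (\<Sum>i<N. of_nat (\<beta> i) * \<delta> i)"
definition Exps :: "(nat \<Rightarrow> nat) set" where "Exps = {\<beta>. \<forall>i\<ge>N. \<beta> i = 0}"
definition madd :: "(nat \<Rightarrow> nat) \<Rightarrow> (nat \<Rightarrow> nat) \<Rightarrow> nat \<Rightarrow> nat" where "madd \<beta> \<gamma> i = \<beta> i + \<gamma> i"

lemma mono_madd: "mono (madd \<beta> \<gamma>) = mono \<beta> * mono \<gamma>"
  by (simp add: mono_def madd_def power_add prod.distrib)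

lemma madd_Exps: "\<beta> \<in> Exps \<Longrightarrow> \<gamma> \<in> Exps \<Longrightarrow> madd \<beta> \<gamma> \<in> Exps"
  by (simp add: Exps_def madd_def)

lemma gr_one: "1 \<in> gr 0"
  unfolding gr_zero using scale_one by (metis rangeI)

lemma mono_gr: "mono \<beta> \<in> gr (deg \<beta>)"
proof -
  have p: "z i ^ e \<in> gr (of_nat e * \<delta> i)" if "i < N" for i e
  proof (induction e)
    case (Suc e)
    then show ?case using gr_mult[OF z_gr[OF that] Suc] by (simp add: distrib_right)
  qed (simp add: gr_one)
  have "(\<Prod>i<M. z i ^ \<beta> i) \<in> gr (\<Sum>i<M. of_nat (\<beta> i) * \<delta> i)" if "M \<le> N" for M
    using that
  proof (induction M)
    case (Suc M)
    then show ?case using gr_mult[OF _ p[of M "\<beta> M"]] by simp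
  qed (simp add: gr_one)
  then show ?thesis by (simp add: mono_def deg_def)
qed

lemma wp_deg: "weight_pairing (deg \<beta>) \<xi> = (\<Sum>i<N. real (\<beta> i) * weight_pairing (\<delta> i) \<xi>)"
proof -
  have 1: "weight_pairing (of_nat e * a) \<xi> = real e * weight_pairing a \<xi>" for e :: nat and a
    by (induction e) (auto simp: weight_pairing_add distrib_right)
  have "weight_pairing (\<Sum>i\<in>A. f i) \<xi> = (\<Sum>i\<in>A. weight_pairing (f i) \<xi>)" if "finite A" for A and f :: "nat \<Rightarrow> int^'d"
    using that by (induction A) (auto simp: weight_pairing_add)
  then show ?thesis by (simp add: deg_def 1)
qed

abbreviation spn where "spn P \<equiv> span {mono \<gamma> |\<gamma>. \<gamma> \<in> Exps \<and> P \<gamma>}"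

lemma mono_times_spn:
  assumes h: "h \<in> spn P" and \<nu>: "\<nu> \<in> Exps" and Q: "\<And>\<gamma>. \<gamma> \<in> Exps \<Longrightarrow> P \<gamma> \<Longrightarrow> Q (madd \<nu> \<gamma>)"
  shows "mono \<nu> * h \<in> spn Q"
  using h
proof (induction rule: span_induct_alt)
  case base then show ?case by (simp add: span_zero)
next
  case (step c b h)
  then obtain \<gamma> where \<gamma>: "\<gamma> \<in> Exps" "P \<gamma>" "b = mono \<gamma>" by auto
  have "mono \<nu> * b \<in> spn Q"
    using \<gamma> \<nu> Q madd_Exps by (intro span_base) (auto simp: mono_madd[symmetric])
  then show ?case using step by (simp add: distrib_left scale_mult_right span_add span_scale)
qed

lemma in_spn: "f \<in> spn (\<lambda>_. True)"
proof -
  let ?D = "spn (\<lambda>_. True)"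
  have one: "1 \<in> ?D"
    by (intro span_base CollectI exI[of _ "\<lambda>_. 0"]) (auto simp: mono_def Exps_def)
  have "is_subring ?D"
    unfolding is_subring_def
  proof (intro conjI ballI one span_diff)
    fix a b assume "a \<in> ?D" and b: "b \<in> ?D"
    then show "a * b \<in> ?D"
    proof (induction rule: span_induct_alt)
      case base then show ?case by (simp add: span_zero)
    next
      case (step c m h)
      then obtain \<gamma> where "\<gamma> \<in> Exps" "m = mono \<gamma>" by auto
      then have "m * b \<in> ?D" using mono_times_spn[OF b, of \<gamma> "\<lambda>_. True"] by simp
      then show ?case using step by (simp add: distrib_right scale_mult span_add span_scale)
    qed
  qed auto
  moreover have "range (\<lambda>c. smul c 1) \<subseteq> ?D" using one span_scale by auto
  moreover have "z ` {..<N} \<subseteq> ?D"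
  proof
    fix a assume "a \<in> z ` {..<N}"
    then obtain i where i: "i < N" "a = z i" by auto
    have "mono (\<lambda>j. if j = i then 1 else 0) = (\<Prod>j<N. if j = i then z i else 1)"
      unfolding mono_def by (rule prod.cong) auto
    also have "\<dots> = z i" using i by (simp add: prod.delta)
    finally show "a \<in> ?D" using i
      by (intro span_base CollectI exI[of _ "\<lambda>j. if j = i then 1 else 0"]) (auto simp: Exps_def)
  qed
  ultimately show ?thesis using generating by blast
qed

text \<open>Lets the relations between generators, which need not be homogeneous, be replaced by
  their component of one degree. That component has only finitely many monomials available.\<close>

lemma spn_component:
  assumes f: "f \<in> gr \<alpha>" and s: "f \<in> spn P" shows "f \<in> spn (\<lambda>\<gamma>. P \<gamma> \<and> deg \<gamma> = \<alpha>)"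
proof -
  obtain T r where T: "finite T" "T \<subseteq> {mono \<gamma> |\<gamma>. \<gamma> \<in> Exps \<and> P \<gamma>}" "f = (\<Sum>a\<in>T. smul (r a) a)"
    using s unfolding span_explicit by blast
  define g where "g a = (SOME \<gamma>. \<gamma> \<in> Exps \<and> P \<gamma> \<and> a = mono \<gamma>)" for a
  have g: "g a \<in> Exps" "P (g a)" "a = mono (g a)" if "a \<in> T" for a
    using someI_ex[of "\<lambda>\<gamma>. \<gamma> \<in> Exps \<and> P \<gamma> \<and> a = mono \<gamma>"] that T(2) unfolding g_def by blast+
  \<comment> \<open>\<open>None\<close> indexes the term \<open>- f\<close>, so that the
    representation of \<open>f\<close> becomes a vanishing sum of homogeneous terms.\<close>
  define I where "I = insert None (Some ` T)"
  define h where "h i = (case i of None \<Rightarrow> - f | Some a \<Rightarrow> smul (r a) a)" for i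
  define d where "d i = (case i of None \<Rightarrow> \<alpha> | Some a \<Rightarrow> deg (g a))" for i
  have I: "finite I" using T(1) by (simp add: I_def)
  have hd: "h i \<in> gr (d i)" if "i \<in> I" for i
    using that f g mono_gr subspace_scale[OF gr_subspace] subspace_neg[OF gr_subspace]
    by (auto simp: I_def h_def d_def) (metis)
  have "(\<Sum>i\<in>I. h i) = 0"
    unfolding I_def using T(1) by (subst sum.insert) (auto simp: h_def sum.reindex T(3))
  from component_zero[OF I hd this, of \<alpha>]
  have "(\<Sum>i\<in>{i \<in> I. d i = \<alpha>}. h i) = 0" .
  also have "{i \<in> I. d i = \<alpha>} = insert None (Some ` {a \<in> T. deg (g a) = \<alpha>})"
    by (auto simp: I_def d_def)
  finally have "f = (\<Sum>a\<in>{a \<in> T. deg (g a) = \<alpha>}. smul (r a) a)"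
    using T(1) by (subst (asm) sum.insert) (auto simp: h_def sum.reindex)
  moreover have "(\<Sum>a\<in>{a \<in> T. deg (g a) = \<alpha>}. smul (r a) a) \<in> spn (\<lambda>\<gamma>. P \<gamma> \<and> deg \<gamma> = \<alpha>)"
    using g by (intro span_sum span_scale span_base) blast
  ultimately show ?thesis by simp
qed

text \<open>On \<open>Exps\<close> this amounts to \<open>lexgt\<close>. With inequalities in place
  of equalities before \<open>i\<close> it is the form in which the boundary relations produce their
  tails.\<close>

definition above :: "(nat \<Rightarrow> nat) \<Rightarrow> (nat \<Rightarrow> nat) \<Rightarrow> bool"
  where "above \<gamma> \<beta> \<longleftrightarrow> (\<exists>i<N. (\<forall>j<i. \<beta> j \<le> \<gamma> j) \<and> \<beta> i < \<gamma> i)"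

definition lexgt :: "(nat \<Rightarrow> nat) \<Rightarrow> (nat \<Rightarrow> nat) \<Rightarrow> bool"
  where "lexgt \<gamma> \<beta> \<longleftrightarrow> (\<exists>i. (\<forall>j<i. \<beta> j = \<gamma> j) \<and> \<beta> i < \<gamma> i)"

lemma above_madd: "above \<gamma> \<beta> \<Longrightarrow> above (madd \<nu> \<gamma>) (madd \<nu> \<beta>)"
  by (auto simp: above_def madd_def)

lemma above_lexgt: assumes "above \<gamma> \<beta>" shows "lexgt \<gamma> \<beta>"
proof -
  obtain i where i: "\<forall>j<i. \<beta> j \<le> \<gamma> j" "\<beta> i < \<gamma> i" using assms by (auto simp: above_def)
  define k where "k = (LEAST k. \<beta> k < \<gamma> k)"
  have "\<beta> k < \<gamma> k" unfolding k_def by (rule LeastI, rule i(2))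
  moreover have "k \<le> i" unfolding k_def by (rule Least_le, rule i(2))
  moreover have "\<not> \<beta> j < \<gamma> j" if "j < k" for j using not_less_Least that unfolding k_def by blast
  ultimately show ?thesis unfolding lexgt_def using i(1) by (metis le_neq_implies_less order_less_le_trans)
qed

lemma lexgt_trans: assumes "lexgt a b" "lexgt b c" shows "lexgt a c"
proof -
  obtain i k where "\<forall>j<i. b j = a j" "b i < a i" "\<forall>j<k. c j = b j" "c k < b k"
    using assms by (auto simp: lexgt_def)
  then show ?thesis unfolding lexgt_def
    by (intro exI[of _ "min i k"]) (smt (verit) min_less_iff_conj min_def not_less_iff_gr_or_eq order_less_trans linorder_not_le)
qed

lemma lexgt_irrefl: "\<not> lexgt a a" by (auto simp: lexgt_def)

text \<open>In \<open>z i ^ m * (t + a * z i)\<close> the second summand carries one more power of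
  \<open>z i\<close> than the leading monomial, whose remaining factors involve only later
  generators; so whatever \<open>a\<close> is, it contributes lexicographically larger monomials.
  For \<open>s = 0\<close> the leading monomial is a combination of larger ones.\<close>

lemma boundary_relation:
  assumes "sorted_wrt (<) is" "set is \<subseteq> {..<N}" "s \<in> boundary_monoid UNIV (map z is)"
  shows "\<exists>\<mu>. (\<forall>j. j \<notin> set is \<longrightarrow> \<mu> j = 0) \<and> s - mono \<mu> \<in> spn (\<lambda>\<gamma>. above \<gamma> \<mu>)"
  using assms
proof (induction "is" arbitrary: s)
  case Nil
  then show ?case by (intro exI[of _ "\<lambda>_. 0"]) (auto simp: mono_def span_zero)
next
  case (Cons i ks)
  then obtain m t a where t: "t \<in> boundary_monoid UNIV (map z ks)" "s = z i ^ m * (t + a * z i)" by auto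
  have i: "i < N" "\<And>j. j \<in> set ks \<Longrightarrow> i < j" using Cons.prems by auto
  obtain \<mu> where \<mu>: "\<forall>j. j \<notin> set ks \<longrightarrow> \<mu> j = 0" "t - mono \<mu> \<in> spn (\<lambda>\<gamma>. above \<gamma> \<mu>)"
    using Cons.IH[OF _ _ t(1)] Cons.prems by auto
  define e where "e k j = (if j = i then k else (0::nat))" for k j
  have eE: "e k \<in> Exps" for k using i by (auto simp: e_def Exps_def)
  have me: "mono (e k) = z i ^ k" for k
  proof -
    have "mono (e k) = (\<Prod>j<N. if j = i then z i ^ k else 1)"
      unfolding mono_def by (rule prod.cong) (auto simp: e_def)
    then show ?thesis using i by (simp add: prod.delta)
  qed
  have "mono (e m) * (t - mono \<mu>) \<in> spn (\<lambda>\<gamma>. above \<gamma> (madd (e m) \<mu>))"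
    by (rule mono_times_spn[OF \<mu>(2) eE]) (rule above_madd)
  moreover have "mono (e (Suc m)) * a \<in> spn (\<lambda>\<gamma>. above \<gamma> (madd (e m) \<mu>))"
  proof (rule mono_times_spn[OF in_spn eE])
    fix \<gamma>
    have "\<mu> j = 0" if "j \<le> i" for j using \<mu>(1) i(2)[of j] that by auto
    then show "above (madd (e (Suc m)) \<gamma>) (madd (e m) \<mu>)"
      unfolding above_def by (intro exI[of _ i]) (auto simp: i madd_def e_def)
  qed
  ultimately have "mono (e m) * (t - mono \<mu>) + mono (e (Suc m)) * a \<in> spn (\<lambda>\<gamma>. above \<gamma> (madd (e m) \<mu>))"
    by (rule span_add)
  moreover have "mono (e m) * (t - mono \<mu>) + mono (e (Suc m)) * a = s - mono (madd (e m) \<mu>)"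
    by (simp add: t(2) me mono_madd algebra_simps)
  ultimately have "s - mono (madd (e m) \<mu>) \<in> spn (\<lambda>\<gamma>. above \<gamma> (madd (e m) \<mu>))" by simp
  moreover have "\<forall>j. j \<notin> set (i # ks) \<longrightarrow> madd (e m) \<mu> j = 0" using \<mu>(1) by (auto simp: madd_def e_def)
  ultimately show ?case by blast
qed

lemma exponent_bound:
  obtains w where "w > 0" "\<And>\<gamma> i c. weight_pairing (deg \<gamma>) \<xi> \<le> c \<Longrightarrow> i < N \<Longrightarrow> real (\<gamma> i) \<le> c / w"
proof -
  \<comment> \<open>The smallest weight of a generator; the inserted 1 keeps \<open>Min\<close>
    meaningful for \<open>N = 0\<close>.\<close>
  define w where "w = Min (insert 1 ((\<lambda>i. weight_pairing (\<delta> i) \<xi>) ` {..<N}))"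
  have w: "w > 0" "\<And>i. i < N \<Longrightarrow> w \<le> weight_pairing (\<delta> i) \<xi>"
    using \<delta>_pos unfolding w_def by (auto simp: Min_gr_iff intro: Min_le)
  have "real (\<gamma> i) \<le> c / w" if "weight_pairing (deg \<gamma>) \<xi> \<le> c" "i < N" for \<gamma> i c
  proof -
    have "real (\<gamma> i) * w \<le> real (\<gamma> i) * weight_pairing (\<delta> i) \<xi>" using w(2)[OF that(2)] by (simp add: mult_left_mono)
    also have "\<dots> \<le> weight_pairing (deg \<gamma>) \<xi>" unfolding wp_deg using that(2) \<delta>_pos
      by (intro member_le_sum[of i "{..<N}" "\<lambda>i. real (\<gamma> i) * weight_pairing (\<delta> i) \<xi>"]) (auto simp: less_imp_le)
    finally show ?thesis using that(1) w(1) by (simp add: pos_le_divide_eq)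
  qed
  then show thesis using that w(1) by blast
qed

lemma finite_deg: "finite {\<gamma> \<in> Exps. weight_pairing (deg \<gamma>) \<xi> \<le> c}"
proof -
  obtain w where w: "w > 0" "\<And>\<gamma> i c. weight_pairing (deg \<gamma>) \<xi> \<le> c \<Longrightarrow> i < N \<Longrightarrow> real (\<gamma> i) \<le> c / w"
    using exponent_bound by metis
  have bd: "\<gamma> i \<le> nat \<lfloor>c / w\<rfloor>" if "weight_pairing (deg \<gamma>) \<xi> \<le> c" "i < N" for \<gamma> i
    using w(2)[OF that] by (simp add: le_nat_floor)
  have "{\<gamma> \<in> Exps. weight_pairing (deg \<gamma>) \<xi> \<le> c} \<subseteq> {\<gamma>. \<forall>i. (i \<in> {..<N} \<longrightarrow> \<gamma> i \<in> {..nat \<lfloor>c / w\<rfloor>}) \<and> (i \<notin> {..<N} \<longrightarrow> \<gamma> i = 0)}"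
    using bd by (auto simp: Exps_def)
  then show ?thesis by (rule finite_subset) (rule finite_set_of_finite_funs, auto)
qed

text \<open>Rewriting goes towards lexicographically larger monomials. It stops because the degree
  is preserved and, the weights being positive, only finitely many exponents share a degree.\<close>

lemma standard_reduction:
  assumes bad: "\<And>\<beta>. \<beta> \<in> Exps \<Longrightarrow> \<not> good \<beta> \<Longrightarrow> mono \<beta> \<in> spn (\<lambda>\<gamma>. above \<gamma> \<beta>)" and \<beta>: "\<beta> \<in> Exps"
  shows "mono \<beta> \<in> spn (\<lambda>\<gamma>. good \<gamma> \<and> deg \<gamma> = deg \<beta>)"
  using \<beta>
proof (induction "card {\<gamma> \<in> Exps. deg \<gamma> = deg \<beta> \<and> lexgt \<gamma> \<beta>}" arbitrary: \<beta> rule: less_induct)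
  case less
  show ?case
  proof (cases "good \<beta>")
    case True
    then show ?thesis using less.prems by (intro span_base) auto
  next
    case False
    have "mono \<beta> \<in> spn (\<lambda>\<gamma>. above \<gamma> \<beta> \<and> deg \<gamma> = deg \<beta>)"
      by (rule spn_component[OF mono_gr bad[OF less.prems False]])
    also have "\<dots> \<subseteq> span (spn (\<lambda>\<gamma>. good \<gamma> \<and> deg \<gamma> = deg \<beta>))"
    proof (rule span_mono, safe)
      fix \<gamma> assume \<gamma>: "\<gamma> \<in> Exps" "above \<gamma> \<beta>" "deg \<gamma> = deg \<beta>"
      have lt: "lexgt \<gamma> \<beta>" by (rule above_lexgt[OF \<gamma>(2)])
      have "finite {\<gamma> \<in> Exps. deg \<gamma> = deg \<beta> \<and> lexgt \<gamma> \<beta>}"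
        by (rule finite_subset[OF _ finite_deg[of "weight_pairing (deg \<beta>) \<xi>"]]) auto
      moreover have "{\<gamma>' \<in> Exps. deg \<gamma>' = deg \<gamma> \<and> lexgt \<gamma>' \<gamma>} \<subset> {\<gamma> \<in> Exps. deg \<gamma> = deg \<beta> \<and> lexgt \<gamma> \<beta>}"
      proof
        show "{\<gamma>' \<in> Exps. deg \<gamma>' = deg \<gamma> \<and> lexgt \<gamma>' \<gamma>} \<subseteq> {\<gamma> \<in> Exps. deg \<gamma> = deg \<beta> \<and> lexgt \<gamma> \<beta>}"
          using \<gamma>(3) lt lexgt_trans by auto
        show "{\<gamma>' \<in> Exps. deg \<gamma>' = deg \<gamma> \<and> lexgt \<gamma>' \<gamma>} \<noteq> {\<gamma> \<in> Exps. deg \<gamma> = deg \<beta> \<and> lexgt \<gamma> \<beta>}"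
          using \<gamma>(1,3) lt lexgt_irrefl[of \<gamma>] by blast
      qed
      ultimately have "mono \<gamma> \<in> spn (\<lambda>\<gamma>'. good \<gamma>' \<and> deg \<gamma>' = deg \<gamma>)"
        using less.hyps[OF _ \<gamma>(1)] psubset_card_mono by blast
      then show "mono \<gamma> \<in> spn (\<lambda>\<gamma>. good \<gamma> \<and> deg \<gamma> = deg \<beta>)" by (simp add: \<gamma>(3))
    qed
    finally show ?thesis by (simp add: span_span)
  qed
qed

end

context homogeneous_generators
begin

text \<open>What remains after the relations is a count: an irreducible exponent has at most
  \<open>n\<close> entries that are not bounded by a constant, and each of these is at most
  \<open>m / w\<close>.\<close>

lemma growth:
  assumes chains: "\<And>k P. (\<forall>i\<le>k. is_prime (UNIV :: 'r set) (P i)) \<and> (\<forall>i<k. P i \<subset> P (Suc i)) \<Longrightarrow> k \<le> n"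
  shows "\<exists>C. \<forall>m. \<exists>T. finite T \<and> graded_part smul gr \<xi> m \<subseteq> span T \<and> real (card T) \<le> C * (real m + 1) ^ n"
proof -
  define L where "L = {ks. sorted_wrt (<) ks \<and> set ks \<subseteq> {..<N} \<and> length ks = n + 1}"
  have finL: "finite L"
    by (rule finite_subset[OF _ finite_lists_length_eq[of "{..<N}" "n + 1"]]) (auto simp: L_def)
  define R where "R ks \<mu> \<longleftrightarrow> (\<forall>j. j \<notin> set ks \<longrightarrow> \<mu> j = 0) \<and> mono \<mu> \<in> spn (\<lambda>\<gamma>. above \<gamma> \<mu>)"
    for ks :: "nat list" and \<mu>
  have "\<exists>\<mu>. (\<forall>j. j \<notin> set ks \<longrightarrow> \<mu> j = 0) \<and> mono \<mu> \<in> spn (\<lambda>\<gamma>. above \<gamma> \<mu>)" if ks: "ks \<in> L" for ks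
  proof -
    have "0 \<in> boundary_monoid UNIV (map z ks)"
    proof (rule ccontr)
      assume "0 \<notin> boundary_monoid UNIV (map z ks)"
      then have "\<exists>P. (\<forall>i\<le>n + 1. is_prime (UNIV :: 'r set) (P i)) \<and> (\<forall>i<n + 1. P i \<subset> P (Suc i))"
        using prime_chain_from_boundary[OF is_subring_UNIV, of "map z ks" "{0}"] ks
        by (auto simp: L_def is_ideal_def)
      then show False using chains[of "n + 1"] by auto
    qed
    then obtain \<mu> where "\<forall>j. j \<notin> set ks \<longrightarrow> \<mu> j = 0" "0 - mono \<mu> \<in> spn (\<lambda>\<gamma>. above \<gamma> \<mu>)"
      using boundary_relation[of ks 0] ks by (auto simp: L_def)
    then show ?thesis using span_neg[of "- mono \<mu>"] by auto
  qed
  then have "\<forall>ks\<in>L. \<exists>\<mu>. R ks \<mu>" by (simp only: R_def) blast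
  from bchoice[OF this] obtain M where "\<forall>ks\<in>L. R ks (M ks)" ..
  then have M: "\<And>ks j. ks \<in> L \<Longrightarrow> j \<notin> set ks \<Longrightarrow> M ks j = 0"
    "\<And>ks. ks \<in> L \<Longrightarrow> mono (M ks) \<in> spn (\<lambda>\<gamma>. above \<gamma> (M ks))" by (simp_all add: R_def)
  \<comment> \<open>Divisible by none of the leading monomials \<open>M ks\<close>. As
    \<open>M ks\<close> is supported on the \<open>n + 1\<close> indices of \<open>ks\<close>, a
    good exponent cannot be large on all of them.\<close>
  define good where "good \<beta> \<longleftrightarrow> (\<forall>ks\<in>L. \<exists>i. \<beta> i < M ks i)" for \<beta>
  have bad: "mono \<beta> \<in> spn (\<lambda>\<gamma>. above \<gamma> \<beta>)" if \<beta>: "\<beta> \<in> Exps" "\<not> good \<beta>" for \<beta>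
  proof -
    obtain ks where ks: "ks \<in> L" "\<And>i. M ks i \<le> \<beta> i" using \<beta>(2) by (auto simp: good_def not_less)
    define \<nu> where "\<nu> i = \<beta> i - M ks i" for i
    have \<nu>: "\<nu> \<in> Exps" using \<beta>(1) by (auto simp: Exps_def \<nu>_def)
    have eq: "madd \<nu> (M ks) = \<beta>" using ks(2) by (auto simp: madd_def \<nu>_def)
    have "mono \<nu> * mono (M ks) \<in> spn (\<lambda>\<gamma>. above \<gamma> \<beta>)"
      unfolding eq[symmetric] by (rule mono_times_spn[OF M(2)[OF ks(1)] \<nu>]) (rule above_madd)
    then show ?thesis using mono_madd[of \<nu> "M ks"] eq by simp
  qed
  define D where "D = Suc (\<Sum>ks\<in>L. \<Sum>i<N. M ks i)"
  have D: "M ks i < D" if "ks \<in> L" "i < N" for ks i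
  proof -
    have "M ks i \<le> (\<Sum>i<N. M ks i)" using that by (intro member_le_sum) auto
    also have "\<dots> \<le> (\<Sum>ks\<in>L. \<Sum>i<N. M ks i)" using that finL by (intro member_le_sum) auto
    finally show ?thesis by (simp add: D_def)
  qed
  have few: "card {i \<in> {..<N}. D \<le> \<beta> i} \<le> n" if gd: "good \<beta>" for \<beta>
  proof (rule ccontr)
    assume "\<not> ?thesis"
    then have "n + 1 \<le> card {i \<in> {..<N}. D \<le> \<beta> i}" by simp
    then obtain U where U: "U \<subseteq> {i \<in> {..<N}. D \<le> \<beta> i}" "card U = n + 1" and fU: "finite U"
      by (rule obtain_subset_with_card_n)
    define ks where "ks = sorted_list_of_set U"
    have ks: "ks \<in> L" "set ks = U" using U fU by (auto simp: L_def ks_def)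
    obtain i where i: "\<beta> i < M ks i" using gd ks(1) unfolding good_def by blast
    then have "i \<in> U" using M(1)[OF ks(1), of i] ks(2) by auto
    then have "i < N" "D \<le> \<beta> i" using U(1) by auto
    then show False using D[OF ks(1), of i] i by linarith
  qed
  obtain w where w: "w > 0" "\<And>\<gamma> i c. weight_pairing (deg \<gamma>) \<xi> \<le> c \<Longrightarrow> i < N \<Longrightarrow> real (\<gamma> i) \<le> c / w"
    using exponent_bound by metis
  \<comment> \<open>\<open>2 ^ N\<close> bounds the choices of the set of large entries,
    \<open>D ^ N\<close> the small entries, and the last factor comes from
    \<open>K + 1 \<le> (1 / w + 1) * (m + 1)\<close>.\<close>
  define C where "C = 2 ^ N * real D ^ N * (1 / w + 1) ^ n"
  have "\<exists>T. finite T \<and> graded_part smul gr \<xi> m \<subseteq> span T \<and> real (card T) \<le> C * (real m + 1) ^ n" for m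
  proof -
    define G where "G = {\<beta> \<in> Exps. good \<beta> \<and> weight_pairing (deg \<beta>) \<xi> \<le> real m}"
    have finG: "finite G" by (rule finite_subset[OF _ finite_deg[of "real m"]]) (auto simp: G_def)
    define K where "K = nat \<lfloor>real m / w\<rfloor>"
    define Q where "Q I = PiE {..<N} (\<lambda>i. if i \<in> I then {..K} else {..<D})" for I
    let ?II = "{I \<in> Pow {..<N}. card I \<le> n}"
    have cQ: "card (Q I) \<le> (K + 1) ^ n * D ^ N" if I: "I \<in> ?II" for I
    proof -
      have "card (Q I) = (\<Prod>i<N. card (if i \<in> I then {..K} else {..<D}))" unfolding Q_def by (simp add: card_PiE)
      also have "\<dots> \<le> (\<Prod>i<N. (if i \<in> I then K + 1 else 1) * D)"
        by (rule prod_mono) (auto simp: D_def)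
      also have "\<dots> = (\<Prod>i<N. if i \<in> I then K + 1 else 1) * D ^ N" by (simp add: prod.distrib)
      also have "(\<Prod>i<N. if i \<in> I then K + 1 else 1) = (\<Prod>i\<in>I. K + 1)"
        using I by (subst prod.inter_restrict[symmetric]) (auto intro!: prod.cong simp: Int_absorb1)
      also have "\<dots> \<le> (K + 1) ^ n" using I power_increasing[of "card I" n "K + 1"] by simp
      finally show ?thesis by simp
    qed
    have inj: "inj_on (\<lambda>\<beta>. restrict \<beta> {..<N}) G"
    proof (rule inj_onI)
      fix a b assume ab: "a \<in> G" "b \<in> G" "restrict a {..<N} = restrict b {..<N}"
      show "a = b"
      proof
        fix i show "a i = b i"
          using fun_cong[OF ab(3), of i] ab(1,2) by (cases "i < N") (simp_all add: G_def Exps_def)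
      qed
    qed
    have sub: "(\<lambda>\<beta>. restrict \<beta> {..<N}) ` G \<subseteq> (\<Union>I\<in>?II. Q I)"
    proof safe
      fix \<beta> assume b: "\<beta> \<in> G"
      let ?I = "{i \<in> {..<N}. D \<le> \<beta> i}"
      have "?I \<in> ?II" using few b by (auto simp: G_def)
      moreover have "restrict \<beta> {..<N} \<in> Q ?I"
        using w(2)[of \<beta> "real m"] b by (auto simp: Q_def G_def K_def le_nat_floor)
      ultimately show "restrict \<beta> {..<N} \<in> (\<Union>I\<in>?II. Q I)" by blast
    qed
    have fII: "finite ?II" by simp
    have fQ: "finite (Q I)" for I unfolding Q_def by (intro finite_PiE) auto
    have "card G = card ((\<lambda>\<beta>. restrict \<beta> {..<N}) ` G)" using card_image[OF inj] by simp
    also have "\<dots> \<le> card (\<Union>I\<in>?II. Q I)" using fQ by (intro card_mono[OF _ sub]) auto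
    also have "\<dots> \<le> (\<Sum>I\<in>?II. card (Q I))" by (rule card_UN_le[OF fII])
    also have "\<dots> \<le> (\<Sum>I\<in>?II. (K + 1) ^ n * D ^ N)" by (rule sum_mono) (rule cQ)
    also have "\<dots> = card ?II * ((K + 1) ^ n * D ^ N)" by simp
    also have "\<dots> \<le> 2 ^ N * ((K + 1) ^ n * D ^ N)"
      using card_mono[of "Pow {..<N}" ?II] by (intro mult_right_mono) (auto simp: card_Pow)
    finally have "real (card G) \<le> real (2 ^ N * ((K + 1) ^ n * D ^ N))" by (simp only: of_nat_le_iff)
    also have "\<dots> = 2 ^ N * real D ^ N * (real K + 1) ^ n" by (simp add: add.commute)
    also have "\<dots> \<le> 2 ^ N * real D ^ N * ((1 / w + 1) * (real m + 1)) ^ n"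
    proof (intro mult_left_mono power_mono)
      have "real K \<le> real m / w" using w(1) by (simp add: K_def)
      moreover have "(1 / w + 1) * (real m + 1) = real m / w + 1 / w + real m + 1" by (simp add: algebra_simps)
      moreover have "1 / w > 0" using w(1) by simp
      ultimately show "real K + 1 \<le> (1 / w + 1) * (real m + 1)" by linarith
    qed auto
    also have "\<dots> = C * (real m + 1) ^ n" by (simp add: C_def power_mult_distrib mult.assoc)
    finally have cG: "real (card G) \<le> C * (real m + 1) ^ n" .
    have "graded_part smul gr \<xi> m \<subseteq> span (mono ` G)"
      unfolding graded_part_def
    proof (rule span_minimal)
      show "subspace (span (mono ` G))" by simp
      show "(\<Union>\<alpha>\<in>{\<alpha>. weight_pairing \<alpha> \<xi> \<le> real m}. gr \<alpha>) \<subseteq> span (mono ` G)"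
      proof safe
        fix f \<alpha> assume \<alpha>: "weight_pairing \<alpha> \<xi> \<le> real m" "f \<in> gr \<alpha>"
        have "f \<in> spn (\<lambda>\<gamma>. True \<and> deg \<gamma> = \<alpha>)" by (rule spn_component[OF \<alpha>(2) in_spn])
        also have "\<dots> \<subseteq> span (span (mono ` G))"
        proof (rule span_mono, safe)
          fix \<gamma> assume "\<gamma> \<in> Exps" "\<alpha> = deg \<gamma>"
          then have "mono \<gamma> \<in> spn (\<lambda>\<gamma>. good \<gamma> \<and> deg \<gamma> = \<alpha>)" using standard_reduction[of good, OF bad] by blast
          also have "\<dots> \<subseteq> span (mono ` G)" by (rule span_mono) (use \<alpha>(1) in \<open>auto simp: G_def\<close>)
          finally show "mono \<gamma> \<in> span (mono ` G)" .
        qed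
        finally show "f \<in> span (mono ` G)" by (simp add: span_span)
      qed
    qed
    moreover have "real (card (mono ` G)) \<le> C * (real m + 1) ^ n"
      using card_image_le[OF finG, of mono] cG by linarith
    ultimately show ?thesis using finG by blast
  qed
  then show ?thesis by blast
qed

end

context polarized_affine_variety
begin

text \<open>The homogeneous components of finitely many generators, without those of degree 0: the
  latter are scalars by \<open>gr_zero\<close>, and all other occurring degrees have positive weight
  by \<open>reeb\<close>.\<close>

lemma homogeneous_generators_exist:
  obtains N z \<delta> where "homogeneous_generators smul gr \<mm> \<xi> N z \<delta>"
proof -
  obtain S where S: "finite S" "generate_ring (ring_on UNIV) (range (\<lambda>c. smul c 1) \<union> S) = UNIV"
    using finitely_generated by blast
  have "\<forall>s. \<exists>c. decomposes gr s c" using gr_direct_sum by blast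
  then obtain c where c: "\<And>s. decomposes gr s (c s)" by metis
  \<comment> \<open>Components are stored together with their degrees, so that an enumeration of
    \<open>Z\<close> yields \<open>z\<close> and \<open>\<delta>\<close> at once.\<close>
  define Z where "Z = (\<Union>s\<in>S. (\<lambda>\<alpha>. (\<alpha>, c s \<alpha>)) ` ({\<alpha>. c s \<alpha> \<noteq> 0} - {0}))"
  have finZ: "finite Z" unfolding Z_def using S(1) c by (auto simp: decomposes_def)
  define N where "N = card Z"
  obtain h where h: "bij_betw h {..<N} Z"
    using ex_bij_betw_nat_finite[OF finZ] by (auto simp: N_def atLeast0LessThan)
  define z where "z i = snd (h i)" for i
  define \<delta> where "\<delta> i = fst (h i)" for i
  have hZ: "h i \<in> Z" if "i < N" for i using h that by (auto simp: bij_betw_def)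
  have "homogeneous_generators smul gr \<mm> \<xi> N z \<delta>"
  proof unfold_locales
    fix i assume "i < N"
    then obtain s \<alpha> where s: "s \<in> S" "h i = (\<alpha>, c s \<alpha>)" "c s \<alpha> \<noteq> 0" "\<alpha> \<noteq> 0" using hZ[of i] by (auto simp: Z_def)
    then show "z i \<in> gr (\<delta> i)" using c by (auto simp: z_def \<delta>_def decomposes_def)
    have "gr \<alpha> \<noteq> {0}" using c[of s] s(3) by (auto simp: decomposes_def)
    then show "0 < weight_pairing (\<delta> i) \<xi>" using reeb s by (auto simp: \<delta>_def)
  next
    fix D :: "'r set" assume D: "is_subring D" "range (\<lambda>c. smul c 1) \<subseteq> D" "z ` {..<N} \<subseteq> D"
    have ZD: "y \<in> D" if "(\<alpha>, y) \<in> Z" for \<alpha> y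
    proof -
      obtain i where "i < N" "h i = (\<alpha>, y)" using h \<open>(\<alpha>, y) \<in> Z\<close> by (force simp: bij_betw_def)
      then show ?thesis using D(3) by (force simp: z_def)
    qed
    have "S \<subseteq> D"
    proof
      fix s assume s: "s \<in> S"
      have "c s \<alpha> \<in> D" if "c s \<alpha> \<noteq> 0" for \<alpha>
      proof (cases "\<alpha> = 0")
        case True
        have "c s 0 \<in> gr 0" using c[of s] unfolding decomposes_def by blast
        then show ?thesis using D(2) gr_zero True by auto
      next
        case False
        then show ?thesis using ZD[of \<alpha> "c s \<alpha>"] s that by (auto simp: Z_def)
      qed
      then have "(\<Sum>\<alpha>\<in>A. c s \<alpha>) \<in> D" if "A \<subseteq> {\<alpha>. c s \<alpha> \<noteq> 0}" for A
        using that by (induction A rule: infinite_finite_induct) (auto simp: is_subringD[OF D(1)])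
      then have "(\<Sum>\<alpha> | c s \<alpha> \<noteq> 0. c s \<alpha>) \<in> D" by blast
      moreover have "s = (\<Sum>\<alpha> | c s \<alpha> \<noteq> 0. c s \<alpha>)" using c[of s] unfolding decomposes_def by blast
      ultimately show "s \<in> D" by (rule back_subst[where P = "\<lambda>s. s \<in> D", OF _ sym])
    qed
    then show "D = UNIV" using generate_ring_ring_on(3)[OF D(1), of "range (\<lambda>c. smul c 1) \<union> S"] D(2) S(2) by auto
  qed
  then show thesis by (rule that)
qed

lemma graded_part_growth:
  assumes "krull_dim (UNIV :: 'r set) = enat n"
  obtains C where "\<And>m. \<exists>T. finite T \<and> graded_part smul gr \<xi> m \<subseteq> span T \<and> real (card T) \<le> C * (real m + 1) ^ n"
proof -
  obtain N z \<delta> where "homogeneous_generators smul gr \<mm> \<xi> N z \<delta>" by (rule homogeneous_generators_exist)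
  then interpret homogeneous_generators smul gr \<mm> \<xi> N z \<delta> .
  show thesis using growth[of n] krull_dim_eqD(2)[OF is_subring_UNIV assms] that by blast
qed

definition \<kappa> :: "'k \<Rightarrow> 'r fract" where "\<kappa> c = to_fract (smul c 1)"

lemma const_hom:
  "\<kappa> (a - b) = \<kappa> a - \<kappa> b" "\<kappa> (a * b) = \<kappa> a * \<kappa> b" "\<kappa> 1 = 1" "\<kappa> 0 = 0" "\<kappa> (a + b) = \<kappa> a + \<kappa> b"
proof -
  show "\<kappa> (a - b) = \<kappa> a - \<kappa> b" unfolding \<kappa>_def scale_left_diff_distrib by (rule to_fract_diff)
  show "\<kappa> (a + b) = \<kappa> a + \<kappa> b" unfolding \<kappa>_def scale_left_distrib by (rule to_fract_add)
  have "smul (a * b) 1 = smul a 1 * smul b 1" by (simp add: scale_mult)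
  then show "\<kappa> (a * b) = \<kappa> a * \<kappa> b" unfolding \<kappa>_def by simp
qed (simp_all add: \<kappa>_def)

text \<open>The chart is generated over the field \<open>range \<kappa>\<close> by \<open>S\<close>
  and the generators of \<open>R\<close>, so the basis theorem is applied over a field.\<close>

lemma noeth_finite_type:
  assumes S: "finite S" and A: "A = generate_ring (ring_on UNIV) (range to_fract \<union> S)"
  shows "noeth (A :: 'r fract set)"
proof -
  note k = const_hom
  have K: "is_subring (range \<kappa>)"
    unfolding is_subring_def
  proof (intro conjI ballI)
    show "1 \<in> range \<kappa>" using k(3) by (metis rangeI)
    fix a b assume "a \<in> range \<kappa>" "b \<in> range \<kappa>"
    then obtain c d where "a = \<kappa> c" "b = \<kappa> d" by auto
    then show "a - b \<in> range \<kappa>" "a * b \<in> range \<kappa>" by (simp_all add: k[symmetric])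
  qed
  have N: "noeth (range \<kappa>)"
  proof (rule noeth_field[OF K])
    fix a assume "a \<in> range \<kappa>" "a \<noteq> 0"
    then obtain c where c: "a = \<kappa> c" "c \<noteq> 0" using k(4) by auto
    then have "\<kappa> (inverse c) * a = 1" using k(2)[of "inverse c" c] k(3) by simp
    then show "\<exists>b\<in>range \<kappa>. b * a = 1" by blast
  qed
  obtain S0 where S0: "finite S0" "generate_ring (ring_on UNIV) (range (\<lambda>c. smul c 1) \<union> S0) = (UNIV :: 'r set)"
    using finitely_generated by blast
  obtain Z where Z: "noeth Z" "range \<kappa> \<subseteq> Z" "to_fract ` S0 \<union> S \<subseteq> Z"
    "\<And>D. is_subring D \<Longrightarrow> range \<kappa> \<subseteq> D \<Longrightarrow> to_fract ` S0 \<union> S \<subseteq> D \<Longrightarrow> Z \<subseteq> D"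
    using noeth_finitely_generated[OF N, of "to_fract ` S0 \<union> S"] S0(1) S by auto
  note Zs = is_subringD[OF noethD(1)[OF Z(1)]]
  note g = generate_ring_ring_on[where T = "range to_fract \<union> S", folded A]
  have "Z \<subseteq> A" by (rule Z(4)) (use g in \<open>auto simp: \<kappa>_def\<close>)
  moreover have "A \<subseteq> Z"
  proof (rule g(3)[OF noethD(1)[OF Z(1)]])
    have "is_subring {r. to_fract r \<in> Z}"
      using Zs by (auto simp: is_subring_def to_fract_diff to_fract_mult)
    then have "generate_ring (ring_on UNIV) (range (\<lambda>c. smul c 1) \<union> S0) \<subseteq> {r. to_fract r \<in> Z}"
      by (rule generate_ring_ring_on(3)) (use Z in \<open>auto simp: \<kappa>_def\<close>)
    then show "range to_fract \<union> S \<subseteq> Z" using Z(3) unfolding S0(2) by auto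
  qed
  ultimately show ?thesis using Z(1) by simp
qed

end

section \<open>One-dimensional leaves\<close>

context vector_space
begin

text \<open>For an indexed family, injectivity is part of freeness: \<open>e p = e q\<close> would
  be a relation with coefficients 1 and -1.\<close>

lemma card_le_if_free:
  assumes P: "finite P" and T: "finite T" "e ` P \<subseteq> span T"
    and free: "\<And>c. (\<Sum>p\<in>P. scale (c p) (e p)) = 0 \<Longrightarrow> \<forall>p\<in>P. c p = 0"
  shows "card P \<le> card T"
proof -
  have inj: "inj_on e P"
  proof (rule inj_onI, rule ccontr)
    fix p q assume pq: "p \<in> P" "q \<in> P" "e p = e q" "p \<noteq> q"
    define c where "c r = (if r = p then 1 else if r = q then - 1 else (0::'a))" for r
    have "(\<Sum>r\<in>P. scale (c r) (e r)) = (\<Sum>r\<in>{p, q}. scale (c r) (e r))"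
      using pq P by (intro sum.mono_neutral_right) (auto simp: c_def)
    also have "\<dots> = 0" using pq by (simp add: c_def)
    finally show False using free[of c] pq(1) by (auto simp: c_def)
  qed
  have "independent (e ` P)"
    unfolding dependent_finite[OF finite_imageI[OF P]]
  proof (clarify)
    fix u p assume u: "(\<Sum>v\<in>e ` P. scale (u v) v) = 0" and p: "p \<in> P" "u (e p) \<noteq> 0"
    have "(\<Sum>q\<in>P. scale (u (e q)) (e q)) = 0" using u by (simp add: sum.reindex[OF inj])
    then show False using free[of "\<lambda>q. u (e q)"] p by auto
  qed
  then have "card (e ` P) \<le> card T" using independent_span_bound[OF T(1) _ T(2)] by blast
  then show ?thesis by (simp add: card_image[OF inj])
qed

end

context polarized_affine_variety
begin

lemma span_mult_span:
  assumes f: "f \<in> span U" and g: "g \<in> span V" and W: "\<And>u v. u \<in> U \<Longrightarrow> v \<in> V \<Longrightarrow> u * v \<in> span W"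
  shows "f * g \<in> span W"
  using f
proof (induction rule: span_induct_alt)
  case base then show ?case by (simp add: span_zero)
next
  case (step c u h)
  have "u * g \<in> span W"
    using g
  proof (induction rule: span_induct_alt)
    case base then show ?case by (simp add: span_zero)
  next
    case (step d v k)
    then show ?case using W \<open>u \<in> U\<close> by (simp add: distrib_left scale_mult_right span_add span_scale)
  qed
  then show ?case using step by (simp add: distrib_right scale_mult span_add span_scale)
qed

lemma subspace_graded_part: "subspace (graded_part smul gr \<xi> m)"
  by (simp add: graded_part_def)

lemma graded_part_mono: "m \<le> m' \<Longrightarrow> graded_part smul gr \<xi> m \<subseteq> graded_part smul gr \<xi> m'"
  unfolding graded_part_def by (rule span_mono) force

lemma one_in_graded_part: "1 \<in> graded_part smul gr \<xi> m"
proof -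
  have "1 \<in> gr 0" unfolding gr_zero using scale_one by (metis rangeI)
  then show ?thesis unfolding graded_part_def by (intro span_base UN_I[of 0]) auto
qed

lemma graded_part_mult:
  assumes "f \<in> graded_part smul gr \<xi> m" "g \<in> graded_part smul gr \<xi> m'"
  shows "f * g \<in> graded_part smul gr \<xi> (m + m')"
  using assms unfolding graded_part_def
proof (rule span_mult_span)
  fix u v assume "u \<in> (\<Union>\<alpha>\<in>{\<alpha>. weight_pairing \<alpha> \<xi> \<le> real m}. gr \<alpha>)" "v \<in> (\<Union>\<alpha>\<in>{\<alpha>. weight_pairing \<alpha> \<xi> \<le> real m'}. gr \<alpha>)"
  then obtain \<alpha> \<beta> where "u \<in> gr \<alpha>" "v \<in> gr \<beta>" "weight_pairing \<alpha> \<xi> \<le> real m" "weight_pairing \<beta> \<xi> \<le> real m'" by auto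
  then show "u * v \<in> span (\<Union>\<alpha>\<in>{\<alpha>. weight_pairing \<alpha> \<xi> \<le> real (m + m')}. gr \<alpha>)"
    using gr_mult[of u \<alpha> v \<beta>] by (intro span_base UN_I[of "\<alpha> + \<beta>"]) (auto simp: weight_pairing_add)
qed

lemma graded_part_power: "f \<in> graded_part smul gr \<xi> m \<Longrightarrow> f ^ k \<in> graded_part smul gr \<xi> (k * m)"
  by (induction k) (auto simp: one_in_graded_part graded_part_mult)

lemma in_graded_part: "\<exists>m. f \<in> graded_part smul gr \<xi> m"
proof -
  obtain c where c: "\<And>\<alpha>. c \<alpha> \<in> gr \<alpha>" "finite {\<alpha>. c \<alpha> \<noteq> 0}" "f = (\<Sum>\<alpha> | c \<alpha> \<noteq> 0. c \<alpha>)"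
    using gr_direct_sum[of f] by (auto simp: decomposes_def)
  obtain m :: nat where m: "(\<Sum>\<alpha> | c \<alpha> \<noteq> 0. \<bar>weight_pairing \<alpha> \<xi>\<bar>) \<le> real m" using real_arch_simple by blast
  have "c \<alpha> \<in> graded_part smul gr \<xi> m" if "c \<alpha> \<noteq> 0" for \<alpha>
  proof -
    have "\<bar>weight_pairing \<alpha> \<xi>\<bar> \<le> (\<Sum>\<alpha> | c \<alpha> \<noteq> 0. \<bar>weight_pairing \<alpha> \<xi>\<bar>)"
      using that c(2) by (intro member_le_sum[of \<alpha> _ "\<lambda>\<alpha>. \<bar>weight_pairing \<alpha> \<xi>\<bar>"]) auto
    then show ?thesis using m c(1) unfolding graded_part_def by (intro span_base UN_I[of \<alpha>]) auto
  qed
  then have "f \<in> graded_part smul gr \<xi> m" unfolding c(3) by (intro subspace_sum subspace_graded_part) auto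
  then show ?thesis ..
qed

lemma in_graded_part_finite: "finite A \<Longrightarrow> \<exists>m. A \<subseteq> graded_part smul gr \<xi> m"
proof (induction A rule: finite_induct)
  case (insert a A)
  then obtain m m' where "A \<subseteq> graded_part smul gr \<xi> m" "a \<in> graded_part smul gr \<xi> m'" using in_graded_part by blast
  then show ?case
    using graded_part_mono[of m "max m m'"] graded_part_mono[of m' "max m m'"]
    by (intro exI[of _ "max m m'"]) auto
qed auto

lemma common_denominator:
  assumes "finite W"
  obtains q :: 'r where "q \<noteq> 0" "\<And>w. w \<in> W \<Longrightarrow> \<exists>a. w * to_fract q = to_fract a"
proof -
  have "\<exists>q. q \<noteq> 0 \<and> (\<forall>w\<in>W. \<exists>a :: 'r. w * to_fract q = to_fract a)"
    using assms
  proof induction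
    case empty then show ?case by (intro exI[of _ 1]) auto
  next
    case (insert w W)
    then obtain q where q: "q \<noteq> 0" "\<forall>w\<in>W. \<exists>a. w * to_fract q = to_fract a" by blast
    obtain a b where ab: "w = Fract a b" "b \<noteq> 0" by (cases w) auto
    then have wb: "w * to_fract b = to_fract a" by (simp add: Fract_conv_to_fract)
    have "\<exists>a. w' * to_fract (b * q) = to_fract a" if w': "w' \<in> insert w W" for w'
    proof (cases "w' = w")
      case True
      have "w * to_fract (b * q) = to_fract (a * q)" using wb by (simp add: mult.assoc[symmetric])
      then show ?thesis using True by blast
    next
      case False
      then obtain c where "w' * to_fract q = to_fract c" using q w' by auto
      then have "w' * to_fract (b * q) = to_fract (b * c)" by (simp add: mult.left_commute)
      then show ?thesis by blast
    qed
    then show ?case using q(1) ab(2) by (intro exI[of _ "b * q"]) auto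
  qed
  then show thesis using that by blast
qed

end

locale flag_variety = polarized_affine_variety smul gr \<mm> \<xi> + flag_ring \<eta> x n
  for smul :: "'k::{alg_closed_field, field_char_0} \<Rightarrow> 'r::idom \<Rightarrow> 'r"
    and gr :: "int^'d \<Rightarrow> 'r set" and \<mm> :: "'r set" and \<xi> :: "real^'d"
    and \<eta> :: "'r fract set" and x :: "nat \<Rightarrow> 'r fract" and n :: nat +
  assumes dim_R: "krull_dim (UNIV :: 'r set) = enat n" and R_in: "range to_fract \<subseteq> \<eta>"
begin

definition v :: "'r \<Rightarrow> nat list" where "v f = val (to_fract f)"

lemma to_fract_in: "to_fract f \<in> \<eta>" using R_in by auto

lemma const_in: "\<kappa> c \<in> \<eta>" by (simp add: \<kappa>_def to_fract_in)

lemma const_unit: assumes "c \<noteq> 0" shows "\<kappa> c \<in> \<eta>" "\<kappa> c \<noteq> 0" "\<kappa> c \<notin> nonunits \<eta>"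
proof -
  have 1: "\<kappa> c * \<kappa> (inverse c) = 1" using const_hom(2)[of c "inverse c"] const_hom(3) assms by simp
  show "\<kappa> c \<in> \<eta>" by (rule const_in)
  show "\<kappa> c \<noteq> 0" using 1 by auto
  show "\<kappa> c \<notin> nonunits \<eta>" using 1 const_in[of "inverse c"] by (auto simp: nonunits_def)
qed

lemma to_fract_scale: "to_fract (smul c f) = \<kappa> c * to_fract f"
  using scale_mult[of c 1 f] by (simp add: \<kappa>_def to_fract_mult[symmetric] del: to_fract_mult)

lemma val_unit_mult:
  assumes "u \<in> \<eta>" "u \<notin> nonunits \<eta>" "f \<in> \<eta>" "f \<noteq> 0" shows "val (u * f) = val f"
proof -
  have "u \<noteq> 0" using assms(2) is_idealD(2)[OF local] by auto
  then show ?thesis unfolding val_eq_iff using flag_val_mult assms flag_val_unit by simp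
qed

sublocale valued_space smul v
proof
  fix c :: 'k and f :: 'r assume "c \<noteq> 0" "f \<noteq> 0"
  then show "v (smul c f) = v f"
    using val_unit_mult[OF const_unit(1,3) to_fract_in, of c f] by (simp add: v_def to_fract_scale)
next
  fix f g :: 'r assume "f \<noteq> 0" "g \<noteq> 0" "v f < v g"
  then show "f + g \<noteq> 0 \<and> v (f + g) = v f"
    using val_add[OF to_fract_in _ to_fract_in, of f g]
    by (simp add: v_def to_fract_add[symmetric] del: to_fract_add)
qed

definition evp :: "'r fract \<Rightarrow> 'k poly \<Rightarrow> 'r fract" where "evp w p = poly (map_poly \<kappa> p) w"

lemma evp_pCons: "evp w (pCons a p) = \<kappa> a + w * evp w p"
  by (simp add: evp_def map_poly_pCons const_hom)

lemma evp_add: "evp w (p + q) = evp w p + evp w q"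
  by (induction p q rule: poly_induct2) (simp_all add: evp_pCons const_hom algebra_simps, simp add: evp_def)

lemma evp_smult: "evp w (Polynomial.smult a p) = \<kappa> a * evp w p"
  by (induction p) (simp_all add: evp_pCons const_hom algebra_simps, simp add: evp_def)

lemma evp_in: "w \<in> \<eta> \<Longrightarrow> evp w p \<in> \<eta>"
proof (induction p)
  case 0 then show ?case using S(2) by (simp add: evp_def)
next
  case (pCons a p) then show ?case using S const_in by (simp add: evp_pCons)
qed

lemma evp_monom: "evp w (Polynomial.monom a k) = \<kappa> a * w ^ k"
  by (simp add: evp_def map_poly_monom const_hom poly_monom)

lemma evp_sum: "finite A \<Longrightarrow> evp w (\<Sum>i\<in>A. p i) = (\<Sum>i\<in>A. evp w (p i))"
  by (induction rule: finite_induct) (simp_all add: evp_add, simp add: evp_def)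

text \<open>Over an algebraically closed field \<open>p\<close> splits into linear factors, none of
  which lands in the prime ideal of nonunits at \<open>w\<close>. In other words, a residue class
  outside \<bbbK> is transcendental over \<bbbK>.\<close>

lemma evp_unit:
  assumes w: "w \<in> \<eta>" "\<And>c. w - \<kappa> c \<notin> nonunits \<eta>" and p: "p \<noteq> 0"
  shows "evp w p \<notin> nonunits \<eta>"
  using p
proof (induction "Polynomial.degree p" arbitrary: p)
  case 0
  then obtain a where "p = [:a:]" "a \<noteq> 0" by (metis degree_eq_zeroE pCons_0_0)
  then show ?case using const_unit(3) by (simp add: evp_pCons) (simp add: evp_def)
next
  case (Suc k)
  then obtain c where "poly p c = 0" using alg_closed_imp_poly_has_root[of p] by auto
  then obtain q where q: "p = [:- c, 1:] * q" by (metis dvdE poly_eq_0_iff_dvd)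
  then have "q \<noteq> 0" using Suc.prems by auto
  then have "Polynomial.degree p = Suc (Polynomial.degree q)" unfolding q by (subst degree_mult_eq) auto
  then have nq: "evp w q \<notin> nonunits \<eta>" using Suc \<open>q \<noteq> 0\<close> by auto
  have p: "p = Polynomial.smult (- c) q + pCons 0 q" unfolding q by simp
  moreover have "\<kappa> (- c) = - \<kappa> c" using const_hom(1)[of 0 c] const_hom(4) by simp
  ultimately have "evp w p = (w - \<kappa> c) * evp w q"
    by (simp only: p evp_add evp_smult evp_pCons const_hom) (simp add: algebra_simps)
  then show ?case
    using is_primeD(3)[OF is_prime_nonunits[OF subring local]] nq w(2)[of c] evp_in[OF w(1)] S(3)[OF w(1) const_in] by metis
qed

text \<open>If the residue field of \<open>\<eta>\<close> contained an element outside \<open>\<K>\<close>, represented by \<open>w\<close>, then the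
  monomials in \<open>x\<close> and \<open>w\<close> would be linearly independent and \<open>R\<close> would grow like \<open>m\<^sup>n\<^sup>+\<^sup>1\<close>.\<close>

lemma residue_field:
  assumes w: "w \<in> \<eta>" shows "\<exists>c. w - \<kappa> c \<in> nonunits \<eta>"
proof (rule ccontr)
  assume "\<not> ?thesis"
  then have wu: "evp w p \<notin> nonunits \<eta>" if "p \<noteq> 0" for p using evp_unit[OF w] that by blast
  \<comment> \<open>\<open>w\<close> and the parameters lie only in the function field. A common
    denominator moves them into \<open>R\<close>, at the price of the factor
    \<open>q ^ (k * (n + 1))\<close> common to all monomials with exponents at most
    \<open>k\<close>.\<close>
  obtain q :: 'r where q: "q \<noteq> 0" "\<And>y. y \<in> insert w (x ` {..<n}) \<Longrightarrow> \<exists>a. y * to_fract q = to_fract a"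
    using common_denominator[of "insert w (x ` {..<n})"] by auto
  then have "\<forall>i<n. \<exists>a. x i * to_fract q = to_fract a" by auto
  then obtain a where a: "\<And>i. i < n \<Longrightarrow> x i * to_fract q = to_fract (a i)" by metis
  obtain b where b: "w * to_fract q = to_fract b" using q(2) by auto
  obtain s where s: "insert q (insert b (a ` {..<n})) \<subseteq> graded_part smul gr \<xi> s"
    using in_graded_part_finite[of "insert q (insert b (a ` {..<n}))"] by auto
  obtain C where C: "\<And>m. \<exists>T. finite T \<and> graded_part smul gr \<xi> m \<subseteq> span T \<and> real (card T) \<le> C * (real m + 1) ^ n"
    using graded_part_growth[OF dim_R] by metis
  have main: "real (k + 1) ^ (n + 1) \<le> C * (real ((n + 1) * (k * s)) + 1) ^ n" for k
  proof -
    define A where "A = PiE {..<n} (\<lambda>_. {..k})"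
    have finA: "finite A" unfolding A_def by (intro finite_PiE) auto
    define e where "e p = (\<Prod>i<n. a i ^ fst p i * q ^ (k - fst p i)) * (b ^ snd p * q ^ (k - snd p))" for p :: "(nat \<Rightarrow> nat) \<times> nat"
    have two: "f ^ j * q ^ (k - j) \<in> graded_part smul gr \<xi> (k * s)" if "f \<in> graded_part smul gr \<xi> s" "j \<le> k" for f j
      using graded_part_mult[OF graded_part_power[OF that(1), of j] graded_part_power[of q s "k - j"]] s that(2)
      by (simp add: add_mult_distrib[symmetric])
    have eR: "e p \<in> graded_part smul gr \<xi> ((n + 1) * (k * s))" if "p \<in> A \<times> {..k}" for p
    proof -
      have "(\<Prod>i<l. a i ^ fst p i * q ^ (k - fst p i)) \<in> graded_part smul gr \<xi> (l * (k * s))" if "l \<le> n" for l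
        using that
      proof (induction l)
        case 0 then show ?case by (simp add: one_in_graded_part)
      next
        case (Suc l)
        have "a l ^ fst p l * q ^ (k - fst p l) \<in> graded_part smul gr \<xi> (k * s)"
          using \<open>p \<in> A \<times> {..k}\<close> s Suc.prems by (intro two) (auto simp: A_def PiE_def Pi_def)
        then show ?case using graded_part_mult[OF Suc.IH] Suc.prems by (simp add: add.commute)
      qed
      from graded_part_mult[OF this[OF order_refl] two[of b "snd p"]] s that
      show ?thesis by (auto simp: e_def add.commute)
    qed
    define Q where "Q = to_fract q"
    have Q: "Q \<in> \<eta>" "Q \<noteq> 0" using q(1) to_fract_in by (auto simp: Q_def)
    have efr: "to_fract (e (\<alpha>, j)) = (\<Prod>i<n. x i ^ \<alpha> i) * Q ^ (k * (n + 1)) * w ^ j" if \<alpha>: "\<alpha> \<in> A" and j: "j \<le> k" for \<alpha> j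
    proof -
      have pw: "to_fract (f ^ i) = to_fract f ^ i" for f :: 'r and i by (induction i) auto
      have pp: "to_fract (\<Prod>i\<in>I. g i) = (\<Prod>i\<in>I. to_fract (g i))" if "finite I" for I and g :: "nat \<Rightarrow> 'r"
        using that by induction auto
      have fac: "(y * Q) ^ i * Q ^ (k - i) = y ^ i * Q ^ k" if "i \<le> k" for y i
        using that by (simp add: power_mult_distrib mult.assoc power_add[symmetric])
      have "to_fract (e (\<alpha>, j)) = (\<Prod>i<n. (x i * Q) ^ \<alpha> i * Q ^ (k - \<alpha> i)) * ((w * Q) ^ j * Q ^ (k - j))"
        using a b by (simp add: e_def pp pw Q_def)
      also have "(\<Prod>i<n. (x i * Q) ^ \<alpha> i * Q ^ (k - \<alpha> i)) = (\<Prod>i<n. x i ^ \<alpha> i * Q ^ k)"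
        using \<alpha> by (intro prod.cong fac) (auto simp: A_def PiE_def Pi_def)
      also have "\<dots> = (\<Prod>i<n. x i ^ \<alpha> i) * Q ^ (k * n)" by (simp add: prod.distrib power_mult)
      also have "(w * Q) ^ j * Q ^ (k - j) = w ^ j * Q ^ k" by (rule fac[OF j])
      finally show ?thesis by (simp add: power_add algebra_simps)
    qed
    have xp: "(\<Prod>i<l. x i ^ \<alpha> i) \<in> \<eta> \<and> (\<Prod>i<l. x i ^ \<alpha> i) \<noteq> 0 \<and>
        (\<forall>h<n. flag_val \<eta> x (\<Prod>i<l. x i ^ \<alpha> i) h = (if h < l then \<alpha> h else 0))" if "l \<le> n" for l \<alpha>
    proof -
      have xne: "x i \<noteq> 0" if "i < n" for i using x_notin[OF that] is_idealD(2)[OF J_ideal[of i]] that by auto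
      have pw: "x i ^ k \<in> \<eta> \<and> x i ^ k \<noteq> 0 \<and> (\<forall>h<n. flag_val \<eta> x (x i ^ k) h = (if h = i then k else 0))" if i: "i < n" for i k
      proof (induction k)
        case 0
        then show ?case using S(1) flag_val_unit[OF S(1) one_notin_nonunits[OF subring]] by auto
      next
        case (Suc k)
        then show ?case using S(4)[OF x_in[OF i]] xne[OF i]
          by (auto simp: flag_val_mult[OF x_in[OF i] xne[OF i]] flag_val_x[OF i])
      qed
      show ?thesis using that
      proof (induction l)
        case 0
        then show ?case using S(1) flag_val_unit[OF S(1) one_notin_nonunits[OF subring]] by auto
      next
        case (Suc l)
        then show ?case using pw[of l "\<alpha> l"] S(4) by (auto simp: flag_val_mult)
      qed
    qed
    have "card (A \<times> {..k}) \<le> card T" if T: "finite T" "graded_part smul gr \<xi> ((n + 1) * (k * s)) \<subseteq> span T" for T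
    proof (rule card_le_if_free[where e = e])
      show "finite (A \<times> {..k})" using finA by simp
      show "finite T" "e ` (A \<times> {..k}) \<subseteq> span T" using T eR by auto
      fix c assume c: "(\<Sum>p\<in>A \<times> {..k}. smul (c p) (e p)) = 0"
      \<comment> \<open>The relation is sorted by the exponent of \<open>x\<close>: each coefficient
        is a polynomial in \<open>w\<close>, and a unit of \<open>\<eta>\<close> if that polynomial
        is nonzero. The nonzero groups then have the value \<open>\<alpha>\<close> plus a constant
        vector, and distinct values cannot cancel.\<close>
      define p where "p \<alpha> = (\<Sum>j\<le>k. Polynomial.monom (c (\<alpha>, j)) j)" for \<alpha>
      define g where "g \<alpha> = (\<Sum>j\<le>k. smul (c (\<alpha>, j)) (e (\<alpha>, j)))" for \<alpha>
      define A' where "A' = {\<alpha> \<in> A. p \<alpha> \<noteq> 0}"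
      have gfr: "to_fract (g \<alpha>) = (\<Prod>i<n. x i ^ \<alpha> i) * (Q ^ (k * (n + 1)) * evp w (p \<alpha>))" if "\<alpha> \<in> A" for \<alpha>
        unfolding g_def p_def using that
        by (simp add: efr to_fract_scale evp_sum evp_monom sum_distrib_left algebra_simps)
      have Qp: "Q ^ l \<in> \<eta>" "Q ^ l \<noteq> 0" for l using Q S(7) by auto
      have gv: "g \<alpha> \<noteq> 0 \<and> (\<forall>h<n. flag_val \<eta> x (to_fract (g \<alpha>)) h = \<alpha> h + flag_val \<eta> x (Q ^ (k * (n + 1))) h)" if "\<alpha> \<in> A'" for \<alpha>
      proof -
        have u: "evp w (p \<alpha>) \<in> \<eta>" "evp w (p \<alpha>) \<notin> nonunits \<eta>" using evp_in[OF w] wu that by (auto simp: A'_def)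
        then have u0: "evp w (p \<alpha>) \<noteq> 0" using is_idealD(2)[OF local] by auto
        have m: "Q ^ (k * (n + 1)) * evp w (p \<alpha>) \<in> \<eta>" "Q ^ (k * (n + 1)) * evp w (p \<alpha>) \<noteq> 0"
          using Qp u0 S(4)[OF Qp(1) u(1)] by auto
        have "to_fract (g \<alpha>) \<noteq> 0" using gfr[of \<alpha>] xp[OF order_refl, of \<alpha>] m that by (auto simp: A'_def)
        moreover have "flag_val \<eta> x (to_fract (g \<alpha>)) h = \<alpha> h + flag_val \<eta> x (Q ^ (k * (n + 1))) h" if h: "h < n" for h
        proof -
          have "flag_val \<eta> x (to_fract (g \<alpha>)) h = flag_val \<eta> x (\<Prod>i<n. x i ^ \<alpha> i) h + flag_val \<eta> x (Q ^ (k * (n + 1)) * evp w (p \<alpha>)) h"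
            using gfr[of \<alpha>] \<open>\<alpha> \<in> A'\<close> flag_val_mult[OF _ _ m h] xp[OF order_refl, of \<alpha>] by (auto simp: A'_def)
          then show ?thesis using xp[OF order_refl, of \<alpha>] flag_val_mult[OF Qp u(1) u0 h] flag_val_unit[OF u h] h by simp
        qed
        ultimately show ?thesis by auto
      qed
      have zero: "p \<alpha> = 0 \<Longrightarrow> g \<alpha> = 0" if "\<alpha> \<in> A" for \<alpha>
        using gfr[OF that] by (simp add: evp_def)
      have "(\<Sum>\<alpha>\<in>A'. g \<alpha>) = (\<Sum>\<alpha>\<in>A. g \<alpha>)"
        using finA zero by (intro sum.mono_neutral_left) (auto simp: A'_def)
      also have "\<dots> = 0" using c unfolding g_def by (simp add: sum.cartesian_product)
      finally have s0: "(\<Sum>\<alpha>\<in>A'. g \<alpha>) = 0" .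
      have inj: "inj_on (\<lambda>\<alpha>. v (g \<alpha>)) A'"
      proof (rule inj_onI)
        fix \<alpha> \<beta> assume ab: "\<alpha> \<in> A'" "\<beta> \<in> A'" "v (g \<alpha>) = v (g \<beta>)"
        then have "\<forall>h<n. \<alpha> h = \<beta> h" using gv[of \<alpha>] gv[of \<beta>] by (auto simp: v_def val_eq_iff)
        then show "\<alpha> = \<beta>" using ab by (intro PiE_ext[of \<alpha> "{..<n}" "\<lambda>_. {..k}" \<beta> ]) (auto simp: A'_def A_def)
      qed
      have "A' = {}"
      proof (rule ccontr)
        assume "A' \<noteq> {}"
        then have "(\<Sum>\<alpha>\<in>A'. g \<alpha>) \<noteq> 0"
          using sum_distinct_values[of A' g] inj gv finA by (auto simp: A'_def)
        then show False using s0 by simp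
      qed
      then have p0: "p \<alpha> = 0" if "\<alpha> \<in> A" for \<alpha> using that by (auto simp: A'_def)
      show "\<forall>r\<in>A \<times> {..k}. c r = 0"
      proof safe
        fix \<alpha> j assume "\<alpha> \<in> A" "j \<le> k"
        have "Polynomial.coeff (p \<alpha>) j = (\<Sum>i\<le>k. if i = j then c (\<alpha>, i) else 0)"
          unfolding p_def by (simp add: coeff_sum)
        also have "\<dots> = c (\<alpha>, j)" using \<open>j \<le> k\<close> by (simp add: sum.delta)
        finally show "c (\<alpha>, j) = 0" using p0[OF \<open>\<alpha> \<in> A\<close>] by simp
      qed
    qed
    moreover obtain T where T: "finite T" "graded_part smul gr \<xi> ((n + 1) * (k * s)) \<subseteq> span T"
      "real (card T) \<le> C * (real ((n + 1) * (k * s)) + 1) ^ n" using C by blast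
    ultimately have "real (card (A \<times> {..k})) \<le> C * (real ((n + 1) * (k * s)) + 1) ^ n"
      by (meson of_nat_mono order_trans)
    moreover have "card (A \<times> {..k}) = (k + 1) ^ (n + 1)"
      by (simp add: A_def card_cartesian_product card_PiE)
    ultimately show ?thesis by (metis of_nat_power)
  qed
  define D where "D = real ((n + 1) * s) + 1"
  have D: "D \<ge> 1" by (simp add: D_def)
  have C0: "C \<ge> 0"
  proof -
    have "0 \<le> C * (real ((n + 1) * (0 * s)) + 1) ^ n" using order_trans[OF _ main[of 0]] by simp
    then show ?thesis by simp
  qed
  have "real (k + 1) \<le> C * D ^ n" for k
  proof -
    have "real ((n + 1) * (k * s)) + 1 \<le> D * real (k + 1)"
      unfolding D_def by (simp add: algebra_simps)
    then have "(real ((n + 1) * (k * s)) + 1) ^ n \<le> (D * real (k + 1)) ^ n" by (intro power_mono) auto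
    then have "real (k + 1) ^ (n + 1) \<le> C * (D * real (k + 1)) ^ n"
      using main[of k] C0 by (meson mult_left_mono order_trans)
    then have "real (k + 1) * real (k + 1) ^ n \<le> (C * D ^ n) * real (k + 1) ^ n"
      by (simp add: power_mult_distrib mult.assoc)
    then show ?thesis by (rule mult_right_le_imp_le) simp
  qed
  moreover obtain k :: nat where "C * D ^ n < real k" using reals_Archimedean2 by blast
  ultimately show False by (smt (verit) of_nat_add of_nat_1)
qed

sublocale leaf_space smul v
proof
  fix f g :: 'r assume fg: "f \<noteq> 0" "g \<noteq> 0" "v f = v g"
  have K: "range \<kappa> \<subseteq> \<eta>" using const_in by auto
  have "\<exists>c\<in>range \<kappa>. to_fract f - c * to_fract g = 0 \<or> val (to_fract f) < val (to_fract f - c * to_fract g)"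
    using flag_val_leaf[OF to_fract_in _ to_fract_in _ _ K, of f g] residue_field fg
    unfolding v_def val_eq_iff val_less_iff by (metis (no_types, opaque_lifting) rangeI to_fract_eq_0_iff)
  then obtain c where c: "to_fract f - \<kappa> c * to_fract g = 0 \<or> val (to_fract f) < val (to_fract f - \<kappa> c * to_fract g)" by blast
  have "to_fract f - \<kappa> c * to_fract g = to_fract (f - smul c g)" by (simp add: to_fract_scale)
  then show "\<exists>c. f - smul c g = 0 \<or> v f < v (f - smul c g)"
    using c unfolding v_def by (metis to_fract_eq_0_iff)
qed

lemma graded_part_finite_dim: "\<exists>T. finite T \<and> graded_part smul gr \<xi> m \<subseteq> span T"
  using graded_part_growth[OF dim_R] by metis

lemma card_values:
  assumes "subspace W" "W \<subseteq> graded_part smul gr \<xi> m"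
  shows "finite (v ` (W - {0}))" "card (v ` (W - {0})) = dim W"
  using graded_part_finite_dim[of m] assms finite_values(1)[of W] card_values_eq_dim[of W] by (metis order_trans)+

end

section \<open>Semigroups of lattice points\<close>

definition lattice_pt :: "'a::euclidean_space \<Rightarrow> bool"
  where "lattice_pt v \<longleftrightarrow> (\<forall>b\<in>Basis. v \<bullet> b \<in> \<int>)"

definition floor_vec :: "'a::euclidean_space \<Rightarrow> 'a"
  where "floor_vec v = (\<Sum>b\<in>Basis. of_int \<lfloor>v \<bullet> b\<rfloor> *\<^sub>R b)"

lemma floor_vec_inner: "b \<in> Basis \<Longrightarrow> floor_vec v \<bullet> b = of_int \<lfloor>v \<bullet> b\<rfloor>"
  by (simp add: floor_vec_def)

lemma lattice_pt_floor_vec: "lattice_pt (floor_vec v)"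
  by (simp add: lattice_pt_def floor_vec_inner)

lemma lattice_pt_diff: "lattice_pt a \<Longrightarrow> lattice_pt b \<Longrightarrow> lattice_pt (a - b)"
  by (auto simp: lattice_pt_def inner_diff_left)

lemma lattice_pt_scale: "lattice_pt a \<Longrightarrow> lattice_pt (of_int k *\<^sub>R a)"
  by (auto simp: lattice_pt_def)

lemma lattice_pt_sum: "(\<And>i. i \<in> I \<Longrightarrow> lattice_pt (f i)) \<Longrightarrow> lattice_pt (\<Sum>i\<in>I. f i)"
  by (auto simp: lattice_pt_def inner_sum_left)

lemma lattice_pt_Pair: "lattice_pt (v, h :: real) \<longleftrightarrow> lattice_pt v \<and> h \<in> \<int>"
proof -
  have "lattice_pt (v, h) \<longleftrightarrow> (\<forall>b\<in>Basis. v \<bullet> b \<in> \<int>) \<and> (\<forall>b\<in>(Basis :: real set). h * b \<in> \<int>)"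
    by (simp add: lattice_pt_def Basis_prod_def ball_Un conj_commute)
  then show ?thesis by (simp add: lattice_pt_def)
qed

lemma norm_floor_vec_diff: "norm (floor_vec v - (v :: 'a::euclidean_space)) \<le> real DIM('a)"
proof -
  have "norm (floor_vec v - v) \<le> (\<Sum>b\<in>Basis. \<bar>(floor_vec v - v) \<bullet> b\<bar>)" by (rule norm_le_l1)
  also have "\<dots> \<le> (\<Sum>b\<in>(Basis::'a set). 1)"
    by (rule sum_mono) (simp add: inner_diff_left floor_vec_inner, linarith)
  finally show ?thesis by simp
qed

lemma floor_vec_limit: "(\<lambda>m. (1 / real m) *\<^sub>R floor_vec (real m *\<^sub>R p)) \<longlonglongrightarrow> (p :: 'a::euclidean_space)"
proof (rule Lim_null_comparison[THEN LIM_zero_cancel])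
  show "\<forall>\<^sub>F m in sequentially. norm ((1 / real m) *\<^sub>R floor_vec (real m *\<^sub>R p) - p) \<le> real DIM('a) / real m"
    using eventually_gt_at_top[of "0::nat"]
  proof eventually_elim
    case (elim m)
    have "(1 / real m) *\<^sub>R floor_vec (real m *\<^sub>R p) - p = (1 / real m) *\<^sub>R (floor_vec (real m *\<^sub>R p) - real m *\<^sub>R p)"
      using elim by (simp add: algebra_simps)
    then have "norm ((1 / real m) *\<^sub>R floor_vec (real m *\<^sub>R p) - p) = norm (floor_vec (real m *\<^sub>R p) - real m *\<^sub>R p) / real m"
      by (simp only: norm_scaleR) simp
    then show ?case using norm_floor_vec_diff[of "real m *\<^sub>R p"] by (simp add: divide_right_mono)
  qed
  show "(\<lambda>m. real DIM('a) / real m) \<longlonglongrightarrow> 0" by (rule lim_const_over_n)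
qed

lemma finite_lattice_bounded:
  assumes "bounded A" shows "finite {v \<in> A. lattice_pt (v :: 'a::euclidean_space)}"
proof -
  obtain r where r: "\<And>v. v \<in> A \<Longrightarrow> norm v \<le> r" using assms by (auto simp: bounded_iff)
  let ?L = "{v \<in> A. lattice_pt v}"
  let ?g = "\<lambda>v. restrict (\<lambda>b. \<lfloor>v \<bullet> b\<rfloor>) (Basis :: 'a set)"
  have "inj_on ?g ?L"
  proof (rule inj_onI)
    fix v w assume vw: "v \<in> ?L" "w \<in> ?L" "?g v = ?g w"
    have "v \<bullet> b = w \<bullet> b" if b: "b \<in> Basis" for b
    proof -
      have "\<lfloor>v \<bullet> b\<rfloor> = \<lfloor>w \<bullet> b\<rfloor>" using fun_cong[OF vw(3), of b] b by simp
      then show ?thesis using vw b by (auto simp: lattice_pt_def elim!: Ints_cases)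
    qed
    then show "v = w" by (rule euclidean_eqI)
  qed
  moreover have "?g ` ?L \<subseteq> PiE Basis (\<lambda>_. {- \<lceil>r\<rceil> - 1..\<lceil>r\<rceil>})"
  proof safe
    fix v and b :: 'a assume v: "v \<in> A" and b: "b \<in> Basis"
    have "\<bar>v \<bullet> b\<bar> \<le> r" using Basis_le_norm[OF b, of v] r[OF v] by linarith
    then have "\<lfloor>v \<bullet> b\<rfloor> \<in> {- \<lceil>r\<rceil> - 1..\<lceil>r\<rceil>}"
      by (simp add: le_floor_iff floor_le_iff) linarith
    then show "restrict (\<lambda>b. \<lfloor>v \<bullet> b\<rfloor>) Basis b \<in> {- \<lceil>r\<rceil> - 1..\<lceil>r\<rceil>}" using b by simp
  qed auto
  moreover have "finite (PiE (Basis :: 'a set) (\<lambda>_. {- \<lceil>r\<rceil> - 1..\<lceil>r\<rceil>}))" by (intro finite_PiE) auto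
  ultimately show ?thesis by (meson finite_imageD finite_subset)
qed

subsection \<open>Slices of cones\<close>

definition slice :: "('a::euclidean_space \<times> real) set \<Rightarrow> 'a set"
  where "slice S = {p. (p, 1) \<in> closure (convex_cone hull S)}"

lemma convex_cone_closure: "convex_cone (C :: 'a::euclidean_space set) \<Longrightarrow> convex_cone (closure C)"
  unfolding convex_cone_def using conic_closure convex_closure by fastforce

lemma closed_slice: "closed (slice S)"
proof -
  have "slice S = (\<lambda>p. (p, 1)) -` closure (convex_cone hull S)" by (auto simp: slice_def)
  then show ?thesis by (simp add: continuous_closed_vimage continuous_intros)
qed

lemma convex_slice: "convex (slice S)"
proof (rule convexI)
  fix p q :: 'a and a b :: real assume *: "p \<in> slice S" "q \<in> slice S" "0 \<le> a" "0 \<le> b" "a + b = 1"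
  have "convex (closure (convex_cone hull S))"
    by (intro convex_closure convex_convex_cone_hull)
  from convexD[OF this, of "(p, 1)" "(q, 1)" a b] show "a *\<^sub>R p + b *\<^sub>R q \<in> slice S"
    using * by (simp add: slice_def)
qed

lemma slice_mono: "S \<subseteq> T \<Longrightarrow> slice S \<subseteq> slice T"
  unfolding slice_def using closure_mono[OF hull_mono] by blast

lemma slice_empty: "slice {} = {}"
proof -
  have "convex_cone hull {} = {0 :: 'a \<times> real}"
  proof
    show "convex_cone hull {} \<subseteq> {0 :: 'a \<times> real}"
      by (rule hull_minimal) (auto simp: convex_cone_iff)
    show "{0 :: 'a \<times> real} \<subseteq> convex_cone hull {}" by (simp add: convex_cone_hull_contains_0)
  qed
  then show ?thesis by (auto simp: slice_def zero_prod_def)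
qed

lemma slice_scale:
  assumes "(w, h) \<in> closure (convex_cone hull S)" "h > 0" shows "(1 / h) *\<^sub>R w \<in> slice S"
  using convex_cone_scaleR[OF convex_cone_closure[OF convex_cone_convex_cone_hull] _ assms(1), of "1 / h"] assms(2)
  by (simp add: slice_def)

text \<open>The slice is closed and contains \<open>1 / m\<close> times every point of
  \<open>S\<close> at height \<open>m\<close>. \<open>S\<close> is an arbitrary set here, so that
  this applies at slopes where the lattice is not generated.\<close>

lemma eventually_not_in_semigroup:
  assumes "p \<notin> slice S" shows "\<forall>\<^sub>F m in sequentially. (floor_vec (real m *\<^sub>R p), real m) \<notin> S"
proof -
  have "\<forall>\<^sub>F m in sequentially. (1 / real m) *\<^sub>R floor_vec (real m *\<^sub>R p) \<in> - slice S"
    by (rule topological_tendstoD[OF floor_vec_limit]) (use closed_slice assms in auto)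
  then show ?thesis
    using eventually_gt_at_top[of "0::nat"]
  proof eventually_elim
    case (elim m)
    show ?case
    proof
      assume "(floor_vec (real m *\<^sub>R p), real m) \<in> S"
      then have "(floor_vec (real m *\<^sub>R p), real m) \<in> closure (convex_cone hull S)"
        by (meson closure_subset hull_inc subsetD)
      from slice_scale[OF this] elim show False by auto
    qed
  qed
qed

text \<open>The open cone \<open>U\<close> over a ball around \<open>p\<close> lies in the closed
  cone, and a convex set has the same interior as its closure. Removing the closure is what makes
  finitely many generators suffice later.\<close>

lemma interior_slice:
  assumes p: "p \<in> interior (slice S)" shows "(p, 1) \<in> interior (convex_cone hull S)"
proof -
  let ?K = "closure (convex_cone hull S)"
  obtain r where r: "r > 0" "ball p r \<subseteq> slice S" using p by (auto simp: mem_interior)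
  define U where "U = {z :: 'a \<times> real. 0 < snd z \<and> norm (fst z - snd z *\<^sub>R p) < r * snd z}"
  have "open U" unfolding U_def by (intro open_Collect_conj open_Collect_less continuous_intros)
  moreover have "(p, 1) \<in> U" using r by (simp add: U_def)
  moreover have "U \<subseteq> ?K"
  proof safe
    fix q s assume "(q, s) \<in> U"
    then have s: "s > 0" "norm (q - s *\<^sub>R p) < r * s" by (auto simp: U_def)
    have "(1 / s) *\<^sub>R q - p = (1 / s) *\<^sub>R (q - s *\<^sub>R p)" using s by (simp add: algebra_simps)
    then have "norm ((1 / s) *\<^sub>R q - p) = norm (q - s *\<^sub>R p) / s" using s(1) by (simp only: norm_scaleR) simp
    then have "norm ((1 / s) *\<^sub>R q - p) < r" using s by (simp add: pos_divide_less_eq)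
    then have "(1 / s) *\<^sub>R q \<in> slice S" using r(2) by (auto simp: dist_norm norm_minus_commute)
    then have "((1 / s) *\<^sub>R q, 1) \<in> ?K" by (simp add: slice_def)
    from convex_cone_scaleR[OF convex_cone_closure[OF convex_cone_convex_cone_hull] _ this, of s] s
    show "(q, s) \<in> ?K" by simp
  qed
  ultimately have "(p, 1) \<in> interior ?K" by (rule interiorI)
  then show ?thesis using convex_interior_closure[OF convex_convex_cone_hull] by blast
qed

lemma convex_cone_hull_finite_subset:
  assumes "z \<in> convex_cone hull S" obtains A where "finite A" "A \<subseteq> S" "z \<in> convex_cone hull A"
proof -
  let ?U = "\<Union>A\<in>{A. finite A \<and> A \<subseteq> S}. convex_cone hull A"
  have "convex_cone ?U"
  proof (rule convex_cone_iff[THEN iffD2], intro conjI ballI allI impI)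
    show "0 \<in> ?U" using convex_cone_hull_contains_0 by blast
    fix a b assume "a \<in> ?U" "b \<in> ?U"
    then obtain A B where "finite A" "A \<subseteq> S" "finite B" "B \<subseteq> S" "a \<in> convex_cone hull A" "b \<in> convex_cone hull B" by blast
    then show "a + b \<in> ?U"
      using hull_mono[of A "A \<union> B" convex_cone] hull_mono[of B "A \<union> B" convex_cone]
      by (intro UN_I[of "A \<union> B"] convex_cone_hull_add) auto
  next
    fix c :: real and a assume "a \<in> ?U" "0 \<le> c"
    then show "c *\<^sub>R a \<in> ?U" using convex_cone_scaleR[OF convex_cone_convex_cone_hull] by blast
  qed
  moreover have "S \<subseteq> ?U"
  proof
    fix s assume "s \<in> S" then show "s \<in> ?U" by (intro UN_I[of "{s}"]) (auto intro: hull_inc)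
  qed
  ultimately have "convex_cone hull S \<subseteq> ?U" by (intro hull_minimal)
  then show thesis using assms that by blast
qed

lemma convex_cone_hull_finite:
  assumes "finite A" shows "convex_cone hull A \<subseteq> {\<Sum>a\<in>A. u a *\<^sub>R a | u. \<forall>a\<in>A. 0 \<le> u a}"
proof (rule hull_minimal)
  let ?U = "{\<Sum>a\<in>A. u a *\<^sub>R a | u. \<forall>a\<in>A. 0 \<le> (u a :: real)}"
  show "A \<subseteq> ?U"
  proof
    fix a assume a: "a \<in> A"
    then have "a = (\<Sum>b\<in>A. (if b = a then 1 else 0) *\<^sub>R b)"
      using assms by (simp add: if_distrib[of "\<lambda>c. c *\<^sub>R _"] sum.delta cong: if_cong)
    then show "a \<in> ?U" by (intro CollectI exI[of _ "\<lambda>b. if b = a then 1 else 0"]) auto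
  qed
  show "convex_cone ?U"
    unfolding convex_cone_iff
  proof (intro conjI ballI allI impI)
    show "0 \<in> ?U" by (intro CollectI exI[of _ "\<lambda>_. 0"]) auto
    fix a b assume "a \<in> ?U" "b \<in> ?U"
    then obtain u w where "\<forall>a\<in>A. 0 \<le> u a" "\<forall>a\<in>A. 0 \<le> w a" "a = (\<Sum>a\<in>A. u a *\<^sub>R a)" "b = (\<Sum>a\<in>A. w a *\<^sub>R a)" by blast
    then show "a + b \<in> ?U"
      by (intro CollectI exI[of _ "\<lambda>a. u a + w a"]) (auto simp: scaleR_left_distrib sum.distrib)
  next
    fix c :: real and a assume "a \<in> ?U" and c: "0 \<le> c"
    then obtain u where "\<forall>a\<in>A. 0 \<le> u a" "a = (\<Sum>a\<in>A. u a *\<^sub>R a)" by blast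
    then show "c *\<^sub>R a \<in> ?U" using c
      by (intro CollectI exI[of _ "\<lambda>a. c * u a"]) (auto simp: scaleR_sum_right)
  qed
qed

text \<open>By \<open>generates\<close> the group spanned by \<open>S\<close> is the full lattice,
  not a sublattice of finite index; this is why the lattice points of the levels fill the slice with
  density one.\<close>

locale lattice_semigroup =
  fixes S :: "('a::euclidean_space \<times> real) set"
  assumes lattice: "s \<in> S \<Longrightarrow> lattice_pt s" and height: "s \<in> S \<Longrightarrow> 1 \<le> snd s"
    and add: "s \<in> S \<Longrightarrow> t \<in> S \<Longrightarrow> s + t \<in> S"
    and generates: "lattice_pt w \<Longrightarrow> \<exists>s\<in>S. \<exists>t\<in>S. w = s - t"
begin

lemma scale_mem: "s \<in> S \<Longrightarrow> real (Suc k) *\<^sub>R s \<in> S"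
proof (induction k)
  case (Suc k)
  have "real (Suc (Suc k)) *\<^sub>R s = real (Suc k) *\<^sub>R s + s"
    unfolding of_nat_Suc[of "Suc k"] scaleR_left_distrib by simp
  then show ?case using add[OF Suc.IH] Suc.prems by simp
qed simp

lemma add_combination:
  assumes "finite A" "A \<subseteq> S" "s \<in> S" shows "s + (\<Sum>a\<in>A. real (k a) *\<^sub>R a) \<in> S"
  using assms(1,2)
proof (induction A)
  case (insert a A)
  have "s + (\<Sum>a\<in>A. real (k a) *\<^sub>R a) \<in> S" using insert by auto
  then have "(s + (\<Sum>a\<in>A. real (k a) *\<^sub>R a)) + real (k a) *\<^sub>R a \<in> S"
    using add scale_mem[of a "k a - 1"] insert.prems by (cases "k a") auto
  then show ?case using insert by (simp add: algebra_simps)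
qed (use assms(3) in simp)

text \<open>Khovanskii's argument: every lattice point of a finitely generated cone is an integral
  combination of the generators plus one of finitely many lattice points in a bounded set.\<close>

lemma conductor:
  assumes A: "finite A" "A \<subseteq> S"
  shows "\<exists>c. lattice_pt c \<and> (\<forall>w. lattice_pt w \<longrightarrow> w \<in> convex_cone hull A \<longrightarrow> w + c \<in> S)"
proof -
  let ?B = "{\<Sum>a\<in>A. u a *\<^sub>R a | u. \<forall>a\<in>A. 0 \<le> u a \<and> u a \<le> (1::real)}"
  have "norm z \<le> (\<Sum>a\<in>A. norm a)" if zB: "z \<in> ?B" for z
  proof -
    obtain u where u: "z = (\<Sum>a\<in>A. u a *\<^sub>R a)" "\<forall>a\<in>A. 0 \<le> u a \<and> u a \<le> 1" using zB by blast
    have "norm z \<le> (\<Sum>a\<in>A. norm (u a *\<^sub>R a))" unfolding u(1) by (rule norm_sum)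
    also have "\<dots> \<le> (\<Sum>a\<in>A. norm a)"
      using u(2) by (intro sum_mono) (simp add: mult_left_le_one_le)
    finally show ?thesis .
  qed
  then have "bounded ?B" unfolding bounded_iff by blast
  then have finQ: "finite {v \<in> ?B. lattice_pt v}" (is "finite ?Q") by (rule finite_lattice_bounded)
  obtain f g where fg: "\<And>w. lattice_pt w \<Longrightarrow> f w \<in> S \<and> g w \<in> S \<and> w = f w - g w"
    using generates by metis
  \<comment> \<open>Each of the finitely many remainders is a difference \<open>f q - g q\<close> in
    \<open>S\<close>. Adding all the \<open>g q\<close> clears the subtracted term of whichever
    remainder occurs and otherwise adds only members of \<open>S\<close>.\<close>
  define c where "c = (\<Sum>q\<in>?Q. g q)"
  have "lattice_pt c" unfolding c_def using fg lattice by (intro lattice_pt_sum) auto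
  moreover have "w + c \<in> S" if w: "lattice_pt w" "w \<in> convex_cone hull A" for w
  proof -
    obtain u where u: "\<forall>a\<in>A. 0 \<le> u a" "w = (\<Sum>a\<in>A. u a *\<^sub>R a)"
      using convex_cone_hull_finite[OF A(1)] w(2) by blast
    define q where "q = (\<Sum>a\<in>A. frac (u a) *\<^sub>R a)"
    define k where "k a = nat \<lfloor>u a\<rfloor>" for a
    have k: "real (k a) = of_int \<lfloor>u a\<rfloor>" if "a \<in> A" for a using u(1) that by (simp add: k_def)
    have wq: "w = q + (\<Sum>a\<in>A. real (k a) *\<^sub>R a)"
      unfolding u(2) q_def sum.distrib[symmetric]
      by (rule sum.cong) (auto simp: k frac_def scaleR_left_distrib[symmetric])
    have "q = w - (\<Sum>a\<in>A. of_int (int (k a)) *\<^sub>R a)" using wq by simp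
    then have "lattice_pt q"
      using w(1) A(2) lattice by (auto intro!: lattice_pt_diff lattice_pt_sum lattice_pt_scale simp del: of_int_of_nat_eq)
    moreover have "q \<in> ?B" unfolding q_def
      by (intro CollectI exI[of _ "\<lambda>a. frac (u a)"]) (auto simp: frac_lt_1 less_imp_le)
    ultimately have qQ: "q \<in> ?Q" by simp
    have c1: "c = g q + (\<Sum>q'\<in>?Q - {q}. g q')" unfolding c_def by (rule sum.remove[OF finQ qQ])
    have q1: "f q = q + g q" using fg \<open>lattice_pt q\<close> by (metis diff_add_cancel)
    have qc: "q + c = f q + (\<Sum>q'\<in>?Q - {q}. g q')" by (simp only: c1 q1 add.assoc)
    have "f q + (\<Sum>q'\<in>X. g q') \<in> S" if "finite X" "X \<subseteq> ?Q" for X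
      using that
    proof (induction X)
      case (insert y X)
      have "lattice_pt y" using insert.prems by blast
      then have "g y \<in> S" using fg by blast
      moreover have "f q + (\<Sum>q'\<in>X. g q') \<in> S" using insert by blast
      ultimately have "(f q + (\<Sum>q'\<in>X. g q')) + g y \<in> S" using add by blast
      then show ?case using insert by (simp add: algebra_simps)
    qed (use fg \<open>lattice_pt q\<close> in auto)
    then have "q + c \<in> S" using qc finQ by (metis (no_types, lifting) Diff_subset finite_Diff)
    then have "(q + c) + (\<Sum>a\<in>A. real (k a) *\<^sub>R a) \<in> S" by (rule add_combination[OF A])
    then show ?thesis unfolding wq by (simp add: algebra_simps)
  qed
  ultimately show ?thesis by blast
qed

text \<open>A box around \<open>(p, 1)\<close> is the hull of finitely many vertices, so a cone over
  a finite subset of \<open>S\<close> already contains it. The shift by the conductor is negligible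
  after division by \<open>m\<close>, hence the shifted lattice point is still in that cone.\<close>

lemma eventually_in_semigroup:
  assumes p: "p \<in> interior (slice S)"
  shows "\<forall>\<^sub>F m in sequentially. (floor_vec (real m *\<^sub>R p), real m) \<in> S"
proof -
  let ?z = "(p, 1::real)"
  have z: "?z \<in> interior (convex_cone hull S)" by (rule interior_slice[OF p])
  obtain a b where ab: "cbox a b \<subseteq> interior (convex_cone hull S)" "?z \<in> box a b"
    using open_contains_cbox[OF open_interior z] by metis
  obtain V where V: "finite V" "cbox a b = convex hull V" by (rule closed_interval_as_convex_hull)
  have "\<forall>v\<in>V. \<exists>A. finite A \<and> A \<subseteq> S \<and> v \<in> convex_cone hull A"
  proof
    fix v assume "v \<in> V"
    then have "v \<in> cbox a b" unfolding V(2) by (rule hull_inc)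
    then have "v \<in> convex_cone hull S" using ab(1) interior_subset by blast
    then show "\<exists>A. finite A \<and> A \<subseteq> S \<and> v \<in> convex_cone hull A" by (metis convex_cone_hull_finite_subset)
  qed
  then obtain Af where Af: "\<And>v. v \<in> V \<Longrightarrow> finite (Af v) \<and> Af v \<subseteq> S \<and> v \<in> convex_cone hull (Af v)" by metis
  define A where "A = (\<Union>v\<in>V. Af v)"
  have A: "finite A" "A \<subseteq> S" using V(1) Af by (auto simp: A_def)
  have "V \<subseteq> convex_cone hull A"
  proof
    fix v assume v: "v \<in> V"
    have "convex_cone hull (Af v) \<subseteq> convex_cone hull A" using v by (intro hull_mono) (auto simp: A_def)
    then show "v \<in> convex_cone hull A" using Af[OF v] by blast
  qed
  then have "convex hull V \<subseteq> convex_cone hull A" by (rule hull_minimal) (rule convex_convex_cone_hull)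
  then have zA: "?z \<in> interior (convex_cone hull A)"
    using ab(2) V(2) box_subset_cbox[of a b] by (intro interiorI[of "box a b"]) auto
  obtain c where c: "\<And>w. lattice_pt c \<and> (lattice_pt w \<longrightarrow> w \<in> convex_cone hull A \<longrightarrow> w + c \<in> S)"
    using conductor[OF A] by blast
  have "(\<lambda>m. ((1 / real m) *\<^sub>R floor_vec (real m *\<^sub>R p), 1) - (1 / real m) *\<^sub>R c) \<longlonglongrightarrow> (p, 1) - 0"
  proof (intro tendsto_diff tendsto_Pair floor_vec_limit tendsto_const)
    show "(\<lambda>m. (1 / real m) *\<^sub>R c) \<longlonglongrightarrow> 0"
      using tendsto_scaleR[OF lim_const_over_n[of 1] tendsto_const[of c]] by simp
  qed
  then have "\<forall>\<^sub>F m in sequentially. ((1 / real m) *\<^sub>R floor_vec (real m *\<^sub>R p), 1) - (1 / real m) *\<^sub>R c \<in> interior (convex_cone hull A)"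
    using zA by (intro topological_tendstoD[OF _ open_interior]) auto
  then show ?thesis
    using eventually_gt_at_top[of "0::nat"]
  proof eventually_elim
    case (elim m)
    let ?w = "(floor_vec (real m *\<^sub>R p), real m)"
    have "real m *\<^sub>R (((1 / real m) *\<^sub>R floor_vec (real m *\<^sub>R p), 1) - (1 / real m) *\<^sub>R c) \<in> convex_cone hull A"
      using elim interior_subset by (intro convex_cone_scaleR[OF convex_cone_convex_cone_hull]) auto
    also have "real m *\<^sub>R (((1 / real m) *\<^sub>R floor_vec (real m *\<^sub>R p), 1) - (1 / real m) *\<^sub>R c) = ?w - c"
      using elim by (simp add: scaleR_diff_right)
    finally have "?w - c \<in> convex_cone hull A" .
    moreover have "lattice_pt (?w - c)" using c by (intro lattice_pt_diff) (auto simp: lattice_pt_Pair lattice_pt_floor_vec)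
    ultimately show ?case using c[of "?w - c"] by simp
  qed
qed

text \<open>\<open>S\<close> spans the space, so its cone contains a simplex of full dimension with
  vertex 0. An interior point of the simplex is rescaled to height 1.\<close>

lemma interior_slice_nonempty: "interior (slice S) \<noteq> {}"
proof -
  have "span S = UNIV"
  proof -
    have "Basis \<subseteq> span S"
    proof
      fix b :: "'a \<times> real" assume "b \<in> Basis"
      then have "lattice_pt b" by (auto simp: lattice_pt_def inner_Basis)
      then obtain s t where "s \<in> S" "t \<in> S" "b = s - t" using generates by blast
      then show "b \<in> span S" by (auto intro: span_diff span_base)
    qed
    then show ?thesis using span_mono[of Basis "span S"] by (auto simp: span_span)
  qed
  obtain B where B: "B \<subseteq> S" "independent B" "S \<subseteq> span B" "card B = dim S" by (rule basis_exists)
  have "dim S = DIM('a \<times> real)" using \<open>span S = UNIV\<close> by (metis dim_UNIV dim_span)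
  then have cB: "card B = DIM('a \<times> real)" using B(4) by simp
  have fB: "finite B" using B(2) independent_imp_finite by blast
  obtain z where "z \<in> interior (convex hull (insert 0 B))" by (rule interior_simplex_nonempty[OF B(2) fB cB])
  moreover have "convex hull (insert 0 B) \<subseteq> convex_cone hull S"
    using B(1) by (intro hull_minimal convex_convex_cone_hull) (auto intro: hull_inc simp: convex_cone_hull_contains_0)
  ultimately have z: "z \<in> interior (convex_cone hull S)" using interior_mono by blast
  have "convex_cone hull S \<subseteq> {z. 0 \<le> snd z}"
    by (rule hull_minimal) (use height in \<open>force simp: convex_cone_iff\<close>)+
  then have "z \<in> interior {z. 0 \<le> snd z}" using z interior_mono by blast
  then obtain e where e: "e > 0" "ball z e \<subseteq> {z. 0 \<le> snd z}" by (auto simp: mem_interior)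
  \<comment> \<open>The cone lies in the upper half-space; a point that can be moved down inside it
    has positive height.\<close>
  have "z - (0, e / 2) \<in> ball z e" using e(1) by (simp add: dist_norm norm_Pair)
  then have "z - (0, e / 2) \<in> {z. 0 \<le> snd z}" using e(2) by blast
  then have h: "snd z > 0" using e(1) by simp
  define p where "p = (1 / snd z) *\<^sub>R fst z"
  have p1: "(p, 1::real) = (1 / snd z) *\<^sub>R z" using h by (simp add: p_def prod_eq_iff)
  have "(p, 1) \<in> interior (convex_cone hull S)"
  proof -
    obtain r where r: "r > 0" "ball z r \<subseteq> convex_cone hull S" using z by (auto simp: mem_interior)
    have "ball (p, 1::real) (r / snd z) \<subseteq> convex_cone hull S"
    proof
      fix y assume "y \<in> ball (p, 1::real) (r / snd z)"
      then have "norm ((1 / snd z) *\<^sub>R (z - snd z *\<^sub>R y)) < r / snd z"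
        using h by (simp add: dist_norm p1 scaleR_diff_right)
      then have "norm (z - snd z *\<^sub>R y) / snd z < r / snd z" using h by (simp only: norm_scaleR) simp
      then have "snd z *\<^sub>R y \<in> ball z r" using h by (simp add: dist_norm divide_less_cancel)
      then have "snd z *\<^sub>R y \<in> convex_cone hull S" using r(2) by blast
      then have "(1 / snd z) *\<^sub>R (snd z *\<^sub>R y) \<in> convex_cone hull S"
        by (rule convex_cone_scaleR[OF convex_cone_convex_cone_hull, rotated]) (use h in simp)
      then show "y \<in> convex_cone hull S" using h by simp
    qed
    then show ?thesis using r h by (meson centre_in_ball divide_pos_pos interiorI open_ball)
  qed
  moreover have "open ((\<lambda>p. (p, 1)) -` interior (convex_cone hull S))"
    by (intro continuous_open_vimage continuous_intros) auto
  moreover have "(\<lambda>p. (p, 1)) -` interior (convex_cone hull S) \<subseteq> slice S"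
  proof
    fix q assume "q \<in> (\<lambda>p. (p, 1)) -` interior (convex_cone hull S)"
    then have "(q, 1) \<in> convex_cone hull S" using interior_subset by blast
    then have "(q, 1) \<in> closure (convex_cone hull S)" using closure_subset by blast
    then show "q \<in> slice S" by (simp add: slice_def)
  qed
  ultimately have "p \<in> interior (slice S)"
    by (intro interiorI[of "(\<lambda>p. (p, 1)) -` interior (convex_cone hull S)"]) simp_all
  then show ?thesis by blast
qed

end

subsection \<open>Counting lattice points\<close>

definition cell :: "nat \<Rightarrow> 'a::euclidean_space \<Rightarrow> 'a set"
  where "cell m w = {x. floor_vec (real m *\<^sub>R x) = w}"

lemma cell_eq:
  assumes w: "lattice_pt w"
  shows "cell m w = (\<Inter>b\<in>Basis. {x. w \<bullet> b \<le> real m * (x \<bullet> b)} \<inter> {x. real m * (x \<bullet> b) < w \<bullet> b + 1})"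
proof -
  have "floor_vec (real m *\<^sub>R x) = w \<longleftrightarrow> (\<forall>b\<in>Basis. w \<bullet> b \<le> real m * (x \<bullet> b) \<and> real m * (x \<bullet> b) < w \<bullet> b + 1)" for x
  proof -
    have "floor_vec (real m *\<^sub>R x) = w \<longleftrightarrow> (\<forall>b\<in>Basis. of_int \<lfloor>real m * (x \<bullet> b)\<rfloor> = w \<bullet> b)"
      by (auto simp: euclidean_eq_iff[where 'a='a] floor_vec_inner)
    also have "\<dots> \<longleftrightarrow> (\<forall>b\<in>Basis. w \<bullet> b \<le> real m * (x \<bullet> b) \<and> real m * (x \<bullet> b) < w \<bullet> b + 1)"
    proof (rule ball_cong[OF refl])
      fix b :: 'a assume "b \<in> Basis"
      then obtain k where k: "w \<bullet> b = of_int k" using w by (auto simp: lattice_pt_def elim: Ints_cases)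
      show "(of_int \<lfloor>real m * (x \<bullet> b)\<rfloor> = w \<bullet> b) \<longleftrightarrow> (w \<bullet> b \<le> real m * (x \<bullet> b) \<and> real m * (x \<bullet> b) < w \<bullet> b + 1)"
        unfolding k of_int_eq_iff floor_eq_iff by simp
    qed
    finally show ?thesis .
  qed
  then show ?thesis by (auto simp: cell_def)
qed

lemma sets_cell: assumes "lattice_pt w" shows "cell m w \<in> sets lborel"
  unfolding cell_eq[OF assms]
  by (intro sets.finite_INT) (auto intro!: borel_closed borel_open closed_Collect_le open_Collect_less continuous_intros)

lemma emeasure_cell:
  assumes w: "lattice_pt (w :: 'a::euclidean_space)" and m: "m \<ge> 1"
  shows "emeasure lborel (cell m w) = ennreal (1 / real m ^ DIM('a))"
proof -
  define l where "l = (1 / real m) *\<^sub>R w"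
  define u where "u = (1 / real m) *\<^sub>R (w + One)"
  have lu: "l \<bullet> b \<le> u \<bullet> b" "(u - l) \<bullet> b = 1 / real m" if "b \<in> Basis" for b
    using m that by (auto simp: l_def u_def inner_add_left inner_diff_left algebra_simps divide_right_mono)
  have "box l u \<subseteq> cell m w" "cell m w \<subseteq> cbox l u"
    using m unfolding cell_eq[OF w] by (auto simp: l_def u_def mem_box inner_add_left field_simps less_imp_le)
  then have "emeasure lborel (box l u) \<le> emeasure lborel (cell m w)" "emeasure lborel (cell m w) \<le> emeasure lborel (cbox l u)"
    using sets_cell[OF w] by (auto intro!: emeasure_mono)
  moreover have "emeasure lborel (box l u) = ennreal (1 / real m ^ DIM('a))"
    using lu by (simp add: power_one_over)
  moreover have "emeasure lborel (cbox l u) = ennreal (1 / real m ^ DIM('a))"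
    using lu by (simp add: emeasure_lborel_cbox_eq power_one_over)
  ultimately show ?thesis by simp
qed

text \<open>Turns a sum over lattice points into an integral over cubes of side
  \<open>1 / m\<close>, so that convergence theorems for integrals apply to lattice sums.\<close>

lemma step_function:
  fixes W :: "'a::euclidean_space set" and \<phi> :: "'a \<Rightarrow> real"
  assumes W: "finite W" "\<And>w. w \<in> W \<Longrightarrow> lattice_pt w" and m: "m \<ge> 1"
  defines "f \<equiv> \<lambda>x. if floor_vec (real m *\<^sub>R x) \<in> W then \<phi> (floor_vec (real m *\<^sub>R x)) else 0"
  shows "has_bochner_integral lborel f ((\<Sum>w\<in>W. \<phi> w) / real m ^ DIM('a))"
proof -
  have f: "f = (\<lambda>x. \<Sum>w\<in>W. indicator (cell m w) x * \<phi> w)"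
  proof
    fix x
    have "(\<Sum>w\<in>W. indicator (cell m w) x * \<phi> w) = (\<Sum>w\<in>W. if w = floor_vec (real m *\<^sub>R x) then \<phi> w else 0)"
      by (rule sum.cong) (auto simp: cell_def indicator_def)
    then show "f x = (\<Sum>w\<in>W. indicator (cell m w) x * \<phi> w)" using W(1) by (simp add: f_def sum.delta)
  qed
  have 1: "measure lborel (cell m w) = 1 / real m ^ DIM('a)" "emeasure lborel (cell m w) < \<infinity>" if "w \<in> W" for w
    using emeasure_cell[OF W(2)[OF that] m] by (simp_all add: measure_def)
  have "has_bochner_integral lborel f (\<Sum>w\<in>W. measure lborel (cell m w) * \<phi> w)"
    unfolding f
    by (intro has_bochner_integral_sum has_bochner_integral_mult_left has_bochner_integral_real_indicator sets_cell W 1)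
  also have "(\<Sum>w\<in>W. measure lborel (cell m w) * \<phi> w) = (\<Sum>w\<in>W. \<phi> w) / real m ^ DIM('a)"
    by (simp add: 1 sum_divide_distrib)
  finally show ?thesis .
qed

text \<open>A point \<open>q\<close> far from a ball in \<open>U\<close> forces many disjoint balls
  of half the radius into \<open>U\<close>: shrink the ball towards \<open>q\<close> by convexity
  and place the copies along the first half of the segment.\<close>

lemma bounded_of_finite_measure:
  fixes U :: "'a::euclidean_space set"
  assumes U: "open U" "convex U" and fin: "emeasure lborel U < \<infinity>"
  shows "bounded U"
proof (cases "U = {}")
  case False
  then obtain p where "p \<in> U" by blast
  then obtain r where r: "r > 0" "ball p r \<subseteq> U" using U(1) open_contains_ball by blast
  define c where "c = measure lborel (ball (0::'a) (r / 2))"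
  have c: "c > 0" using r(1) by (simp add: c_def content_ball_pos)
  have emb: "emeasure lborel (ball z (r / 2)) = ennreal c" for z :: 'a
    using emeasure_lborel_ball_finite[of "0::'a" "r / 2"] r(1) unfolding c_def
    by (simp add: emeasure_ball content_ball)
  have main: "norm (q - p) \<le> 2 * real k * r" if q: "q \<in> U" and k: "emeasure lborel U < ennreal (real k * c)" for q k
  proof (rule ccontr)
    assume "\<not> ?thesis"
    then have far: "norm (q - p) > 2 * real k * r" by simp
    define d where "d = norm (q - p)"
    have "0 \<le> 2 * real k * r" using r(1) by simp
    then have d: "d > 0" using far unfolding d_def by linarith
    \<comment> \<open>Consecutive centres are at distance \<open>r\<close>, which makes the balls of
      radius \<open>r / 2\<close> disjoint; staying below \<open>1 / 2\<close> keeps the shrinking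
      factor at least one half.\<close>
    define s where "s j = real j * r / d" for j
    define z where "z j = p + s j *\<^sub>R (q - p)" for j
    have s: "0 \<le> s j" "s j \<le> 1 / 2" if "j < k" for j
    proof -
      show "0 \<le> s j" using r d by (simp add: s_def)
      have "2 * real j * r \<le> 2 * real k * r" using that r(1) by simp
      then show "s j \<le> 1 / 2" using far d by (simp add: s_def d_def field_simps)
    qed
    have sub: "ball (z j) (r / 2) \<subseteq> U" if j: "j < k" for j
    proof
      fix y assume y: "y \<in> ball (z j) (r / 2)"
      define h where "h = p + (1 / (1 - s j)) *\<^sub>R (y - z j)"
      have "norm (h - p) = norm (y - z j) / (1 - s j)" using s[OF j] by (simp add: h_def)
      also have "\<dots> < r"
      proof -
        have "norm (y - z j) < r / 2" using y by (simp add: dist_norm norm_minus_commute)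
        also have "r / 2 \<le> r * (1 - s j)" using s[OF j] r(1) by (simp add: field_simps)
        finally show ?thesis using s[OF j] by (simp add: pos_divide_less_eq)
      qed
      finally have "h \<in> U" using r(2) by (auto simp: dist_norm norm_minus_commute)
      then have "(1 - s j) *\<^sub>R h + s j *\<^sub>R q \<in> U" using convexD[OF U(2) _ q, of h "1 - s j" "s j"] s[OF j] by simp
      also have "(1 - s j) *\<^sub>R h = (1 - s j) *\<^sub>R p + (y - z j)"
        using s[OF j] by (simp add: h_def scaleR_add_right)
      also have "(1 - s j) *\<^sub>R p + (y - z j) + s j *\<^sub>R q = y"
        by (simp add: z_def algebra_simps)
      finally show "y \<in> U" .
    qed
    have disj: "disjoint_family_on (\<lambda>j. ball (z j) (r / 2)) {..<k}"
      unfolding disjoint_family_on_def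
    proof (intro ballI impI)
      fix i j :: nat assume "i \<noteq> j"
      have "dist (z i) (z j) = \<bar>s i - s j\<bar> * d"
        by (simp add: z_def dist_norm d_def scaleR_diff_left[symmetric] del: scaleR_diff_left)
      also have "\<dots> = \<bar>real i - real j\<bar> * r"
        using d r(1) by (simp add: s_def diff_divide_distrib[symmetric] left_diff_distrib[symmetric] abs_mult)
      also have "\<dots> \<ge> 1 * r" using \<open>i \<noteq> j\<close> r(1) by (intro mult_right_mono) auto
      finally show "ball (z i) (r / 2) \<inter> ball (z j) (r / 2) = {}"
        by (intro disjoint_ballI) simp
    qed
    have "ennreal (real k * c) = (\<Sum>j<k. emeasure lborel (ball (z j) (r / 2)))"
      using c by (simp add: emb ennreal_mult ennreal_of_nat_eq_real_of_nat)
    also have "\<dots> = emeasure lborel (\<Union>j\<in>{..<k}. ball (z j) (r / 2))"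
      by (rule sum_emeasure) (use disj in auto)
    also have "\<dots> \<le> emeasure lborel U" using sub U(1) by (intro emeasure_mono) auto
    finally show False using k by simp
  qed
  obtain e where e: "emeasure lborel U = ennreal e" "e \<ge> 0" using fin by (cases "emeasure lborel U") auto
  obtain k :: nat where "e / c < real k" using reals_Archimedean2 by blast
  then have "emeasure lborel U < ennreal (real k * c)"
    using e c by (simp add: ennreal_less_iff pos_divide_less_eq)
  then have "U \<subseteq> cball p (2 * real k * r)" using main by (auto simp: dist_norm norm_minus_commute)
  then show ?thesis using bounded_cball bounded_subset by blast
qed simp

definition level :: "('a \<times> real) set \<Rightarrow> nat \<Rightarrow> 'a set"
  where "level S m = {w. (w, real m) \<in> S}"

context lattice_semigroup
begin

lemma level_lattice: "w \<in> level S m \<Longrightarrow> lattice_pt w"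
  using lattice[of "(w, real m)"] by (simp add: level_def lattice_pt_Pair)

lemma level_slice: assumes "w \<in> level S m" shows "m \<ge> 1" "(1 / real m) *\<^sub>R w \<in> slice S"
proof -
  have "1 \<le> real m" using assms height[of "(w, real m)"] by (simp add: level_def)
  then show "m \<ge> 1" by simp
  have "(w, real m) \<in> closure (convex_cone hull S)"
    using assms unfolding level_def by (meson closure_subset hull_inc mem_Collect_eq subsetD)
  from slice_scale[OF this] \<open>m \<ge> 1\<close> show "(1 / real m) *\<^sub>R w \<in> slice S" by auto
qed

text \<open>Fatou's lemma bounds the volume of the slice by the growth rate, and a convex set with
  nonempty interior and finite volume is bounded.\<close>

lemma bounded_slice:
  assumes growth: "\<And>m. m \<ge> 1 \<Longrightarrow> finite (level S m) \<and> real (card (level S m)) \<le> C * real m ^ DIM('a)"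
  shows "bounded (slice S)"
proof -
  let ?U = "interior (slice S)"
  define f where "f m x = (if floor_vec (real m *\<^sub>R x) \<in> level S m then 1 else (0::real))" for m x
  have hb: "has_bochner_integral lborel (f m) (real (card (level S m)) / real m ^ DIM('a))" if "m \<ge> 1" for m
    unfolding f_def using step_function[of "level S m" m "\<lambda>_. 1"] growth[OF that] level_lattice that by simp
  have meas: "f m \<in> borel_measurable lborel" for m
  proof (cases "m \<ge> 1")
    case False
    then have "w \<notin> level S m" for w using level_slice(1) by blast
    then show ?thesis by (simp add: f_def[abs_def])
  next
    case True
    then show ?thesis using hb by (meson borel_measurable_integrable has_bochner_integral_iff)
  qed
  have le: "(\<integral>\<^sup>+x. ennreal (f m x) \<partial>lborel) \<le> ennreal C" if m: "m \<ge> 1" for m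
  proof -
    have "(\<integral>\<^sup>+x. ennreal (f m x) \<partial>lborel) = ennreal (real (card (level S m)) / real m ^ DIM('a))"
      using hb[OF m] by (subst nn_integral_eq_integral) (auto simp: has_bochner_integral_iff f_def)
    also have "\<dots> \<le> ennreal C" using growth[OF m] m by (intro ennreal_leI) (simp add: pos_divide_le_eq)
    finally show ?thesis .
  qed
  have "emeasure lborel ?U = (\<integral>\<^sup>+x. indicator ?U x \<partial>lborel)" by simp
  also have "\<dots> \<le> (\<integral>\<^sup>+x. liminf (\<lambda>m. ennreal (f m x)) \<partial>lborel)"
  proof (rule nn_integral_mono)
    fix x
    show "indicator ?U x \<le> liminf (\<lambda>m. ennreal (f m x))"
    proof (cases "x \<in> ?U")
      case True
      have "\<forall>\<^sub>F m in sequentially. 1 \<le> ennreal (f m x)"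
        using eventually_in_semigroup[OF True] by eventually_elim (simp add: f_def level_def)
      then show ?thesis using True by (simp add: Liminf_bounded)
    qed simp
  qed
  also have "\<dots> \<le> liminf (\<lambda>m. \<integral>\<^sup>+x. ennreal (f m x) \<partial>lborel)"
    by (rule nn_integral_liminf) (use meas in measurable)
  also have "\<dots> \<le> ennreal C"
  proof -
    have "\<forall>\<^sub>F m in sequentially. (\<integral>\<^sup>+x. ennreal (f m x) \<partial>lborel) \<le> ennreal C"
      using eventually_ge_at_top[of "1::nat"] by eventually_elim (rule le)
    then show ?thesis by (intro order_trans[OF Liminf_le_Limsup Limsup_bounded]) simp_all
  qed
  finally have "emeasure lborel ?U < \<infinity>" by (simp add: order_le_less_trans)
  then have "bounded ?U" by (intro bounded_of_finite_measure) (auto simp: convex_slice convex_interior)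
  then have "bounded (closure ?U)" by (rule bounded_closure)
  then show ?thesis
    using convex_closure_interior[OF convex_slice interior_slice_nonempty] closed_slice[of S] by simp
qed

end

text \<open>\<open>below\<close> asks for a full lattice only strictly below a slope that still
  occurs: at the largest slope \<open>\<Gamma> t\<close> may be nonempty and too small to
  generate.\<close>

locale filtered_semigroup =
  fixes \<Gamma> :: "real \<Rightarrow> ('a::euclidean_space \<times> real) set" and T C :: real
  assumes base: "lattice_semigroup (\<Gamma> 0)"
    and decreasing: "0 \<le> s \<Longrightarrow> s \<le> t \<Longrightarrow> \<Gamma> t \<subseteq> \<Gamma> s"
    and below: "0 \<le> t \<Longrightarrow> t < s \<Longrightarrow> \<Gamma> s \<noteq> {} \<Longrightarrow> lattice_semigroup (\<Gamma> t)"
    and vanish: "t > T \<Longrightarrow> \<Gamma> t = {}" and T_nonneg: "0 \<le> T"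
    and growth: "m \<ge> 1 \<Longrightarrow> finite (level (\<Gamma> 0) m) \<and> real (card (level (\<Gamma> 0) m)) \<le> C * real m ^ DIM('a)"
begin

interpretation \<Gamma>0: lattice_semigroup "\<Gamma> 0" by (rule base)

definition G :: "'a \<Rightarrow> real" where "G p = Sup {t. t \<ge> 0 \<and> p \<in> slice (\<Gamma> t)}"
text \<open>The counterpart of \<open>G\<close> for a single lattice point; over one level these
  numbers will add up to \<open>1 / m\<close> times the sum of the jumping numbers.\<close>

definition \<tau> :: "nat \<Rightarrow> 'a \<Rightarrow> real" where "\<tau> m w = Sup {t. t \<ge> 0 \<and> w \<in> level (\<Gamma> t) m}"

lemma bounded_slice_0: "bounded (slice (\<Gamma> 0))"
  by (rule \<Gamma>0.bounded_slice) (rule growth)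

lemma interior_slice_0: "interior (slice (\<Gamma> 0)) \<noteq> {}"
  by (rule \<Gamma>0.interior_slice_nonempty)

lemma le_T: "p \<in> slice (\<Gamma> t) \<Longrightarrow> t \<le> T" "w \<in> level (\<Gamma> t) m \<Longrightarrow> t \<le> T"
  using vanish[of t] slice_empty by (force simp: level_def)+

lemma G_bounds: assumes "p \<in> slice (\<Gamma> 0)" shows "0 \<le> G p" "G p \<le> T"
  unfolding G_def using assms le_T(1) by (auto intro!: cSup_upper cSup_least bdd_aboveI[of _ T])

lemma G_upper: "t \<ge> 0 \<Longrightarrow> p \<in> slice (\<Gamma> t) \<Longrightarrow> t \<le> G p"
  unfolding G_def using le_T(1) by (auto intro!: cSup_upper bdd_aboveI[of _ T])

lemma G_less: assumes "p \<in> slice (\<Gamma> 0)" "a < G p" obtains t where "t \<ge> 0" "a < t" "p \<in> slice (\<Gamma> t)"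
  using assms less_cSupE[of a "{t. t \<ge> 0 \<and> p \<in> slice (\<Gamma> t)}"] unfolding G_def by blast

lemma \<tau>_bounds: assumes "w \<in> level (\<Gamma> 0) m" shows "0 \<le> \<tau> m w" "\<tau> m w \<le> T"
  unfolding \<tau>_def using assms le_T(2) by (auto intro!: cSup_upper cSup_least bdd_aboveI[of _ T])

lemma \<tau>_upper: "t \<ge> 0 \<Longrightarrow> w \<in> level (\<Gamma> t) m \<Longrightarrow> t \<le> \<tau> m w"
  unfolding \<tau>_def using le_T(2) by (auto intro!: cSup_upper bdd_aboveI[of _ T])

lemma level_decreasing: "0 \<le> s \<Longrightarrow> s \<le> t \<Longrightarrow> level (\<Gamma> t) m \<subseteq> level (\<Gamma> s) m"
  using decreasing by (auto simp: level_def)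

lemma slice_decreasing: "0 \<le> s \<Longrightarrow> s \<le> t \<Longrightarrow> slice (\<Gamma> t) \<subseteq> slice (\<Gamma> s)"
  using decreasing by (intro slice_mono) auto

lemma \<tau>_le: assumes "w \<in> level (\<Gamma> 0) m" "w \<notin> level (\<Gamma> t) m" "t \<ge> 0" shows "\<tau> m w \<le> t"
  unfolding \<tau>_def
proof (rule cSup_least)
  show "{t. t \<ge> 0 \<and> w \<in> level (\<Gamma> t) m} \<noteq> {}" using assms(1) by auto
  fix s assume "s \<in> {t. t \<ge> 0 \<and> w \<in> level (\<Gamma> t) m}"
  then show "s \<le> t" using level_decreasing[of t s m] assms by force
qed

text \<open>For a non-negative threshold, the superlevel set is the union of the closed slices at
  the rational slopes above it.\<close>

lemma measurable_G: "(\<lambda>p. indicator (slice (\<Gamma> 0)) p * G p) \<in> borel_measurable borel"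
  unfolding borel_measurable_iff_greater
proof
  fix a :: real
  have bs: "slice (\<Gamma> t) \<in> sets borel" for t by (intro borel_closed closed_slice)
  have "{p. indicator (slice (\<Gamma> 0)) p * G p > a} \<in> sets borel"
  proof (cases "a < 0")
    case True
    have "{p. indicator (slice (\<Gamma> 0)) p * G p > a} = UNIV"
      using True G_bounds(1) by (auto simp: indicator_def intro: order_less_le_trans)
    then show ?thesis by simp
  next
    case False
    have "{p. indicator (slice (\<Gamma> 0)) p * G p > a} = (\<Union>q\<in>{q \<in> \<rat>. q > a}. slice (\<Gamma> q))"
    proof (intro equalityI subsetI)
      fix p assume "p \<in> {p. indicator (slice (\<Gamma> 0)) p * G p > a}"
      then have p: "p \<in> slice (\<Gamma> 0)" "a < G p" using False by (cases "p \<in> slice (\<Gamma> 0)"; simp)+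
      obtain t where t: "t \<ge> 0" "a < t" "p \<in> slice (\<Gamma> t)" using G_less[OF p] .
      obtain q where "q \<in> \<rat>" "a < q" "q < t" using Rats_dense_in_real[OF t(2)] by blast
      then show "p \<in> (\<Union>q\<in>{q \<in> \<rat>. q > a}. slice (\<Gamma> q))"
        using slice_decreasing[of q t] False t(3) by (intro UN_I[of q]) auto
    next
      fix p assume "p \<in> (\<Union>q\<in>{q \<in> \<rat>. q > a}. slice (\<Gamma> q))"
      then obtain q where q: "q > a" "p \<in> slice (\<Gamma> q)" by auto
      then have "p \<in> slice (\<Gamma> 0)" using slice_decreasing[of 0 q] False by auto
      moreover have "q \<le> G p" using G_upper[OF _ q(2)] q(1) False by auto
      ultimately show "p \<in> {p. indicator (slice (\<Gamma> 0)) p * G p > a}" using q(1) by simp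
    qed
    also have "\<dots> \<in> sets borel"
      by (intro sets.countable_UN' bs) (auto intro: countable_subset[OF _ countable_rat] bs)
    finally show ?thesis .
  qed
  then show "{p \<in> space borel. a < indicator (slice (\<Gamma> 0)) p * G p} \<in> sets borel" by simp
qed

lemma null_frontier: "frontier (slice (\<Gamma> t)) \<in> null_sets lborel"
  using negligible_convex_frontier[OF convex_slice[of "\<Gamma> t"]]
  by (auto simp: negligible_iff_null_sets null_sets_completion_iff)

theorem limit:
  "(\<lambda>m. (\<Sum>w\<in>level (\<Gamma> 0) m. \<tau> m w) / real m ^ DIM('a))
    \<longlonglongrightarrow> (\<integral>p. indicator (slice (\<Gamma> 0)) p * G p \<partial>lborel)"
proof -
  define f where "f m x = (if floor_vec (real m *\<^sub>R x) \<in> level (\<Gamma> 0) m then \<tau> m (floor_vec (real m *\<^sub>R x)) else 0)" for m x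
  have hb: "has_bochner_integral lborel (f m) ((\<Sum>w\<in>level (\<Gamma> 0) m. \<tau> m w) / real m ^ DIM('a))" if "m \<ge> 1" for m
    unfolding f_def using step_function[of "level (\<Gamma> 0) m" m "\<tau> m"] growth[OF that] \<Gamma>0.level_lattice that by simp
  have "w \<notin> level (\<Gamma> 0) 0" for w using \<Gamma>0.level_slice(1)[of w 0] by auto
  then have f0: "f 0 = (\<lambda>_. 0)" by (simp add: f_def[abs_def])
  have meas: "f m \<in> borel_measurable lborel" for m
  proof (cases "m = 0")
    case False
    then show ?thesis using hb[of m] by (meson borel_measurable_integrable has_bochner_integral_iff less_one not_less)
  qed (simp add: f0)
  obtain r where r: "\<And>p. p \<in> slice (\<Gamma> 0) \<Longrightarrow> norm p \<le> r" using bounded_slice_0 by (auto simp: bounded_iff)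
  \<comment> \<open>Rounding moves a point by at most \<open>DIM('a) / m\<close>, so all the step
    functions live on one ball.\<close>
  define R where "R = r + real DIM('a)"
  have dom: "norm (f m x) \<le> T * indicator (cball 0 R) x" for m x
  proof (cases "floor_vec (real m *\<^sub>R x) \<in> level (\<Gamma> 0) m")
    case True
    let ?w = "floor_vec (real m *\<^sub>R x)"
    have m: "m \<ge> 1" by (rule \<Gamma>0.level_slice(1)[OF True])
    have "x = (1 / real m) *\<^sub>R ?w - (1 / real m) *\<^sub>R (?w - real m *\<^sub>R x)" using m by (simp add: scaleR_diff_right)
    then have "norm x \<le> norm ((1 / real m) *\<^sub>R ?w) + norm ((1 / real m) *\<^sub>R (?w - real m *\<^sub>R x))"
      by (metis norm_triangle_ineq4)
    also have "norm ((1 / real m) *\<^sub>R ?w) \<le> r" by (rule r[OF \<Gamma>0.level_slice(2)[OF True]])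
    also have "norm ((1 / real m) *\<^sub>R (?w - real m *\<^sub>R x)) \<le> norm (?w - real m *\<^sub>R x)"
      unfolding norm_scaleR by (intro mult_left_le_one_le) (use m in auto)
    also have "\<dots> \<le> real DIM('a)" by (rule norm_floor_vec_diff)
    finally have "x \<in> cball 0 R" by (simp add: R_def)
    then show ?thesis using \<tau>_bounds[OF True] True by (simp add: f_def)
  qed (use T_nonneg in \<open>auto simp: f_def\<close>)
  have conv: "(\<lambda>m. f m x) \<longlonglongrightarrow> indicator (slice (\<Gamma> 0)) x * G x"
    if x: "\<And>q. q \<in> \<rat> \<Longrightarrow> x \<notin> frontier (slice (\<Gamma> q))" for x
  proof (cases "x \<in> slice (\<Gamma> 0)")
    case False
    have "\<forall>\<^sub>F m in sequentially. f m x = 0"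
      using eventually_not_in_semigroup[OF False] by eventually_elim (simp add: f_def level_def)
    then show ?thesis using False by (simp add: tendsto_eventually)
  next
    case True
    have inter: "x \<in> interior (slice (\<Gamma> q))" if "q \<in> \<rat>" "x \<in> slice (\<Gamma> q)" for q
      using x[OF that(1)] that(2) closed_slice[of "\<Gamma> q"] by (simp add: frontier_def)
    have ev0: "\<forall>\<^sub>F m in sequentially. floor_vec (real m *\<^sub>R x) \<in> level (\<Gamma> 0) m"
      using \<Gamma>0.eventually_in_semigroup[OF inter[OF _ True]] by (simp add: level_def)
    have "(\<lambda>m. f m x) \<longlonglongrightarrow> G x"
    proof (rule order_tendstoI)
      fix a assume a: "a < G x"
      show "\<forall>\<^sub>F m in sequentially. a < f m x"
      proof (cases "a < 0")
        case True
        show ?thesis using ev0 by eventually_elim (use True \<tau>_bounds(1) in \<open>auto simp: f_def intro: order_less_le_trans\<close>)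
      next
        case False
        obtain t where t: "t \<ge> 0" "a < t" "x \<in> slice (\<Gamma> t)" using G_less[OF True a] .
        \<comment> \<open>The passage to a smaller rational slope does two things: \<open>q\<close>
          is strictly below a nonempty stage, so \<open>below\<close> applies, and \<open>x\<close>
          avoids the frontier of the slice at \<open>q\<close>, so it is an interior point.\<close>
        obtain q where q: "q \<in> \<rat>" "a < q" "q < t" using Rats_dense_in_real[OF t(2)] by blast
        have xq: "x \<in> slice (\<Gamma> q)" using slice_decreasing[of q t] q False t(3) by auto
        have "\<Gamma> t \<noteq> {}" using t(3) slice_empty by force
        then interpret q: lattice_semigroup "\<Gamma> q" using below[of q t] q False by auto
        show ?thesis
          using ev0 q.eventually_in_semigroup[OF inter[OF q(1) xq]]
        proof eventually_elim
          case (elim m)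
          then show ?case using \<tau>_upper[of q "floor_vec (real m *\<^sub>R x)" m] q(2) False by (simp add: f_def level_def)
        qed
      qed
    next
      fix a assume a: "G x < a"
      \<comment> \<open>Strictly between \<open>G x\<close> and \<open>a\<close>: the point is
        outside the closed slice at \<open>t\<close>, so its roundings eventually leave
        \<open>\<Gamma> t\<close>, and \<open>\<tau>\<close> is then at most \<open>t\<close>, still
        below \<open>a\<close>.\<close>
      define t where "t = (G x + a) / 2"
      have t: "G x < t" "t < a" "0 \<le> t" using a G_bounds(1)[OF True] by (auto simp: t_def)
      have "x \<notin> slice (\<Gamma> t)" using G_upper[OF t(3), of x] t(1) by auto
      from eventually_not_in_semigroup[OF this] ev0
      show "\<forall>\<^sub>F m in sequentially. f m x < a"
      proof eventually_elim
        case (elim m)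
        then show ?case using \<tau>_le[of "floor_vec (real m *\<^sub>R x)" m t] t by (simp add: f_def level_def)
      qed
    qed
    then show ?thesis using True by simp
  qed
  have AE: "AE x in lborel. (\<lambda>m. f m x) \<longlonglongrightarrow> indicator (slice (\<Gamma> 0)) x * G x"
  proof -
    have "(\<Union>q\<in>\<rat>. frontier (slice (\<Gamma> q))) \<in> null_sets lborel"
      by (intro null_sets_UN' countable_rat null_frontier)
    from AE_not_in[OF this] show ?thesis by eventually_elim (rule conv, auto)
  qed
  have "(\<lambda>m. \<integral>x. f m x \<partial>lborel) \<longlonglongrightarrow> (\<integral>p. indicator (slice (\<Gamma> 0)) p * G p \<partial>lborel)"
  proof (rule integral_dominated_convergence[where w = "\<lambda>x. T * indicator (cball 0 R) x"])
    show "integrable lborel (\<lambda>x. T * indicator (cball (0::'a) R) x)"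
      by (intro integrable_mult_right integrable_real_indicator) (use emeasure_compact_finite[OF compact_cball[of "0::'a" R]] in \<open>auto simp: top.not_eq_extremum\<close>)
  qed (use measurable_G meas AE dom in auto)
  moreover have "\<forall>\<^sub>F m in sequentially. (\<integral>x. f m x \<partial>lborel) = (\<Sum>w\<in>level (\<Gamma> 0) m. \<tau> m w) / real m ^ DIM('a)"
    using eventually_ge_at_top[of "1::nat"] by eventually_elim (use hb in \<open>auto simp: has_bochner_integral_iff\<close>)
  ultimately show ?thesis by (rule Lim_transform_eventually)
qed

text \<open>The filtration that keeps all of \<open>\<Gamma> 0\<close> up to slope 1 and nothing
  beyond has \<open>\<tau>\<close> and \<open>G\<close> constantly 1, so \<open>limit\<close> counts
  lattice points.\<close>

lemma volume_limit:
  "(\<lambda>m. real (card (level (\<Gamma> 0) m)) / real m ^ DIM('a)) \<longlonglongrightarrow> measure lborel (slice (\<Gamma> 0))"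
proof -
  define \<Gamma>' where "\<Gamma>' t = (if t \<le> 1 then \<Gamma> 0 else {})" for t :: real
  interpret C: filtered_semigroup \<Gamma>' 1 C
    by (rule filtered_semigroup.intro) (use base growth in \<open>auto simp: \<Gamma>'_def split: if_splits\<close>)
  have 0: "\<Gamma>' 0 = \<Gamma> 0" by (simp add: \<Gamma>'_def)
  have "C.\<tau> m w = 1" if "w \<in> level (\<Gamma> 0) m" for m w
    using C.\<tau>_bounds(2)[of w m] C.\<tau>_upper[of 1 w m] that by (auto simp: \<Gamma>'_def)
  moreover have "indicator (slice (\<Gamma> 0)) p * C.G p = indicator (slice (\<Gamma> 0)) p" for p
    using C.G_bounds(2)[of p] C.G_upper[of 1 p] by (auto simp: \<Gamma>'_def indicator_def)
  then have "(\<integral>p. indicator (slice (\<Gamma> 0)) p * C.G p \<partial>lborel) = measure lborel (slice (\<Gamma> 0))"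
    by (simp only: Bochner_Integration.integral_indicator) simp
  ultimately show ?thesis using C.limit unfolding 0 by simp
qed

lemma volume_pos: "0 < measure lborel (slice (\<Gamma> 0))"
proof -
  obtain p r where r: "r > 0" "ball p r \<subseteq> slice (\<Gamma> 0)" using interior_slice_0 by (auto simp: mem_interior)
  have "0 < measure lborel (ball p r)" using r(1) by (simp add: content_ball_pos)
  also have "\<dots> \<le> measure lborel (slice (\<Gamma> 0))"
  proof (rule measure_mono_fmeasurable[OF r(2)])
    have "compact (slice (\<Gamma> 0))" using bounded_slice_0 closed_slice compact_eq_bounded_closed by blast
    then show "slice (\<Gamma> 0) \<in> fmeasurable lborel"
      by (rule fmeasurable_compact)
  qed simp
  finally show ?thesis .
qed

end

section \<open>Okounkov bodies of filtrations\<close>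

text \<open>Layer-cake formula: two finite families of non-negative numbers have equal sums as soon
  as, for almost every \<open>t \<ge> 0\<close>, they have equally many members above
  \<open>t\<close>.\<close>

lemma integral_indicators:
  fixes b :: "'i \<Rightarrow> real"
  assumes "\<And>i. i \<in> I \<Longrightarrow> 0 \<le> b i"
  shows "integral\<^sup>L lborel (\<lambda>t. \<Sum>i\<in>I. indicator {0..<b i} t :: real) = (\<Sum>i\<in>I. b i)"
  using assms by (subst Bochner_Integration.integral_sum) (auto intro!: integrable_real_indicator)

lemma index_bij: "bij_betw (\<lambda>i :: 'n::{finite, linorder}. card {..<i}) UNIV {..<CARD('n::{finite, linorder})}"
proof -
  have lt: "card {..<i} < card {..<j}" if "i < j" for i j :: 'n
    using that by (intro psubset_card_mono) auto
  have inj: "inj (\<lambda>i :: 'n. card {..<i})"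
    by (rule injI) (metis lt less_irrefl linorder_neqE)
  have "card {..<i} < CARD('n)" for i :: 'n
    by (intro psubset_card_mono) auto
  then have sub: "range (\<lambda>i :: 'n. card {..<i}) \<subseteq> {..<CARD('n)}" by auto
  have "card (range (\<lambda>i :: 'n. card {..<i})) = CARD('n)" using inj by (rule card_image)
  then have "range (\<lambda>i :: 'n. card {..<i}) = {..<CARD('n)}" using sub by (intro card_subset_eq) auto
  then show ?thesis using inj by (simp add: bij_betw_def)
qed

context flag_variety
begin

abbreviation vec :: "'r \<Rightarrow> real^'n::{finite, linorder}" where "vec f \<equiv> flag_val_vec \<eta> x f"

lemma index_less: "n = CARD('n::{finite, linorder}) \<Longrightarrow> card {..<i :: 'n::{finite, linorder}} < n"
  using index_bij[where 'n='n] by (auto simp: bij_betw_def)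

lemma vec_eq_iff_v:
  assumes "n = CARD('n::{finite, linorder})"
  shows "(vec f :: real^'n::{finite, linorder}) = vec g \<longleftrightarrow> v f = v g"
proof -
  have "(vec f :: real^'n::{finite, linorder}) = vec g \<longleftrightarrow> (\<forall>i :: 'n. flag_val \<eta> x (to_fract f) (card {..<i}) = flag_val \<eta> x (to_fract g) (card {..<i}))"
    by (simp add: flag_val_vec_def Finite_Cartesian_Product.vec_eq_iff)
  also have "\<dots> \<longleftrightarrow> (\<forall>i\<in>range (\<lambda>i :: 'n. card {..<i}). flag_val \<eta> x (to_fract f) i = flag_val \<eta> x (to_fract g) i)" by simp
  also have "range (\<lambda>i :: 'n. card {..<i}) = {..<n}" using index_bij[where 'n='n] assms by (simp add: bij_betw_def)
  finally show ?thesis by (auto simp: v_def val_eq_iff)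
qed

lemma vec_mult:
  assumes n: "n = CARD('n::{finite, linorder})" and "f \<noteq> 0" "g \<noteq> 0"
  shows "(vec (f * g) :: real^'n::{finite, linorder}) = vec f + vec g"
  using assms(2,3) flag_val_mult[OF to_fract_in _ to_fract_in _ index_less[OF n], of f g]
  by (simp add: flag_val_vec_def Finite_Cartesian_Product.vec_eq_iff)

lemma lattice_pt_vec: "lattice_pt (vec f :: real^'n::{finite, linorder})"
  by (auto simp: lattice_pt_def Basis_vec_def inner_axis flag_val_vec_def)

lemma card_vec:
  assumes n: "n = CARD('n::{finite, linorder})" and W: "subspace W" "W \<subseteq> graded_part smul gr \<xi> m"
  shows "finite ((vec :: 'r \<Rightarrow> real^'n::{finite, linorder}) ` (W - {0}))" "card ((vec :: 'r \<Rightarrow> real^'n::{finite, linorder}) ` (W - {0})) = dim W"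
proof -
  let ?A = "W - {0}" and ?vec = "vec :: 'r \<Rightarrow> real^'n::{finite, linorder}"
  define h where "h w = ?vec (SOME f. f \<in> ?A \<and> v f = w)" for w
  have h: "h (v f) = ?vec f" if "f \<in> ?A" for f
    unfolding h_def vec_eq_iff_v[OF n] using someI_ex[of "\<lambda>g. g \<in> ?A \<and> v g = v f"] that by blast
  then have im: "?vec ` ?A = h ` (v ` ?A)" by (simp add: image_image)
  have "inj_on h (v ` ?A)" using h vec_eq_iff_v[OF n] by (auto simp: inj_on_def)
  then show "finite (?vec ` ?A)" "card (?vec ` ?A) = dim W"
    using card_values[OF W] im by (simp_all add: card_image)
qed

end

section \<open>Filtrations and the semigroups of their slopes\<close>

locale filtered_variety = flag_variety smul gr \<mm> \<xi> \<eta> x n + filtration smul gr F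
  for smul :: "'k::{alg_closed_field, field_char_0} \<Rightarrow> 'r::idom \<Rightarrow> 'r"
    and gr :: "int^'d \<Rightarrow> 'r set" and \<mm> :: "'r set" and \<xi> :: "real^'d"
    and \<eta> :: "'r fract set" and x :: "nat \<Rightarrow> 'r fract" and n :: nat and F :: "real \<Rightarrow> 'r set" +
  assumes bounded: "linearly_bounded smul gr \<xi> F"
begin

abbreviation FP where "FP l m \<equiv> filtered_part smul gr \<xi> F l m"
abbreviation RR where "RR m \<equiv> graded_part smul gr \<xi> m"

lemma subspace_FP: "subspace (FP l m)"
  by (simp add: filtered_part_def)

lemma FP_subset: "FP l m \<subseteq> RR m"
  unfolding filtered_part_def graded_part_def by (rule span_mono) auto

lemma FP_anti: "l \<le> l' \<Longrightarrow> FP l' m \<subseteq> FP l m"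
  unfolding filtered_part_def using decreasing by (intro span_mono) (auto simp: antimono_def)

lemma FP_0: "FP 0 m = RR m"
  by (simp add: filtered_part_def graded_part_def at_zero)

lemma FP_mono: "m \<le> m' \<Longrightarrow> FP l m \<subseteq> FP l m'"
  unfolding filtered_part_def by (rule span_mono) force

lemma FP_mult:
  assumes "f \<in> FP l m" "g \<in> FP l' m'" shows "f * g \<in> FP (l + l') (m + m')"
  using assms unfolding filtered_part_def
proof (rule span_mult_span)
  fix u w assume "u \<in> (\<Union>\<alpha>\<in>{\<alpha>. weight_pairing \<alpha> \<xi> \<le> real m}. F l \<inter> gr \<alpha>)"
    "w \<in> (\<Union>\<alpha>\<in>{\<alpha>. weight_pairing \<alpha> \<xi> \<le> real m'}. F l' \<inter> gr \<alpha>)"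
  then obtain \<alpha> \<beta> where "u \<in> F l \<inter> gr \<alpha>" "w \<in> F l' \<inter> gr \<beta>" "weight_pairing \<alpha> \<xi> \<le> real m" "weight_pairing \<beta> \<xi> \<le> real m'" by auto
  then show "u * w \<in> span (\<Union>\<alpha>\<in>{\<alpha>. weight_pairing \<alpha> \<xi> \<le> real (m + m')}. F (l + l') \<inter> gr \<alpha>)"
    using multiplicative[of u l \<alpha> w l' \<beta>] by (intro span_base UN_I[of "\<alpha> + \<beta>"]) (auto simp: weight_pairing_add)
qed

lemma FP_power: "g \<in> FP l m \<Longrightarrow> g ^ k \<in> FP (real k * l) (k * m)"
proof (induction k)
  case 0
  then show ?case using one_in_graded_part[of 0] FP_0[of 0] by simp
next
  case (Suc k)
  then show ?case using FP_mult[OF Suc.prems Suc.IH] by (simp add: distrib_right)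
qed

abbreviation P where "P t m \<equiv> slope_part smul gr \<xi> F t m"

lemma P_eq: "P t m = FP (real m * t) m" by (simp add: slope_part_def)

lemma P_mult: "f \<in> P t m \<Longrightarrow> g \<in> P t m' \<Longrightarrow> f * g \<in> P t (m + m')"
  using FP_mult[of f "real m * t" m g "real m' * t" m'] by (simp add: P_eq distrib_right)

lemma P_anti: "s \<le> t \<Longrightarrow> P t m \<subseteq> P s m"
  unfolding P_eq by (intro FP_anti mult_left_mono) auto

lemma P_0: "P 0 m = RR m" by (simp add: P_eq FP_0)

lemma max_slope_bound:
  obtains T where "0 \<le> T" "\<And>t m. t \<ge> 0 \<Longrightarrow> m \<ge> 1 \<Longrightarrow> P t m \<noteq> {0} \<Longrightarrow> t \<le> T"
proof -
  let ?s = "max_slope smul gr \<xi> F"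
  have fin: "?s < \<infinity>" using bounded by (simp add: linearly_bounded_def)
  have "t \<le> max 0 (real_of_ereal ?s)" if t: "t \<ge> 0" "m \<ge> 1" "P t m \<noteq> {0}" for t m
  proof -
    have "ereal t \<le> ?s"
      unfolding max_slope_def using t by (intro SUP_upper2[of m] SUP_upper2[of t]) auto
    then show ?thesis using fin by (cases ?s) auto
  qed
  then show thesis using that[of "max 0 (real_of_ereal ?s)"] by auto
qed

abbreviation \<Gamma> :: "real \<Rightarrow> ((real^'n::{finite, linorder}) \<times> real) set"
  where "\<Gamma> t \<equiv> value_semigroup \<eta> x (slope_part smul gr \<xi> F t)"

lemma level_\<Gamma>: "m \<ge> 1 \<Longrightarrow> level (\<Gamma> t :: ((real^'n::{finite, linorder}) \<times> real) set) m = vec ` (P t m - {0})"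
  by (auto simp: level_def value_semigroup_def)

text \<open>One multiplier \<open>h\<close> serves a whole piece \<open>RR M\<close> at two
  consecutive heights: equal heights produce all differences of values, and the two different
  heights produce the vertical vector \<open>(0, 1)\<close>.\<close>

definition absorbing :: "real \<Rightarrow> bool"
  where "absorbing t \<longleftrightarrow> (\<forall>M. \<exists>h N. h \<noteq> 0 \<and> 1 \<le> N \<and> (\<forall>f\<in>RR M. f * h \<in> P t (M + N) \<and> f * h \<in> P t (M + N + 1)))"

lemma absorbing_0: "absorbing 0"
  unfolding absorbing_def
proof (intro allI exI[of _ 1] conjI ballI)
  fix M f assume "f \<in> RR M"
  then show "f * 1 \<in> P 0 (M + 1)" "f * 1 \<in> P 0 (M + 1 + 1)"
    using graded_part_mono[of M "M + 1"] graded_part_mono[of M "M + 1 + 1"] by (auto simp: P_0)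
qed auto

text \<open>An element of slope \<open>s > t\<close> has a surplus of \<open>m * (s - t)\<close>
  over what slope \<open>t\<close> demands, and the surpluses of a high power add up to more than
  the deficit \<open>(M + 1) * t\<close> of arbitrary elements of \<open>RR M\<close>.\<close>

lemma absorbing_if_below:
  assumes t: "0 \<le> t" "t < s" and g: "g \<in> P s m" "g \<noteq> 0" "m \<ge> 1"
  shows "absorbing t"
  unfolding absorbing_def
proof
  fix M
  obtain k :: nat where "real (M + 1) * t / (real m * (s - t)) < real k" using reals_Archimedean2 by blast
  then have k: "real (M + 1) * t < real k * (real m * (s - t))" using t g(3) by (simp add: pos_divide_less_eq)
  \<comment> \<open>The successor makes the height \<open>k' * m\<close> at least 1 even if
    \<open>k = 0\<close>.\<close>
  define k' where "k' = Suc k"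
  have "real k * (real m * (s - t)) \<le> real k' * (real m * (s - t))"
    using t by (intro mult_right_mono) (auto simp: k'_def)
  with k have k': "real (M + 1 + k' * m) * t \<le> real k' * (real m * s)" by (simp add: algebra_simps)
  have gk: "g ^ k' \<in> FP (real k' * (real m * s)) (k' * m)" using FP_power g(1) unfolding P_eq by blast
  have "f * g ^ k' \<in> P t (M + k' * m) \<and> f * g ^ k' \<in> P t (M + k' * m + 1)" if f: "f \<in> RR M" for f
  proof -
    have fg: "f * g ^ k' \<in> FP (real k' * (real m * s)) (M + k' * m)"
      using FP_mult[OF _ gk, of f 0 M] f by (simp add: FP_0)
    have "real (M + k' * m) * t \<le> real (M + 1 + k' * m) * t" using t by (intro mult_right_mono) auto
    with k' have "real (M + k' * m) * t \<le> real k' * (real m * s)" by linarith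
    then have "f * g ^ k' \<in> P t (M + k' * m)" using fg FP_anti unfolding P_eq by blast
    moreover have "f * g ^ k' \<in> FP (real k' * (real m * s)) (M + k' * m + 1)"
      using fg FP_mono[of "M + k' * m" "M + k' * m + 1"] by auto
    then have "f * g ^ k' \<in> P t (M + k' * m + 1)"
      using k' FP_anti[of "real (M + k' * m + 1) * t"] unfolding P_eq by (auto simp: algebra_simps)
    ultimately show ?thesis by blast
  qed
  moreover have "1 \<le> k' * m" using g(3) by (simp add: k'_def)
  ultimately show "\<exists>h N. h \<noteq> 0 \<and> 1 \<le> N \<and> (\<forall>f\<in>RR M. f * h \<in> P t (M + N) \<and> f * h \<in> P t (M + N + 1))"
    using g(2) by (intro exI[of _ "g ^ k'"] exI[of _ "k' * m"]) auto
qed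

text \<open>Differences of values of elements of \<open>R\<close> are values of elements of the function field, and
  multiplication by \<open>h\<close> moves them into \<open>\<Gamma> t\<close>.\<close>

lemma lattice_semigroup_\<Gamma>:
  assumes n: "n = CARD('n::{finite, linorder})" and t: "absorbing t"
  shows "lattice_semigroup (\<Gamma> t :: ((real^'n::{finite, linorder}) \<times> real) set)"
proof
  let ?G = "\<Gamma> t :: ((real^'n::{finite, linorder}) \<times> real) set" and ?vec = "vec :: 'r \<Rightarrow> real^'n::{finite, linorder}"
  have GI: "(?vec f, real m) \<in> ?G" if "f \<in> P t m" "f \<noteq> 0" "m \<ge> 1" for f m
    using that by (auto simp: value_semigroup_def)
  show "lattice_pt s" if "s \<in> ?G" for s
    using that by (auto simp: value_semigroup_def lattice_pt_Pair lattice_pt_vec)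
  show "1 \<le> snd s" if "s \<in> ?G" for s
    using that by (auto simp: value_semigroup_def)
  show add: "s + s' \<in> ?G" if ss: "s \<in> ?G" "s' \<in> ?G" for s s'
  proof -
    obtain f m g m' where *: "s = (?vec f, real m)" "s' = (?vec g, real m')" "m \<ge> 1" "m' \<ge> 1"
      "f \<in> P t m" "g \<in> P t m'" "f \<noteq> 0" "g \<noteq> 0"
      using ss by (auto simp: value_semigroup_def)
    have "(?vec (f * g), real (m + m')) \<in> ?G" by (rule GI) (use * P_mult in auto)
    then show ?thesis by (simp add: * vec_mult[OF n])
  qed
  define D where "D = {w. \<exists>s\<in>?G. \<exists>s'\<in>?G. w = s - s'}"
  have DI: "s - s' \<in> D" if "s \<in> ?G" "s' \<in> ?G" for s s' using that by (auto simp: D_def)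
  have Dplus: "a + b \<in> D" if ab: "a \<in> D" "b \<in> D" for a b
  proof -
    obtain s s' r r' where *: "s \<in> ?G" "s' \<in> ?G" "r \<in> ?G" "r' \<in> ?G" "a = s - s'" "b = r - r'"
      using ab unfolding D_def by blast
    have "(s + r) - (s' + r') \<in> D" using * by (intro DI add)
    then show ?thesis by (simp add: * algebra_simps)
  qed
  have Dminus: "- a \<in> D" if a: "a \<in> D" for a
  proof -
    obtain s s' where "s \<in> ?G" "s' \<in> ?G" "a = s - s'" using a unfolding D_def by blast
    then show ?thesis using DI[of s' s] by simp
  qed
  have key: "(?vec f - ?vec g, 0) \<in> D" "(0, 1) \<in> D" if fg: "f \<noteq> 0" "g \<noteq> 0" for f g
  proof -
    obtain M where M: "{f, g} \<subseteq> RR M" using in_graded_part_finite[of "{f, g}"] by auto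
    obtain h N where h: "h \<noteq> 0" "1 \<le> N" "\<And>f. f \<in> RR M \<Longrightarrow> f * h \<in> P t (M + N) \<and> f * h \<in> P t (M + N + 1)"
      using t unfolding absorbing_def by metis
    have *: "(?vec (f * h), real (M + N)) \<in> ?G" "(?vec (g * h), real (M + N)) \<in> ?G" "(?vec (f * h), real (M + N + 1)) \<in> ?G"
      by (rule GI; use h M fg in auto)+
    show "(?vec f - ?vec g, 0) \<in> D" using DI[OF *(1,2)] fg h(1) by (simp add: vec_mult[OF n])
    show "(0, 1) \<in> D" using DI[OF *(3,1)] by simp
  qed
  have D0: "0 \<in> D" using key(1)[of 1 1] by (simp add: zero_prod_def)
  have Dnat: "real k *\<^sub>R a \<in> D" if a: "a \<in> D" for k a
    by (induction k) (use D0 Dplus a in \<open>auto simp: scaleR_left_distrib\<close>)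
  have Dint: "of_int k *\<^sub>R a \<in> D" if a: "a \<in> D" for k a
    using Dnat[OF a, of "nat k"] Dminus[OF Dnat[OF a, of "nat (- k)"]] by (cases "k \<ge> 0") auto
  have Dsum: "(\<Sum>i\<in>I. f i) \<in> D" if "\<And>i. i \<in> I \<Longrightarrow> f i \<in> D" for I :: "'n set" and f
    using that by (induction I rule: infinite_finite_induct) (auto simp: D0 Dplus)
  have Daxis: "(axis i 1 :: real^'n::{finite, linorder}, 0) \<in> D" for i :: 'n
  proof -
    let ?j = "card {..<i}"
    have j: "?j < n" by (rule index_less[OF n])
    \<comment> \<open>\<open>x ?j\<close> need not lie in \<open>R\<close>; written as a fraction,
      it gives two elements of \<open>R\<close> whose values differ by a unit vector.\<close>
    obtain a b where ab: "x ?j = Fract a b" "b \<noteq> 0" by (cases "x ?j") auto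
    then have xb: "x ?j * to_fract b = to_fract a" by (simp add: Fract_conv_to_fract)
    have xne: "x ?j \<noteq> 0" using x_notin[OF j] is_idealD(2)[OF J_ideal[of ?j]] j by auto
    then have a0: "a \<noteq> 0" using xb ab(2) by auto
    have fv: "flag_val \<eta> x (to_fract a) k = (if k = ?j then 1 else 0) + flag_val \<eta> x (to_fract b) k" if "k < n" for k
      using flag_val_mult[OF x_in[OF j] xne to_fract_in _ that, of b] ab(2) xb flag_val_x[OF j that] by simp
    have inj: "card {..<k} = ?j \<longleftrightarrow> k = i" for k :: 'n
      using index_bij[where 'n='n] by (auto simp: bij_betw_def inj_on_def)
    have "?vec a - ?vec b = axis i 1"
      by (simp add: Finite_Cartesian_Product.vec_eq_iff flag_val_vec_def fv[OF index_less[OF n]] axis_def inj)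
    then show ?thesis using key(1)[OF a0 ab(2)] by simp
  qed
  show "\<exists>s\<in>?G. \<exists>s'\<in>?G. w = s - s'" if w: "lattice_pt w" for w
  proof -
    obtain p h where ph: "w = (p, h)" by (cases w)
    then have hp: "h \<in> \<int>" "lattice_pt p" using w by (auto simp: lattice_pt_Pair)
    have pk: "p $ i = of_int \<lfloor>p $ i\<rfloor>" for i
    proof -
      have "p \<bullet> axis i 1 \<in> \<int>" using hp(2) by (auto simp: lattice_pt_def)
      then show ?thesis by (simp add: inner_axis of_int_floor_cancel)
    qed
    have "(\<Sum>i\<in>UNIV. of_int \<lfloor>p $ i\<rfloor> *\<^sub>R (axis i 1 :: real^'n::{finite, linorder}, 0::real)) + of_int \<lfloor>h\<rfloor> *\<^sub>R (0, 1) \<in> D"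
      by (intro Dplus Dsum Dint Daxis key(2)[of 1 1]) auto
    also have "(\<Sum>i\<in>UNIV. of_int \<lfloor>p $ i\<rfloor> *\<^sub>R (axis i 1 :: real^'n::{finite, linorder}, 0::real)) = (p, 0)"
      unfolding pk[symmetric] by (simp add: prod_eq_iff fst_sum snd_sum basis_expansion scalar_mult_eq_scaleR[symmetric])
    also have "(p, 0) + of_int \<lfloor>h\<rfloor> *\<^sub>R (0, 1) = w" using hp(1) by (simp add: ph of_int_floor_cancel)
    finally show ?thesis by (simp add: D_def)
  qed
qed

lemma level_growth:
  assumes n: "n = CARD('n::{finite, linorder})"
  obtains C where "\<And>m. m \<ge> 1 \<Longrightarrow> finite (level (\<Gamma> 0 :: ((real^'n::{finite, linorder}) \<times> real) set) m) \<and>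
    real (card (level (\<Gamma> 0 :: ((real^'n::{finite, linorder}) \<times> real) set) m)) \<le> C * real m ^ DIM(real^'n::{finite, linorder})"
proof -
  obtain C where C: "\<And>m. \<exists>T. finite T \<and> RR m \<subseteq> span T \<and> real (card T) \<le> C * (real m + 1) ^ n"
    using graded_part_growth[OF dim_R] by metis
  have C0: "C \<ge> 0" using C[of 0] by (auto intro: order_trans[OF of_nat_0_le_iff])
  have "finite (level (\<Gamma> 0 :: ((real^'n::{finite, linorder}) \<times> real) set) m) \<and>
    real (card (level (\<Gamma> 0 :: ((real^'n::{finite, linorder}) \<times> real) set) m)) \<le> (C * 2 ^ n) * real m ^ DIM(real^'n::{finite, linorder})" if m: "m \<ge> 1" for m
  proof -
    obtain T where T: "finite T" "RR m \<subseteq> span T" "real (card T) \<le> C * (real m + 1) ^ n" using C by blast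
    have "dim (RR m) \<le> card T" by (rule dim_le_card[OF T(2,1)])
    then have "real (dim (RR m)) \<le> C * (real m + 1) ^ n" using T(3) by linarith
    also have "\<dots> \<le> C * (2 * real m) ^ n" using m C0 by (intro mult_left_mono power_mono) auto
    finally have "real (dim (RR m)) \<le> (C * 2 ^ n) * real m ^ n" by (simp add: power_mult_distrib mult.assoc)
    then show ?thesis
      using card_vec[OF n subspace_graded_part order_refl, of m] by (simp add: level_\<Gamma>[OF m] P_0 n)
  qed
  then show thesis by (rule that)
qed

section \<open>Jumping numbers\<close>

lemma dim_zero: "dim {0} = 0"
  using dim_unique[of "{}" "{0}" 0] independent_empty by simp

text \<open>Keeps the defining infimum from being taken over the empty set. For
  \<open>m \<ge> 1\<close> linear boundedness is enough. Height 0 is outside the scope of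
  \<open>max_slope\<close>: there, positivity of the Reeb vector leaves only degree 0, on which the
  filtration vanishes eventually.\<close>

lemma jumping_number_nonempty:
  assumes "j \<le> hilbert_fun smul gr \<xi> m"
  shows "\<exists>l\<ge>0. dim (RR m) - dim (FP l m) \<ge> j"
proof (cases "m \<ge> 1")
  case True
  obtain T where T: "0 \<le> T" "\<And>t m. t \<ge> 0 \<Longrightarrow> m \<ge> 1 \<Longrightarrow> P t m \<noteq> {0} \<Longrightarrow> t \<le> T" using max_slope_bound by metis
  have "P (T + 1) m = {0}" using T(2)[of "T + 1" m] T(1) True by force
  then have "dim (FP (real m * (T + 1)) m) = 0" using dim_zero by (simp add: P_eq)
  then show ?thesis using assms T(1) by (intro exI[of _ "real m * (T + 1)"]) (simp add: hilbert_fun_def)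
next
  case False
  then have m: "m = 0" by simp
  have "gr \<alpha> = {0}" if "weight_pairing \<alpha> \<xi> \<le> 0" "\<alpha> \<noteq> 0" for \<alpha> using reeb[of \<alpha>] that by force
  then have sub: "F l \<inter> gr \<alpha> \<subseteq> {0} \<union> (F l \<inter> gr 0)" if "weight_pairing \<alpha> \<xi> \<le> 0" for \<alpha> l using that by (cases "\<alpha> = 0") auto
  obtain l where l: "l \<ge> 0" "F l \<inter> gr 0 = {0}"
    using eventually_zero[of 0] unfolding eventually_at_top_linorder by (metis linear)
  have "FP l 0 \<subseteq> span {0}" unfolding filtered_part_def using sub l(2) by (intro span_mono) fastforce
  then have "FP l m = {0}" using subspace_0[OF subspace_FP, of l 0] unfolding m by auto
  then show ?thesis using assms l(1) dim_zero by (intro exI[of _ l]) (simp add: hilbert_fun_def)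
qed

lemma dim_FP_anti: "l \<le> l' \<Longrightarrow> dim (FP l' m) \<le> dim (FP l m)"
proof -
  assume l: "l \<le> l'"
  obtain T where T: "finite T" "RR m \<subseteq> span T" using graded_part_finite_dim by blast
  obtain B where B: "B \<subseteq> FP l m" "independent B" "FP l m \<subseteq> span B" "card B = dim (FP l m)" by (rule basis_exists)
  have "finite B" using independent_span_bound[OF T(1) B(2)] B(1) FP_subset T(2) by blast
  then have "dim (FP l' m) \<le> card B" using FP_anti[OF l] B(3) by (intro dim_le_card) auto
  then show ?thesis using B(4) by simp
qed

lemma jumping_number_nonneg:
  assumes "j \<le> hilbert_fun smul gr \<xi> m" shows "0 \<le> jumping_number smul gr \<xi> F m j"
  unfolding jumping_number_def using jumping_number_nonempty[OF assms] by (intro cInf_greatest) auto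

text \<open>The codimension increases with \<open>l\<close>, so the infimum separates the two cases.
  At the jumping number itself the answer depends on whether the infimum is attained; leaving it out
  costs a null set in the integration over \<open>t\<close>.\<close>

lemma less_jumping_number:
  assumes j: "j \<le> hilbert_fun smul gr \<xi> m" and l: "0 \<le> l" "l \<noteq> jumping_number smul gr \<xi> F m j"
  shows "l < jumping_number smul gr \<xi> F m j \<longleftrightarrow> dim (RR m) - dim (FP l m) < j"
proof
  let ?A = "{l. l \<ge> 0 \<and> dim (RR m) - dim (FP l m) \<ge> j}"
  assume "l < jumping_number smul gr \<xi> F m j"
  then have "l \<notin> ?A" unfolding jumping_number_def
    using cInf_lower[of l ?A] by (force intro: bdd_belowI[of _ 0])
  then show "dim (RR m) - dim (FP l m) < j" using l(1) by auto
next
  let ?A = "{l. l \<ge> 0 \<and> dim (RR m) - dim (FP l m) \<ge> j}"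
  assume less: "dim (RR m) - dim (FP l m) < j"
  have "l \<le> jumping_number smul gr \<xi> F m j"
    unfolding jumping_number_def
  proof (rule cInf_greatest)
    show "?A \<noteq> {}" using jumping_number_nonempty[OF j] by auto
    fix l' assume "l' \<in> ?A"
    then show "l \<le> l'" using less dim_FP_anti[of l' l m] by (cases "l \<le> l'") auto
  qed
  then show "l < jumping_number smul gr \<xi> F m j" using l(2) by simp
qed

lemma filtered_semigroup_\<Gamma>:
  assumes n: "n = CARD('n::{finite, linorder})"
  obtains T C where "filtered_semigroup (\<Gamma> :: real \<Rightarrow> ((real^'n::{finite, linorder}) \<times> real) set) T C"
proof -
  let ?\<Gamma> = "\<Gamma> :: real \<Rightarrow> ((real^'n::{finite, linorder}) \<times> real) set"
  obtain T where T: "0 \<le> T" "\<And>t m. t \<ge> 0 \<Longrightarrow> m \<ge> 1 \<Longrightarrow> P t m \<noteq> {0} \<Longrightarrow> t \<le> T" using max_slope_bound by metis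
  obtain C where C: "\<And>m. m \<ge> 1 \<Longrightarrow> finite (level (?\<Gamma> 0) m) \<and> real (card (level (?\<Gamma> 0) m)) \<le> C * real m ^ DIM(real^'n::{finite, linorder})"
    using level_growth[OF n] by metis
  have "filtered_semigroup ?\<Gamma> T C"
  proof (rule filtered_semigroup.intro)
    show "lattice_semigroup (?\<Gamma> 0)" by (rule lattice_semigroup_\<Gamma>[OF n absorbing_0])
    show "?\<Gamma> t \<subseteq> ?\<Gamma> s" if "0 \<le> s" "s \<le> t" for s t
      using P_anti[OF that(2)] by (auto simp: value_semigroup_def)
    show "lattice_semigroup (?\<Gamma> t)" if ts: "0 \<le> t" "t < s" "?\<Gamma> s \<noteq> {}" for s t
    proof -
      obtain f m where "m \<ge> 1" "f \<in> P s m" "f \<noteq> 0" using ts(3) by (auto simp: value_semigroup_def)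
      then show ?thesis using lattice_semigroup_\<Gamma>[OF n absorbing_if_below[OF ts(1,2)]] by blast
    qed
    show "?\<Gamma> t = {}" if t: "t > T" for t
    proof (rule ccontr)
      assume "?\<Gamma> t \<noteq> {}"
      then obtain f m where "m \<ge> 1" "f \<in> P t m" "f \<noteq> 0" by (auto simp: value_semigroup_def)
      then have "t \<le> T" using T(2)[of t m] t T(1) by force
      then show False using t by simp
    qed
  qed (use T(1) C in auto)
  then show thesis by (rule that)
qed

text \<open>No bijection between lattice points and jumping numbers is constructed: for almost every
  \<open>t \<ge> 0\<close> both families have exactly \<open>dim (P t m)\<close> members above
  \<open>t\<close>, and the layer-cake formula compares the sums.\<close>

lemma sum_jumping_numbers:
  assumes n: "n = CARD('n::{finite, linorder})"
    and fs: "filtered_semigroup (\<Gamma> :: real \<Rightarrow> ((real^'n::{finite, linorder}) \<times> real) set) T C" and m: "m \<ge> 1"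
  shows "(\<Sum>w\<in>level (\<Gamma> 0 :: ((real^'n::{finite, linorder}) \<times> real) set) m. filtered_semigroup.\<tau> \<Gamma> m w)
    = (\<Sum>j = 1..hilbert_fun smul gr \<xi> m. jumping_number smul gr \<xi> F m j) / real m"
proof -
  let ?\<Gamma> = "\<Gamma> :: real \<Rightarrow> ((real^'n::{finite, linorder}) \<times> real) set"
  interpret fs: filtered_semigroup ?\<Gamma> T C by (rule fs)
  let ?L = "level (?\<Gamma> 0) m"
  define N where "N = hilbert_fun smul gr \<xi> m"
  define a where "a j = jumping_number smul gr \<xi> F m j / real m" for j
  have finL: "finite ?L" using fs.growth[OF m] by blast
  have a0: "0 \<le> a j" if "j \<in> {1..N}" for j
    using jumping_number_nonneg[of j m] that by (auto simp: a_def N_def)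
  have card_level: "card (level (?\<Gamma> t) m) = dim (P t m)" for t
    unfolding level_\<Gamma>[OF m] P_eq by (rule card_vec(2)[OF n subspace_FP FP_subset])
  \<comment> \<open>The finitely many \<open>t\<close> that are members of one of the two families,
    where strict and weak inequality differ.\<close>
  define E where "E = fs.\<tau> m ` ?L \<union> a ` {1..N}"
  have "finite E" using finL by (simp add: E_def)
  then have E: "E \<in> null_sets lborel" by (rule finite_imp_null_set_lborel)
  have pt: "(\<Sum>w\<in>?L. indicator {0..<fs.\<tau> m w} t) = (\<Sum>j\<in>{1..N}. indicator {0..<a j} t :: real)" if t: "t \<notin> E" for t
  proof (cases "t \<ge> 0")
    case True
    have "(\<Sum>w\<in>?L. indicator {0..<fs.\<tau> m w} t :: real) = (\<Sum>w\<in>?L. if t < fs.\<tau> m w then 1 else 0)"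
      by (rule sum.cong) (use True in \<open>auto simp: indicator_def\<close>)
    also have "\<dots> = real (card {w \<in> ?L. t < fs.\<tau> m w})"
      using finL by (simp add: sum.If_cases Int_def)
    also have "{w \<in> ?L. t < fs.\<tau> m w} = level (?\<Gamma> t) m"
    proof (intro equalityI subsetI)
      fix w assume "w \<in> {w \<in> ?L. t < fs.\<tau> m w}"
      then show "w \<in> level (?\<Gamma> t) m" using fs.\<tau>_le[of w m t] True by force
    next
      fix w assume w: "w \<in> level (?\<Gamma> t) m"
      then have "w \<in> ?L" using fs.level_decreasing[of 0 t m] True by auto
      moreover have "t \<le> fs.\<tau> m w" by (rule fs.\<tau>_upper[OF True w])
      moreover have "t \<noteq> fs.\<tau> m w" using t \<open>w \<in> ?L\<close> by (auto simp: E_def)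
      ultimately show "w \<in> {w \<in> ?L. t < fs.\<tau> m w}" by simp
    qed
    also have "card (level (?\<Gamma> t) m) = dim (P t m)" by (rule card_level)
    finally have 1: "(\<Sum>w\<in>?L. indicator {0..<fs.\<tau> m w} t :: real) = real (dim (P t m))" .
    have dN: "dim (P t m) \<le> N"
      using dim_FP_anti[of 0 "real m * t" m] True by (simp add: P_eq FP_0 N_def hilbert_fun_def)
    have iff: "t < a j \<longleftrightarrow> N - dim (P t m) < j" if j: "j \<in> {1..N}" for j
    proof -
      have "t < a j \<longleftrightarrow> real m * t < jumping_number smul gr \<xi> F m j"
        using m by (simp add: a_def pos_less_divide_eq mult.commute)
      also have "\<dots> \<longleftrightarrow> dim (RR m) - dim (FP (real m * t) m) < j"
      proof (rule less_jumping_number)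
        show "j \<le> hilbert_fun smul gr \<xi> m" using j by (simp add: N_def)
        show "0 \<le> real m * t" using True by simp
        have "t \<noteq> a j" using t j by (auto simp: E_def)
        moreover have "t = real m * t / real m" using m by simp
        ultimately show "real m * t \<noteq> jumping_number smul gr \<xi> F m j" unfolding a_def by metis
      qed
      finally show ?thesis by (simp add: P_eq N_def hilbert_fun_def)
    qed
    have "(\<Sum>j\<in>{1..N}. indicator {0..<a j} t :: real) = (\<Sum>j\<in>{1..N}. if N - dim (P t m) < j then 1 else 0)"
      by (rule sum.cong) (use True iff in \<open>auto simp: indicator_def\<close>)
    also have "\<dots> = real (card {j \<in> {1..N}. N - dim (P t m) < j})"
      by (simp add: sum.If_cases Int_def)
    also have "{j \<in> {1..N}. N - dim (P t m) < j} = {N - dim (P t m)<..N}" by auto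
    \<comment> \<open>The truncated subtraction is exact by \<open>dN\<close>.\<close>
    also have "card {N - dim (P t m)<..N} = dim (P t m)" using dN by simp
    finally show ?thesis using 1 by simp
  qed (auto simp: indicator_def)
  have "(\<Sum>w\<in>?L. fs.\<tau> m w) = integral\<^sup>L lborel (\<lambda>t. \<Sum>w\<in>?L. indicator {0..<fs.\<tau> m w} t :: real)"
    by (rule integral_indicators[symmetric]) (rule fs.\<tau>_bounds)
  also have "\<dots> = integral\<^sup>L lborel (\<lambda>t. \<Sum>j\<in>{1..N}. indicator {0..<a j} t :: real)"
    by (rule integral_cong_AE) (use AE_not_in[OF E] pt in \<open>auto elim!: eventually_mono\<close>)
  also have "\<dots> = (\<Sum>j\<in>{1..N}. a j)"
    by (rule integral_indicators) (rule a0)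
  finally show ?thesis by (simp add: a_def N_def sum_divide_distrib)
qed

text \<open>The atoms are non-negative, so scaling and push-forward can be unfolded in
  \<open>ennreal\<close>, and the restriction to \<open>{0..}\<close> removes none of them.\<close>

lemma jumping_integral:
  assumes m: "m \<ge> 1"
  shows "(LINT t:{0..}|jumping_measure n smul gr \<xi> F m. t)
    = (\<Sum>j = 1..hilbert_fun smul gr \<xi> m. jumping_number smul gr \<xi> F m j) / real m ^ (n + 1)"
proof -
  let ?N = "hilbert_fun smul gr \<xi> m"
  let ?a = "\<lambda>j. jumping_number smul gr \<xi> F m j / real m"
  let ?D = "distr (count_space {1..?N}) borel ?a"
  let ?f = "\<lambda>t. indicator {0..} t *\<^sub>R t :: real"
  have a0: "0 \<le> ?a j" if "j \<in> {1..?N}" for j using jumping_number_nonneg[of j m] that by auto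
  have "(LINT t:{0..}|jumping_measure n smul gr \<xi> F m. t) = integral\<^sup>L (scale_measure (ennreal (1 / real m ^ n)) ?D) ?f"
    by (simp add: set_lebesgue_integral_def jumping_measure_def)
  also have "\<dots> = enn2real (\<integral>\<^sup>+t. ennreal (?f t) \<partial>scale_measure (ennreal (1 / real m ^ n)) ?D)"
    by (rule integral_eq_nn_integral) (auto simp: indicator_def)
  also have "(\<integral>\<^sup>+t. ennreal (?f t) \<partial>scale_measure (ennreal (1 / real m ^ n)) ?D)
      = ennreal (1 / real m ^ n) * (\<integral>\<^sup>+t. ennreal (?f t) \<partial>?D)"
    by (rule nn_integral_scale_measure) simp
  also have "(\<integral>\<^sup>+t. ennreal (?f t) \<partial>?D) = (\<integral>\<^sup>+j. ennreal (?f (?a j)) \<partial>count_space {1..?N})"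
    by (rule nn_integral_distr) auto
  also have "\<dots> = (\<Sum>j\<in>{1..?N}. ennreal (?f (?a j)))"
    by (rule nn_integral_count_space_finite) simp
  also have "\<dots> = (\<Sum>j\<in>{1..?N}. ennreal (?a j))"
    by (rule sum.cong) (use a0 in \<open>auto simp: indicator_def\<close>)
  also have "\<dots> = ennreal (\<Sum>j\<in>{1..?N}. ?a j)"
    by (rule sum_ennreal) (rule a0)
  also have "ennreal (1 / real m ^ n) * ennreal (\<Sum>j\<in>{1..?N}. ?a j) = ennreal (1 / real m ^ n * (\<Sum>j\<in>{1..?N}. ?a j))"
    by (rule ennreal_mult[symmetric]) (use a0 in \<open>auto intro!: sum_nonneg\<close>)
  also have "enn2real \<dots> = 1 / real m ^ n * (\<Sum>j\<in>{1..?N}. ?a j)"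
    by (rule enn2real_ennreal) (intro mult_nonneg_nonneg sum_nonneg, use a0 in auto)
  also have "\<dots> = (\<Sum>j = 1..?N. jumping_number smul gr \<xi> F m j) / real m ^ (n + 1)"
    by (simp add: sum_divide_distrib[symmetric])
  finally show ?thesis .
qed

lemma okounkov_body_eq_slice: "okounkov_body \<eta> x W = slice (value_semigroup \<eta> x W)"
  by (simp add: okounkov_body_def slice_def)

text \<open>\<open>reeb_volume\<close> is a \<open>lim\<close>, so its convergence has to be shown
  before it can be computed: it is \<open>n!\<close> times the volume of the body. That volume is
  positive, so the third claim follows by dividing the limit of \<open>?s m / m ^ (n + 1)\<close> by
  the limit of \<open>?N m / m ^ n\<close>.\<close>

theorem filtration_volume_limit:
  assumes n: "n = CARD('n::{finite, linorder})"
  shows "filtration_volume_level n smul gr \<xi> F \<longlonglongrightarrow> filtration_volume TYPE('n::{finite, linorder}) smul gr \<xi> \<eta> x F"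
    and "\<And>m. m \<ge> 1 \<Longrightarrow> filtration_volume_level n smul gr \<xi> F m =
        fact n / (reeb_volume n smul gr \<xi> * real m ^ (n + 1))
          * (\<Sum>j = 1..hilbert_fun smul gr \<xi> m. jumping_number smul gr \<xi> F m j)"
    and "(\<lambda>m. 1 / (real m * real (hilbert_fun smul gr \<xi> m))
          * (\<Sum>j = 1..hilbert_fun smul gr \<xi> m. jumping_number smul gr \<xi> F m j))
        \<longlonglongrightarrow> filtration_volume TYPE('n::{finite, linorder}) smul gr \<xi> \<eta> x F"
proof -
  let ?\<Gamma> = "\<Gamma> :: real \<Rightarrow> ((real^'n::{finite, linorder}) \<times> real) set"
  let ?N = "hilbert_fun smul gr \<xi>"
  let ?V = "reeb_volume n smul gr \<xi>"
  let ?s = "\<lambda>m. \<Sum>j = 1..?N m. jumping_number smul gr \<xi> F m j"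
  let ?S = "filtration_volume TYPE('n::{finite, linorder}) smul gr \<xi> \<eta> x F"
  obtain T C where fs: "filtered_semigroup ?\<Gamma> T C" using filtered_semigroup_\<Gamma>[OF n] .
  interpret fs: filtered_semigroup ?\<Gamma> T C by (rule fs)
  let ?\<Delta> = "slice (?\<Gamma> 0)"
  have P0: "slope_part smul gr \<xi> F 0 = graded_part smul gr \<xi>" using P_0 by auto
  have DIMn: "DIM(real^'n::{finite, linorder}) = n" by (simp add: n)
  have cardN: "card (level (?\<Gamma> 0) m) = ?N m" if "m \<ge> 1" for m
    using card_vec(2)[OF n subspace_graded_part order_refl, of m] by (simp add: level_\<Gamma>[OF that] P_0 hilbert_fun_def)
  have volN: "(\<lambda>m. real (?N m) / real m ^ n) \<longlonglongrightarrow> measure lborel ?\<Delta>"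
  proof (rule Lim_transform_eventually[OF fs.volume_limit[unfolded DIMn]])
    show "\<forall>\<^sub>F m in sequentially. real (card (level (?\<Gamma> 0) m)) / real m ^ n = real (?N m) / real m ^ n"
      using eventually_ge_at_top[of "1::nat"] by eventually_elim (simp only: cardN)
  qed
  have V: "?V = fact n * measure lborel ?\<Delta>"
    unfolding reeb_volume_def
  proof (rule limI)
    show "(\<lambda>m. fact n / real m ^ n * real (?N m)) \<longlonglongrightarrow> fact n * measure lborel ?\<Delta>"
      using tendsto_mult_left[OF volN, of "fact n"] by simp
  qed
  then have Vpos: "?V > 0" using fs.volume_pos by simp
  have G_eq: "concave_transform smul gr \<xi> \<eta> x F = fs.G"
    by (rule ext) (simp add: concave_transform_def fs.G_def okounkov_body_eq_slice)
  \<comment> \<open>Outside the body \<open>fs.G\<close> is a supremum over the empty set.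
    Measurability is known for its product with the indicator and is carried over to the restricted
    space.\<close>
  have Gm: "fs.G \<in> borel_measurable (restrict_space lborel ?\<Delta>)"
  proof -
    have "(\<lambda>p. indicator ?\<Delta> p * fs.G p) \<in> borel_measurable (restrict_space lborel ?\<Delta>)"
      by (rule measurable_restrict_space1) (use fs.measurable_G in simp)
    then show ?thesis by (rule measurable_cong[THEN iffD1, rotated]) (simp add: space_restrict_space)
  qed
  have S: "?S = fact n / ?V * (\<integral>p. indicator ?\<Delta> p * fs.G p \<partial>lborel)"
  proof -
    have "(LINT t:{0..}|limit_measure TYPE('n::{finite, linorder}) smul gr \<xi> \<eta> x F. t)
        = integral\<^sup>L (distr (restrict_space lborel ?\<Delta>) borel fs.G) (\<lambda>t. indicator {0..} t *\<^sub>R t)"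
      unfolding set_lebesgue_integral_def limit_measure_def G_eq okounkov_body_eq_slice P0[symmetric] ..
    also have "\<dots> = (\<integral>p. indicator {0..} (fs.G p) *\<^sub>R fs.G p \<partial>restrict_space lborel ?\<Delta>)"
      by (rule integral_distr[OF Gm]) simp
    also have "\<dots> = (\<integral>p. indicator ?\<Delta> p *\<^sub>R (indicator {0..} (fs.G p) *\<^sub>R fs.G p) \<partial>lborel)"
      by (rule integral_restrict_space) (use closed_slice in \<open>auto intro: borel_closed\<close>)
    also have "\<dots> = (\<integral>p. indicator ?\<Delta> p * fs.G p \<partial>lborel)"
      by (rule Bochner_Integration.integral_cong) (use fs.G_bounds(1) in \<open>auto simp: indicator_def\<close>)
    finally show ?thesis by (simp add: filtration_volume_def n)
  qed
  have lim: "(\<lambda>m. ?s m / real m ^ (n + 1)) \<longlonglongrightarrow> (\<integral>p. indicator ?\<Delta> p * fs.G p \<partial>lborel)"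
  proof (rule Lim_transform_eventually[OF fs.limit[unfolded DIMn]])
    show "\<forall>\<^sub>F m in sequentially. (\<Sum>w\<in>level (?\<Gamma> 0) m. fs.\<tau> m w) / real m ^ n = ?s m / real m ^ (n + 1)"
      using eventually_ge_at_top[of "1::nat"]
      by eventually_elim (simp add: sum_jumping_numbers[OF n fs] mult.commute)
  qed
  have level: "filtration_volume_level n smul gr \<xi> F m = fact n / ?V * (?s m / real m ^ (n + 1))" if "m \<ge> 1" for m
    unfolding filtration_volume_level_def jumping_integral[OF that] ..
  show "filtration_volume_level n smul gr \<xi> F m = fact n / (?V * real m ^ (n + 1)) * ?s m" if "m \<ge> 1" for m
    unfolding level[OF that] by simp
  have lim': "(\<lambda>m. fact n / ?V * (?s m / real m ^ (n + 1))) \<longlonglongrightarrow> ?S"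
    unfolding S by (rule tendsto_mult_left[OF lim])
  then show "filtration_volume_level n smul gr \<xi> F \<longlonglongrightarrow> ?S"
  proof (rule Lim_transform_eventually)
    show "\<forall>\<^sub>F m in sequentially. fact n / ?V * (?s m / real m ^ (n + 1)) = filtration_volume_level n smul gr \<xi> F m"
      using eventually_ge_at_top[of "1::nat"] by eventually_elim (simp only: level)
  qed
  have "(\<lambda>m. (?s m / real m ^ (n + 1)) / (real (?N m) / real m ^ n)) \<longlonglongrightarrow>
      (\<integral>p. indicator ?\<Delta> p * fs.G p \<partial>lborel) / measure lborel ?\<Delta>"
    by (rule tendsto_divide[OF lim volN]) (use fs.volume_pos in simp)
  also have "(\<integral>p. indicator ?\<Delta> p * fs.G p \<partial>lborel) / measure lborel ?\<Delta> = ?S"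
    unfolding S V using fs.volume_pos by simp
  finally show "(\<lambda>m. 1 / (real m * real (?N m)) * ?s m) \<longlonglongrightarrow> ?S"
  proof (rule Lim_transform_eventually)
    show "\<forall>\<^sub>F m in sequentially. (?s m / real m ^ (n + 1)) / (real (?N m) / real m ^ n) = 1 / (real m * real (?N m)) * ?s m"
      using eventually_ge_at_top[of "1::nat"] by eventually_elim simp
  qed
qed

end

theorem corollary3p13:
  fixes smul :: "'k::{alg_closed_field, field_char_0} \<Rightarrow> 'r::idom \<Rightarrow> 'r"
    and gr :: "int^'d \<Rightarrow> 'r set" and \<mm> :: "'r set" and \<xi> :: "real^'d"
    and Y :: "'r fract set set" and E :: "nat \<Rightarrow> 'r fract set"
    and \<eta> :: "'r fract set" and x :: "nat \<Rightarrow> 'r fract"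
    and F :: "real \<Rightarrow> 'r set"
  assumes "polarized_affine_variety smul gr \<mm> \<xi>"
    and "krull_dim (UNIV :: 'r set) = enat CARD('n::{finite, linorder})"
    and "log_resolution \<mm> Y"
    and "components_meet_at \<mm> Y CARD('n) E \<eta> x"
    and "filtration smul gr F"
    and "linearly_bounded smul gr \<xi> F"
  shows "filtration_volume_level CARD('n) smul gr \<xi> F
        \<longlonglongrightarrow> filtration_volume TYPE('n) smul gr \<xi> \<eta> x F
    \<and> (\<forall>m\<ge>1. filtration_volume_level CARD('n) smul gr \<xi> F m =
        fact CARD('n) / (reeb_volume CARD('n) smul gr \<xi> * real m ^ (CARD('n) + 1))
          * (\<Sum>j = 1..hilbert_fun smul gr \<xi> m. jumping_number smul gr \<xi> F m j))
    \<and> (\<lambda>m. 1 / (real m * real (hilbert_fun smul gr \<xi> m))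
          * (\<Sum>j = 1..hilbert_fun smul gr \<xi> m. jumping_number smul gr \<xi> F m j))
        \<longlonglongrightarrow> filtration_volume TYPE('n) smul gr \<xi> \<eta> x F"
proof -
  let ?n = "CARD('n)"
  interpret polarized_affine_variety smul gr \<mm> \<xi> by fact
  have "\<eta> \<in> Y" and reg: "regular_parameters \<eta> ?n x" using assms(4) by (auto simp: components_meet_at_def)
  have "proper_birational_model Y" using assms(3) by (simp add: log_resolution_def)
  then obtain \<A> where cover: "\<forall>A\<in>\<A>. \<exists>S. finite S \<and> A = generate_ring (ring_on UNIV) (range to_fract \<union> S)"
    "Y = (\<Union>A\<in>\<A>. spec_points A)"
    unfolding proper_birational_model_def by (elim conjE exE) auto
  \<comment> \<open>The point \<open>\<eta>\<close> is the localization of a chart of finite type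
    over \<open>R\<close> at a prime; hence it is a Noetherian local ring that contains
    \<open>R\<close>.\<close>
  then obtain A where "A \<in> \<A>" "\<eta> \<in> spec_points A" using \<open>\<eta> \<in> Y\<close> by blast
  then obtain S where A: "finite S" "A = generate_ring (ring_on UNIV) (range to_fract \<union> S)" "\<eta> \<in> spec_points A"
    using cover(1) by blast
  have NA: "noeth A" by (rule noeth_finite_type[OF A(1,2)])
  note As = noethD(1)[OF NA]
  obtain Q where Q: "\<eta> = localization_at A Q" "is_prime A Q"
    using A(3) primeideal_ring_on[OF As] by (auto simp: spec_points_def)
  have N: "noeth \<eta>" unfolding Q(1) by (rule noeth_localization[OF As Q(2) NA])
  have M: "is_ideal \<eta> (nonunits \<eta>)" unfolding Q(1) by (rule is_ideal_nonunits_localization[OF As Q(2)])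
  have n: "0 < ?n" by simp
  have R: "range to_fract \<subseteq> \<eta>"
    using generate_ring_ring_on(2)[of "range to_fract \<union> S"] is_subring_localization(2)[OF As Q(2)] A(2) Q(1) by blast
  interpret filtered_variety smul gr \<mm> \<xi> \<eta> x ?n F
  proof (intro filtered_variety.intro flag_variety.intro flag_ring.intro flag_variety_axioms.intro filtered_variety_axioms.intro)
    show "\<And>i. i \<le> ?n \<Longrightarrow> is_prime \<eta> (flag_ideal \<eta> x i)" "\<And>i. i < ?n \<Longrightarrow> x i \<notin> flag_ideal \<eta> x i"
      "flag_ideal \<eta> x ?n = nonunits \<eta>"
      using flag_ideals_prime[OF N M n reg] by auto
    show "\<And>i. i < ?n \<Longrightarrow> x i \<in> \<eta>" using reg by (auto simp: regular_parameters_def)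
  qed (use assms N M R n polarized_affine_variety_axioms in auto)
  show ?thesis using filtration_volume_limit[OF refl] by blast
qed

end
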